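(* Let $d$ be a degree and let $X$ be a $d$-large Banach space spanned by an FDD (i.e. having an FDD) in which every $d$-large Banach space is tight. Then $X$ is ergodic.
   Context: All Banach spaces are real. "Banach space" means infinite-dimensional Banach space and "subspace" means infinite-dimensional closed linear subspace, unless finite dimension is explicitly allowed. Degrees. An approximation pair is a pair $(X,F)$ where $X$ is a finite- or infinite-dimensional Banach space and $F$ is a finite-dimensional subspace of $X$. A morphism from $(X,F)$ to $(Y,G)$ is a pair $\varphi=(S,T)$ of bounded linear operators $S\colon G\to F$, $T\colon X\to Y$ such that $T(S(g))=g$ for all $g\in G$; its norm is $\|\varphi\|=\|S\|\cdot\|T\|$ if $G\neq\{0\}$ and $\|\varphi\|=1$ if $G=\{0\}$. A degree is a map $d$ assigning to every approximation pair $(X,F)$ a number $d(X,F)\in[0,\infty)$, for which there is a function $K_d\colon[1,\infty)\times[0,\infty)\to[0,\infty)$, non-decreasing in both variables, with $\lim_{s\to1}K_d(s,t)=t$ for all $t\ge 0$, such that $d(Y,G)\le K_d(\|\varphi\|,d(X,F))$ for every morphism $\varphi\colon(X,F)\to(Y,G)$. A space $X$ is $d$-small if $\sup_F d(X,F)<\infty$, the supremum being over all finite-dimensional subspaces $F$ of $X$, and $d$-large otherwise. FDDs and tightness. An FDD of a Banach space $X$ is a sequence $(F_n)_{n\in\mathbb N}$ of nonzero finite-dimensional subspaces of $X$ such that every $x\in X$ can be written uniquely as $x=\sum_{n}x_n$ with $x_n\in F_n$. For $B\subseteq\mathbb N$, $[F_n\mid n\in B]$ denotes the closed linear span of the $F_n$,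 $n\in B$. A Banach space $Z$ is tight in the FDD $(F_n)$ if there is an infinite sequence of nonempty intervals of integers $I_0<I_1<\cdots$ (where $I<J$ means every element of $I$ is less than every element of $J$) such that for every infinite $A\subseteq\mathbb N$, $Z$ does not embed isomorphically into $[F_n\mid n\notin\bigcup_{i\in A}I_i]$. Ergodicity. For separable $X$, let $\mathrm{Sub}(X)$ be the set of all closed linear subspaces of $X$ (finite- or infinite-dimensional) with the Effros Borel structure, i.e. the $\sigma$-algebra generated by the sets $\{Y\mid Y\cap U\neq\varnothing\}$, $U\subseteq X$ open; it is a standard Borel space. $\mathbf E_0$ is the equivalence relation on $\{0,1\}^{\mathbb N}$ relating two sequences iff they are eventually equal. A separable Banach space $X$ is ergodic if there is a Borel map $f\colon\{0,1\}^{\mathbb N}\to\mathrm{Sub}(X)$ such that for all $x,y$: $x\,\mathbf E_0\,y$ iff $f(x)$ and $f(y)$ are linearly isomorphic. *)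

theory Defs
  imports "HOL-Analysis.Analysis"
begin

text \<open>
  A normed space is a pair of a linear subspace \<open>V\<close> of a real vector space \<open>'u\<close> and a
  function \<open>N\<close> whose restriction to \<open>V\<close> is a norm; the values of \<open>N\<close> outside \<open>V\<close> are
  irrelevant. The type \<open>'u\<close> is a universe: up to isometry, the spaces it carries are all the
  normed spaces of algebraic dimension at most that of \<open>'u\<close>. In particular \<open>N\<close> is unrelated to
  any norm that the type \<open>'u\<close> may have, and \<open>V\<close> need not be closed for that norm.
\<close>

definition norm_on :: "'u::real_vector set \<Rightarrow> ('u \<Rightarrow> real) \<Rightarrow> bool" where
  "norm_on V N \<longleftrightarrow>
     (\<forall>x\<in>V. 0 \<le> N x \<and> (N x = 0 \<longleftrightarrow> x = 0)) \<and>
     (\<forall>c. \<forall>x\<in>V. N (c *\<^sub>R x) = \<bar>c\<bar> * N x) \<and>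
     (\<forall>x\<in>V. \<forall>y\<in>V. N (x + y) \<le> N x + N y)"

definition complete_on :: "'u::real_vector set \<Rightarrow> ('u \<Rightarrow> real) \<Rightarrow> bool" where
  "complete_on V N \<longleftrightarrow>
     (\<forall>s. (\<forall>n::nat. s n \<in> V) \<and>
          (\<forall>e>0. \<exists>k. \<forall>m\<ge>k. \<forall>n\<ge>k. N (s m - s n) < e) \<longrightarrow>
          (\<exists>l\<in>V. (\<lambda>n. N (s n - l)) \<longlonglongrightarrow> 0))"

text \<open>Finite dimension, including 0, is allowed in \<open>banach_on\<close>.\<close>

definition banach_on :: "'u::real_vector set \<Rightarrow> ('u \<Rightarrow> real) \<Rightarrow> bool" where
  "banach_on V N \<longleftrightarrow> subspace V \<and> norm_on V N \<and> complete_on V N"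

definition finite_dim :: "'u::real_vector set \<Rightarrow> bool" where
  "finite_dim V \<longleftrightarrow> (\<exists>B. finite B \<and> V \<subseteq> span B)"

definition fd_subspace :: "'u::real_vector set \<Rightarrow> 'u set \<Rightarrow> bool" where
  "fd_subspace F V \<longleftrightarrow> subspace F \<and> finite_dim F \<and> F \<subseteq> V"

definition linear_on :: "'u::real_vector set \<Rightarrow> ('u \<Rightarrow> 'v::real_vector) \<Rightarrow> bool" where
  "linear_on V T \<longleftrightarrow>
     (\<forall>x\<in>V. \<forall>y\<in>V. T (x + y) = T x + T y) \<and> (\<forall>c. \<forall>x\<in>V. T (c *\<^sub>R x) = c *\<^sub>R T x)"

definition bounded_op ::
  "'u::real_vector set \<Rightarrow> ('u \<Rightarrow> real) \<Rightarrow> 'v::real_vector set \<Rightarrow> ('v \<Rightarrow> real) \<Rightarrow> ('u \<Rightarrow> 'v) \<Rightarrow> bool"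
where
  "bounded_op V N W M T \<longleftrightarrow>
     linear_on V T \<and> T ` V \<subseteq> W \<and> (\<exists>C. \<forall>x\<in>V. M (T x) \<le> C * N x)"

text \<open>Relative version of \<open>onorm\<close>; as there, \<open>x = 0\<close> contributes \<open>0 / 0 = 0\<close>.\<close>

definition op_norm ::
  "'u set \<Rightarrow> ('u \<Rightarrow> real) \<Rightarrow> ('v \<Rightarrow> real) \<Rightarrow> ('u \<Rightarrow> 'v) \<Rightarrow> real" where
  "op_norm V N M T = (SUP x\<in>V. M (T x) / N x)"

definition isomorphic_on ::
  "'u::real_vector set \<Rightarrow> ('u \<Rightarrow> real) \<Rightarrow> 'v::real_vector set \<Rightarrow> ('v \<Rightarrow> real) \<Rightarrow> bool" where
  "isomorphic_on V N W M \<longleftrightarrow>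
     (\<exists>T S. bounded_op V N W M T \<and> bounded_op W M V N S \<and>
            (\<forall>x\<in>V. S (T x) = x) \<and> (\<forall>y\<in>W. T (S y) = y))"

text \<open>The image \<open>U\<close> is automatically closed when \<open>(V, N)\<close> is complete.\<close>

definition embeds_in ::
  "'u::real_vector set \<Rightarrow> ('u \<Rightarrow> real) \<Rightarrow> 'v::real_vector set \<Rightarrow> ('v \<Rightarrow> real) \<Rightarrow> bool" where
  "embeds_in V N W M \<longleftrightarrow> (\<exists>U. subspace U \<and> U \<subseteq> W \<and> isomorphic_on V N U M)"

definition approx_pair :: "'u::real_vector set \<Rightarrow> ('u \<Rightarrow> real) \<Rightarrow> 'u set \<Rightarrow> bool" where
  "approx_pair X N F \<longleftrightarrow> banach_on X N \<and> fd_subspace F X"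

definition approx_morphism ::
  "'u::real_vector set \<Rightarrow> ('u \<Rightarrow> real) \<Rightarrow> 'u set \<Rightarrow> 'u set \<Rightarrow> ('u \<Rightarrow> real) \<Rightarrow> 'u set \<Rightarrow>
   ('u \<Rightarrow> 'u) \<Rightarrow> ('u \<Rightarrow> 'u) \<Rightarrow> bool"
where
  "approx_morphism X N F Y M G S T \<longleftrightarrow>
     bounded_op G M F N S \<and> bounded_op X N Y M T \<and> (\<forall>g\<in>G. T (S g) = g)"

definition morphism_norm ::
  "'u::real_vector set \<Rightarrow> ('u \<Rightarrow> real) \<Rightarrow> ('u \<Rightarrow> real) \<Rightarrow> 'u set \<Rightarrow>
   ('u \<Rightarrow> 'u) \<Rightarrow> ('u \<Rightarrow> 'u) \<Rightarrow> real"
where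
  "morphism_norm X N M G S T =
     (if G = {0} then 1 else op_norm G M N S * op_norm X N M T)"

text \<open>
  \<open>d X N F\<close> is the degree of the approximation pair formed by the space \<open>(X, N)\<close> and \<open>F\<close>.
  Identity morphisms have norm at most 1 and \<open>K 1 t \<le> t\<close>, so \<open>d X N F\<close> automatically depends
  only on the values of \<open>N\<close> on \<open>X\<close>.
\<close>

definition is_degree ::
  "('u::real_vector set \<Rightarrow> ('u \<Rightarrow> real) \<Rightarrow> 'u set \<Rightarrow> real) \<Rightarrow> bool" where
  "is_degree d \<longleftrightarrow>
     (\<forall>X N F. approx_pair X N F \<longrightarrow> 0 \<le> d X N F) \<and>
     (\<exists>K :: real \<Rightarrow> real \<Rightarrow> real.
        (\<forall>s\<ge>1. \<forall>t\<ge>0. 0 \<le> K s t) \<and>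
        (\<forall>s s' t t'. 1 \<le> s \<and> s \<le> s' \<and> 0 \<le> t \<and> t \<le> t' \<longrightarrow> K s t \<le> K s' t') \<and>
        (\<forall>t\<ge>0. ((\<lambda>s. K s t) \<longlongrightarrow> t) (at_right 1)) \<and>
        (\<forall>X N F Y M G S T.
           approx_pair X N F \<and> approx_pair Y M G \<and> approx_morphism X N F Y M G S T \<longrightarrow>
           d Y M G \<le> K (morphism_norm X N M G S T) (d X N F)))"

definition d_small ::
  "('u::real_vector set \<Rightarrow> ('u \<Rightarrow> real) \<Rightarrow> 'u set \<Rightarrow> real) \<Rightarrow> 'u set \<Rightarrow> ('u \<Rightarrow> real) \<Rightarrow> bool"
where
  "d_small d X N \<longleftrightarrow> bdd_above {d X N F |F. fd_subspace F X}"

definition d_large ::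
  "('u::real_vector set \<Rightarrow> ('u \<Rightarrow> real) \<Rightarrow> 'u set \<Rightarrow> real) \<Rightarrow> 'u set \<Rightarrow> ('u \<Rightarrow> real) \<Rightarrow> bool"
where
  "d_large d X N \<longleftrightarrow> \<not> d_small d X N"

text \<open>
  The remaining notions concern a closed subspace \<open>X\<close> of a Banach space type, with the norm of
  that type.
\<close>

definition is_FDD :: "(nat \<Rightarrow> 'a::real_normed_vector set) \<Rightarrow> 'a set \<Rightarrow> bool" where
  "is_FDD F X \<longleftrightarrow>
     (\<forall>n. fd_subspace (F n) X \<and> F n \<noteq> {0}) \<and>
     (\<forall>x\<in>X. \<exists>!f. (\<forall>n. f n \<in> F n) \<and> f sums x)"

definition closed_span :: "(nat \<Rightarrow> 'a::real_normed_vector set) \<Rightarrow> nat set \<Rightarrow> 'a set" where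
  "closed_span F B = closure (span (\<Union>n\<in>B. F n))"

text \<open>
  In an infinite sequence \<open>I\<^sub>0 < I\<^sub>1 < \<dots>\<close> of nonempty intervals every interval is finite.
\<close>

definition tight_in ::
  "'u::real_vector set \<Rightarrow> ('u \<Rightarrow> real) \<Rightarrow> (nat \<Rightarrow> 'a::real_normed_vector set) \<Rightarrow> bool" where
  "tight_in Z N F \<longleftrightarrow>
     (\<exists>I :: nat \<Rightarrow> nat set.
        (\<forall>k. \<exists>a b. a \<le> b \<and> I k = {a..b}) \<and>
        (\<forall>j k. j < k \<longrightarrow> (\<forall>m\<in>I j. \<forall>n\<in>I k. m < n)) \<and>
        (\<forall>A. infinite A \<longrightarrow> \<not> embeds_in Z N (closed_span F (- (\<Union>i\<in>A. I i))) norm))"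

definition Sub :: "'a::real_normed_vector set \<Rightarrow> 'a set set" where
  "Sub X = {Y. subspace Y \<and> closed Y \<and> Y \<subseteq> X}"

definition effros :: "'a::real_normed_vector set \<Rightarrow> 'a set measure" where
  "effros X = sigma (Sub X) {{Y \<in> Sub X. Y \<inter> U \<noteq> {}} |U. openin (top_of_set X) U}"

definition E0 :: "(nat \<Rightarrow> bool) \<Rightarrow> (nat \<Rightarrow> bool) \<Rightarrow> bool" where
  "E0 x y \<longleftrightarrow> (\<forall>\<^sub>F n in sequentially. x n = y n)"

text \<open>
  The Cantor space is \<open>nat \<Rightarrow> bool\<close>; its \<open>borel\<close> is that of the product topology with \<open>bool\<close>
  discrete.
\<close>

definition ergodic :: "'a::real_normed_vector set \<Rightarrow> bool" where
  "ergodic X \<longleftrightarrow>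
     (\<exists>D. countable D \<and> D \<subseteq> X \<and> X \<subseteq> closure D) \<and>
     (\<exists>f \<in> measurable (borel :: (nat \<Rightarrow> bool) measure) (effros X).
        \<forall>x y. E0 x y \<longleftrightarrow> isomorphic_on (f x) norm (f y) norm)"

end

theory Submission
  imports Defs
begin

text \<open>
  For \<open>A \<subseteq> \<nat>\<close> write \<open>X\<^sub>A\<close> for the closed span of the blocks \<open>F\<^sub>n\<close>, \<open>n \<in> A\<close>, and let \<open>R\<close> be the set
  of pairs \<open>(A, B)\<close> of points of the Cantor space such that \<open>X\<^sub>A\<close> embeds into \<open>X\<^sub>B\<close>. The proof
  shows that \<open>R\<close> is meager and then builds a copy of \<open>E\<^sub>0\<close> that avoids \<open>R\<close>.

  \<^item> \<^emph>\<open>Generic spaces are large.\<close> Since \<open>X\<close> is \<open>d\<close>-large, after every \<open>n\<close> there are intervals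
    \<open>{n..<m}\<close> such that \<open>d\<close> takes a prescribed large value on every \<open>X\<^sub>A\<close> with \<open>{n..<m} \<subseteq> A\<close>
    (\<open>large_on_blocks\<close>); the bounds in the proof rest on the uniform boundedness of the partial
    sum projections (\<open>P_bounded\<close>). A generic \<open>A\<close> contains such an interval for each of the values
    \<open>1, 2, \<dots>\<close>, so \<open>X\<^sub>A\<close> is \<open>d\<close>-large (\<open>nonlarge_meager\<close>).
  \<^item> \<^emph>\<open>Sections are meager.\<close> For such an \<open>A\<close> the space \<open>X\<^sub>A\<close> is tight, so any \<open>B\<close> with \<open>(A, B) \<in> R\<close>
    meets all but finitely many members of a sequence of intervals that depends only on \<open>A\<close>.
    These \<open>B\<close> form a meager set (\<open>tight_sections_meager\<close>).
  \<^item> \<^emph>\<open>The relation is meager.\<close> Passing from sections to \<open>R\<close> itself needs the Baire property of \<open>R\<close>.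
    An embedding of \<open>X\<^sub>A\<close> is determined by its values on a countable set of finitely supported
    vectors, and these values can be coded by a sequence of indices of approximations. Thus \<open>R\<close> is
    a countable union of projections of closed subsets of \<open>2\<^sup>\<nat> \<times> 2\<^sup>\<nat> \<times> \<nat>\<^sup>\<nat>\<close>
    (\<open>embeds_iff_coded\<close>), and the Kuratowski-Ulam argument applies to such projections
    (\<open>Suslin_meager_by_sections\<close>).
  \<^item> \<^emph>\<open>The reduction.\<close> Let \<open>R\<close> be contained in the union of an increasing sequence of closed nowhere
    dense sets \<open>N\<^sub>n\<close>. Cut \<open>\<nat>\<close> into consecutive intervals and prepare on the \<open>n\<close>-th one two patterns
    of subspaces of the \<open>F\<^sub>j\<close>; the \<open>n\<close>-th digit of \<open>\<alpha>\<close> selects one of them, and \<open>f \<alpha>\<close> is the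
    closed span of all the selected subspaces. The patterns are such that
    \<open>f \<alpha>\<close> contains \<open>X\<^sub>A\<close> and \<open>f \<beta>\<close> lies in \<open>X\<^sub>B\<close> for some \<open>(A, B) \<notin> N\<^sub>n\<close> whenever the \<open>n\<close>-th digits
    of \<open>\<alpha>\<close> and \<open>\<beta>\<close> are 1 and 0. Infinitely many different digits therefore exclude an
    isomorphism, after exchanging \<open>\<alpha>\<close> and \<open>\<beta>\<close> if necessary.
    Conversely, the two patterns on an interval have the same total dimension, so that finitely many
    different digits only replace a finite-dimensional summand by another one of the same dimension
    (\<open>isomorphic_of_equal_heads\<close>).

  Blocks \<open>F\<^sub>j\<close> may have pairwise different dimensions, so two sets of indices that differ finitely
  need not have finite parts of equal dimension. This is why the patterns also use lines inside the
  \<open>F\<^sub>j\<close>, and why two sets \<open>A\<close> and \<open>B\<close> (the blocks used fully, and the blocks used at all) are attached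
  to each pattern.
\<close>

section \<open>Category in the Cantor space\<close>

text \<open>
  The points \<open>y\<close> with \<open>agree n x y\<close> form the basic neighbourhoods of \<open>x\<close>; openness
  in the Cantor space becomes a statement about finite initial segments.
\<close>

definition agree :: "nat \<Rightarrow> (nat \<Rightarrow> 'a) \<Rightarrow> (nat \<Rightarrow> 'a) \<Rightarrow> bool" where
  "agree n x y \<longleftrightarrow> (\<forall>i<n. y i = x i)"

instance bool :: second_countable_topology
proof
  have "generate_topology UNIV U" for U :: "bool set"
    by (rule generate_topology.Basis) simp
  then have "open = generate_topology (UNIV :: bool set set)"
    by (auto simp: fun_eq_iff open_discrete)
  then show "\<exists>B::bool set set. countable B \<and> open = generate_topology B"
    by (intro exI[of _ UNIV]) simp
qed

lemma agree_refl [simp]: "agree n x x"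
  by (simp add: agree_def)

lemma agree_mono: "agree n x y \<Longrightarrow> m \<le> n \<Longrightarrow> agree m x y"
  by (auto simp: agree_def)

lemma open_agree: "open {y::nat \<Rightarrow> bool. agree n x y}"
proof -
  have "open {f::nat \<Rightarrow> bool. \<forall>i\<in>{..<n}. f (id i) \<in> {x i}}"
    by (rule product_topology_basis') (auto intro: open_discrete)
  then show ?thesis by (simp add: agree_def Ball_def)
qed

lemma open_cantor_iff:
  "open (U :: (nat \<Rightarrow> bool) set) \<longleftrightarrow> (\<forall>x\<in>U. \<exists>n. \<forall>y. agree n x y \<longrightarrow> y \<in> U)"
proof
  assume U: "open U"
  show "\<forall>x\<in>U. \<exists>n. \<forall>y. agree n x y \<longrightarrow> y \<in> U"
  proof
    fix x assume "x \<in> U"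
    have "openin (product_topology (\<lambda>i. euclidean) UNIV) U"
      using U by (simp add: open_fun_def)
    from product_topology_open_contains_basis[OF this \<open>x \<in> U\<close>]
    obtain B where B: "x \<in> (\<Pi>\<^sub>E i\<in>UNIV. B i)" "finite {i. B i \<noteq> (UNIV::bool set)}"
      "(\<Pi>\<^sub>E i\<in>UNIV. B i) \<subseteq> U" by auto
    from B(2) obtain n where n: "\<forall>i\<in>{i. B i \<noteq> UNIV}. i < n"
      using finite_nat_set_iff_bounded by auto
    have "y \<in> U" if "agree n x y" for y
    proof -
      have "y i \<in> B i" for i
      proof (cases "i < n")
        case True
        then have "y i = x i" using that by (simp add: agree_def)
        then show ?thesis using B(1) by (auto simp: PiE_iff)
      next
        case False
        then have "B i = UNIV" using n by auto
        then show ?thesis by simp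
      qed
      then show ?thesis using B(3) by auto
    qed
    then show "\<exists>n. \<forall>y. agree n x y \<longrightarrow> y \<in> U" by blast
  qed
next
  assume *: "\<forall>x\<in>U. \<exists>n. \<forall>y. agree n x y \<longrightarrow> y \<in> U"
  show "open U"
  proof (subst open_subopen, intro ballI)
    fix x assume "x \<in> U"
    with * obtain n where "\<forall>y. agree n x y \<longrightarrow> y \<in> U" by blast
    then show "\<exists>T. open T \<and> x \<in> T \<and> T \<subseteq> U"
      by (intro exI[of _ "{y. agree n x y}"]) (auto simp: open_agree)
  qed
qed

lemma open_cantor2_iff:
  "open (U :: ((nat \<Rightarrow> bool) \<times> (nat \<Rightarrow> bool)) set) \<longleftrightarrow>
     (\<forall>a b. (a, b) \<in> U \<longrightarrow> (\<exists>n. \<forall>a' b'. agree n a a' \<and> agree n b b' \<longrightarrow> (a', b') \<in> U))"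
proof
  assume U: "open U"
  show "\<forall>a b. (a, b) \<in> U \<longrightarrow> (\<exists>n. \<forall>a' b'. agree n a a' \<and> agree n b b' \<longrightarrow> (a', b') \<in> U)"
  proof (intro allI impI)
    fix a b assume "(a, b) \<in> U"
    then obtain A B where AB: "open A" "open B" "a \<in> A" "b \<in> B" "A \<times> B \<subseteq> U"
      using U unfolding open_prod_def by fastforce
    obtain m where m: "\<forall>y. agree m a y \<longrightarrow> y \<in> A"
      using AB by (auto simp: open_cantor_iff)
    obtain n where n: "\<forall>y. agree n b y \<longrightarrow> y \<in> B"
      using AB by (auto simp: open_cantor_iff)
    show "\<exists>n. \<forall>a' b'. agree n a a' \<and> agree n b b' \<longrightarrow> (a', b') \<in> U"
      using m n AB(5) by (intro exI[of _ "max m n"]) (auto dest: agree_mono[OF _ max.cobounded1] agree_mono[OF _ max.cobounded2])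
  qed
next
  assume *: "\<forall>a b. (a, b) \<in> U \<longrightarrow> (\<exists>n. \<forall>a' b'. agree n a a' \<and> agree n b b' \<longrightarrow> (a', b') \<in> U)"
  show "open U"
    unfolding open_prod_def
  proof (intro ballI)
    fix x assume "x \<in> U"
    then obtain n where "\<forall>a' b'. agree n (fst x) a' \<and> agree n (snd x) b' \<longrightarrow> (a', b') \<in> U"
      using * by (metis prod.collapse)
    then show "\<exists>A B. open A \<and> open B \<and> x \<in> A \<times> B \<and> A \<times> B \<subseteq> U"
      by (intro exI[of _ "{y. agree n (fst x) y}"] exI[of _ "{y. agree n (snd x) y}"])
        (auto simp: open_agree mem_Times_iff)
  qed
qed

definition meager :: "'a::topological_space set \<Rightarrow> bool" where
  "meager S \<longleftrightarrow> (\<exists>\<G>. countable \<G> \<and> (\<forall>T\<in>\<G>. closed T \<and> interior T = {}) \<and> S \<subseteq> \<Union>\<G>)"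

lemma meager_subset: "meager T \<Longrightarrow> S \<subseteq> T \<Longrightarrow> meager S"
  unfolding meager_def by (meson subset_trans)

lemma meager_Union:
  assumes "countable \<A>" "\<And>S. S \<in> \<A> \<Longrightarrow> meager S"
  shows "meager (\<Union>\<A>)"
proof -
  have "\<forall>S\<in>\<A>. \<exists>\<G>. countable \<G> \<and> (\<forall>T\<in>\<G>. closed T \<and> interior T = {}) \<and> S \<subseteq> \<Union>\<G>"
    using assms(2) by (simp add: meager_def)
  then obtain G where G: "\<forall>S\<in>\<A>. countable (G S) \<and> (\<forall>T\<in>G S. closed T \<and> interior T = {}) \<and> S \<subseteq> \<Union>(G S)"
    by metis
  show ?thesis unfolding meager_def
    using assms(1) G by (intro exI[of _ "\<Union>(G ` \<A>)"]) (auto, blast)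
qed

lemma meager_UN:
  fixes f :: "'i::countable \<Rightarrow> 'a::topological_space set"
  shows "(\<And>i. meager (f i)) \<Longrightarrow> meager (\<Union>i. f i)"
  by (rule meager_Union) auto

lemma meager_Un: "meager S \<Longrightarrow> meager T \<Longrightarrow> meager (S \<union> T)"
  using meager_Union[of "{S, T}"] by auto

lemma meager_closed: "closed T \<Longrightarrow> interior T = {} \<Longrightarrow> meager T"
  unfolding meager_def by (intro exI[of _ "{T}"]) auto

lemma open_cantor_not_meager:
  fixes U :: "(nat \<Rightarrow> bool) set"
  assumes "open U" "U \<noteq> {}"
  shows "\<not> meager U"
proof
  assume "meager U"
  then obtain \<G> where G: "countable \<G>" "\<And>T. T \<in> \<G> \<Longrightarrow> closed T \<and> interior T = {}" "U \<subseteq> \<Union>\<G>"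
    unfolding meager_def by blast
  have "compact_space (euclidean :: bool topology)"
    by (simp add: compact_space_def finite_imp_compact)
  then have "compact_space (product_topology (\<lambda>i::nat. euclidean :: bool topology) UNIV)"
    by (simp add: compact_space_product_topology)
  then have c: "compact_space (euclidean :: (nat \<Rightarrow> bool) topology)"
    by (simp only: euclidean_product_topology)
  have h: "Hausdorff_space (euclidean :: (nat \<Rightarrow> bool) topology)"
  proof -
    have "Hausdorff_space (euclidean :: bool topology)"
      unfolding Hausdorff_space_def by (simp add: disjnt_def) (metis separation_t2)
    then have "Hausdorff_space (product_topology (\<lambda>i::nat. euclidean :: bool topology) UNIV)"
      by (simp add: Hausdorff_space_product_topology)
    then show ?thesis by (simp only: euclidean_product_topology)
  qed
  have "euclidean interior_of \<Union>\<G> = {}"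
    by (rule Baire_category_alt)
      (use c h G compact_imp_locally_compact_space compact_Hausdorff_imp_regular_space in auto)
  then have "interior (\<Union>\<G>) = {}" by simp
  then show False using assms G(3) by (metis interior_maximal subset_empty)
qed

text \<open>
  Let \<open>D u\<close> be the set of points all of whose neighbourhoods meet \<open>R u\<close> in a nonmeager set. Up to meager sets,
  \<open>R u\<close> lies in \<open>D u\<close>, and \<open>D u\<close> is covered by the interiors of the sets \<open>D (u @ [k])\<close>: a nonempty
  open set that these interiors miss would meet each \<open>R (u @ [k])\<close>, and hence \<open>R u\<close>, in a meager
  set. So outside one meager set every point of \<open>D []\<close> can be followed along an infinite branch.
  For the scheme of projections of a closed set the branch yields a preimage of the point: the lemma is the
  part of the Baire property of analytic sets that is needed below.
\<close>

lemma baire_property_of_Suslin_scheme: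
  fixes R :: "nat list \<Rightarrow> 'a::second_countable_topology set"
  assumes split: "\<And>u. R u \<subseteq> (\<Union>k. R (u @ [k]))" and "\<not> meager (R [])"
  shows "\<exists>V. open V \<and> V \<noteq> {} \<and>
           meager (V - {p. \<exists>\<sigma>. \<forall>n. p \<in> closure (R (map \<sigma> [0..<n]))})"
proof -
  define D where "D u = {p. \<forall>U. open U \<and> p \<in> U \<longrightarrow> \<not> meager (R u \<inter> U)}" for u
  obtain \<B> :: "'a set set" where B: "countable \<B>" "topological_basis \<B>"
    using ex_countable_basis by blast
  have clD: "closed (D u)" for u
  proof -
    have "open (- D u)"
    proof (subst open_subopen, intro ballI)
      fix x assume "x \<in> - D u"
      then obtain U where "open U" "x \<in> U" "meager (R u \<inter> U)" by (auto simp: D_def)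
      then show "\<exists>T. open T \<and> x \<in> T \<and> T \<subseteq> - D u"
        by (intro exI[of _ U]) (auto simp: D_def)
    qed
    then show ?thesis by (simp add: open_closed)
  qed
  have RD: "meager (R u - D u)" for u
  proof -
    have "meager ((\<Union>U\<in>{U \<in> \<B>. meager (R u \<inter> U)}. R u \<inter> U))"
      by (rule meager_Union) (use B in auto)
    moreover have "R u - D u \<subseteq> (\<Union>U\<in>{U \<in> \<B>. meager (R u \<inter> U)}. R u \<inter> U)"
    proof
      fix x assume "x \<in> R u - D u"
      then obtain U where U: "open U" "x \<in> U" "meager (R u \<inter> U)" "x \<in> R u" by (auto simp: D_def)
      obtain U' where "U' \<in> \<B>" "x \<in> U'" "U' \<subseteq> U"
        using topological_basisE[OF B(2) U(1,2)] by blast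
      moreover then have "meager (R u \<inter> U')" using U(3) by (auto elim: meager_subset)
      ultimately show "x \<in> (\<Union>U\<in>{U \<in> \<B>. meager (R u \<inter> U)}. R u \<inter> U)" using U by blast
    qed
    ultimately show ?thesis by (rule meager_subset)
  qed
  have DR: "D u \<subseteq> closure (R u)" for u
  proof
    fix p assume p: "p \<in> D u"
    show "p \<in> closure (R u)"
    proof (rule ccontr)
      assume "p \<notin> closure (R u)"
      then have "\<not> meager (R u \<inter> - closure (R u))"
        using p open_Compl[OF closed_closure[of "R u"]] by (auto simp: D_def)
      moreover have "R u \<inter> - closure (R u) = {}" using closure_subset by auto
      moreover have "meager ({}::'a set)" by (rule meager_closed) auto
      ultimately show False by simp
    qed
  qed
  define G where "G u = (\<Union>k. interior (D (u @ [k])))" for u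
  have frontier: "meager (D u - interior (D u))" for u
  proof -
    have "interior (D u - interior (D u)) = {}"
      using interior_mono[of "D u - interior (D u)" "D u"] interior_subset[of "D u - interior (D u)"] by blast
    then show ?thesis using clD[of u] by (intro meager_closed) auto
  qed
  have nd: "meager (D u - G u)" for u
  proof (rule meager_closed)
    show "closed (D u - G u)" using clD[of u] by (auto simp: G_def)
    show "interior (D u - G u) = {}"
    proof (rule ccontr)
      assume "interior (D u - G u) \<noteq> {}"
      then obtain p where p: "p \<in> interior (D u - G u)" by blast
      let ?O = "interior (D u - G u)"
      have "p \<in> D u" using p interior_subset by blast
      then have "\<not> meager (R u \<inter> ?O)" using p by (auto simp: D_def)
      moreover have "R u \<inter> ?O \<subseteq> (\<Union>k. (R (u @ [k]) - D (u @ [k])) \<union> (D (u @ [k]) - interior (D (u @ [k]))))"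
      proof
        fix x assume x: "x \<in> R u \<inter> ?O"
        then obtain k where "x \<in> R (u @ [k])" using split by blast
        moreover have "x \<notin> interior (D (u @ [k]))"
          using x interior_subset unfolding G_def by blast
        ultimately show "x \<in> (\<Union>k. (R (u @ [k]) - D (u @ [k])) \<union> (D (u @ [k]) - interior (D (u @ [k]))))"
          by blast
      qed
      moreover have "meager (\<Union>k. (R (u @ [k]) - D (u @ [k])) \<union> (D (u @ [k]) - interior (D (u @ [k]))))"
        by (intro meager_UN meager_Un RD frontier)
      ultimately show False using meager_subset by blast
    qed
  qed
  define Mg where "Mg = (\<Union>u. D u - G u)"
  have Mg: "meager Mg" unfolding Mg_def by (intro meager_UN nd)
  have "interior (D []) \<noteq> {}"
  proof
    assume "interior (D []) = {}"
    then have "meager (D [])" using clD by (intro meager_closed) auto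
    then have "meager ((R [] - D []) \<union> D [])" using RD by (intro meager_Un)
    then show False using assms(2) meager_subset[of _ "R []"] by blast
  qed
  moreover have "p \<in> {p. \<exists>\<sigma>. \<forall>n. p \<in> closure (R (map \<sigma> [0..<n]))}"
    if p: "p \<in> interior (D []) - Mg" for p
  proof -
    have step: "\<exists>k. p \<in> D (u @ [k])" if "p \<in> D u" for u
    proof -
      have "p \<in> G u" using p that by (auto simp: Mg_def)
      then show ?thesis unfolding G_def using interior_subset by blast
    qed
    have "\<exists>us. \<forall>n. (length (us n) = n \<and> p \<in> D (us n)) \<and> (\<exists>k. us (Suc n) = us n @ [k])"
    proof (rule dependent_nat_choice)
      show "\<exists>u. length u = 0 \<and> p \<in> D u"
        using p interior_subset by (intro exI[of _ "[]"]) auto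
      show "\<exists>v. (length v = Suc n \<and> p \<in> D v) \<and> (\<exists>k. v = u @ [k])" if u: "length u = n \<and> p \<in> D u" for u n
      proof -
        obtain k where "p \<in> D (u @ [k])" using step[of u] u by blast
        then show ?thesis using u by (intro exI[of _ "u @ [k]"]) auto
      qed
    qed
    then obtain us where us: "\<And>n. length (us n) = n" "\<And>n. p \<in> D (us n)" "\<And>n. \<exists>k. us (Suc n) = us n @ [k]"
      by blast
    define \<sigma> where "\<sigma> n = us (Suc n) ! n" for n
    have "us n = map \<sigma> [0..<n]" for n
    proof (induction n)
      case 0
      then show ?case using us(1)[of 0] by simp
    next
      case (Suc n)
      obtain k where k: "us (Suc n) = us n @ [k]" using us(3) by blast
      then have "\<sigma> n = k" using us(1)[of n] by (simp add: \<sigma>_def nth_append)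
      then show ?case using k Suc by simp
    qed
    then have "p \<in> closure (R (map \<sigma> [0..<n]))" for n
      using us(2)[of n] DR by (metis subsetD)
    then show ?thesis by blast
  qed
  ultimately show ?thesis
    by (intro exI[of _ "interior (D [])"] conjI) (auto intro: meager_subset[OF Mg])
qed

text \<open>
  If a section of \<open>N\<close> has interior, it contains a member \<open>U\<close> of a countable base, and the
  points whose section contains a fixed \<open>U\<close> form a closed set \<open>E\<close> with \<open>E \<times> U \<subseteq> N\<close>.
\<close>

lemma sections_of_closed_nowhere_dense:
  fixes N :: "('a::topological_space \<times> 'b::second_countable_topology) set"
  assumes "closed N" "interior N = {}"
  shows "meager {x. interior {y. (x, y) \<in> N} \<noteq> {}}"
proof -
  obtain \<B> :: "'b set set" where B: "countable \<B>" "topological_basis \<B>"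
    using ex_countable_basis by blast
  define E where "E U = {x. \<forall>y\<in>U. (x, y) \<in> N}" for U
  have "meager (E U)" if U: "U \<in> \<B> - {{}}" for U
  proof (rule meager_closed)
    have "closed ((\<lambda>x. (x, y)) -` N)" for y
      by (intro closed_vimage assms continuous_intros)
    moreover have "E U = (\<Inter>y\<in>U. (\<lambda>x. (x, y)) -` N)" by (auto simp: E_def)
    ultimately show "closed (E U)" by auto
    have "interior (E U) \<times> U \<subseteq> N" using interior_subset by (auto simp: E_def)
    moreover have "open (interior (E U) \<times> U)"
      using U B(2) topological_basis_open by (intro open_Times) auto
    ultimately have "interior (E U) \<times> U \<subseteq> interior N" by (rule interior_maximal)
    then show "interior (E U) = {}" using assms(2) U by auto
  qed
  then have "meager (\<Union>(E ` (\<B> - {{}})))"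
    using B by (intro meager_Union) auto
  moreover have "{x. interior {y. (x, y) \<in> N} \<noteq> {}} \<subseteq> \<Union>(E ` (\<B> - {{}}))"
  proof
    fix x assume "x \<in> {x. interior {y. (x, y) \<in> N} \<noteq> {}}"
    then obtain y where y: "y \<in> interior {y. (x, y) \<in> N}" by blast
    obtain U where "U \<in> \<B>" "y \<in> U" "U \<subseteq> interior {y. (x, y) \<in> N}"
      using topological_basisE[OF B(2) open_interior y] by blast
    then show "x \<in> \<Union>(E ` (\<B> - {{}}))" using interior_subset by (auto simp: E_def)
  qed
  ultimately show ?thesis by (rule meager_subset)
qed

text \<open>
  The elementary half of the Kuratowski-Ulam theorem.
\<close>

lemma sections_of_meager:
  fixes M :: "('a::topological_space \<times> 'b::second_countable_topology) set"
  assumes "meager M"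
  shows "meager {x. \<not> meager {y. (x, y) \<in> M}}"
proof -
  obtain \<G> where G: "countable \<G>" "\<And>T. T \<in> \<G> \<Longrightarrow> closed T \<and> interior T = {}" "M \<subseteq> \<Union>\<G>"
    using assms unfolding meager_def by blast
  have "meager (\<Union>N\<in>\<G>. {x. interior {y. (x, y) \<in> N} \<noteq> {}})"
    using G by (intro meager_Union) (auto intro: sections_of_closed_nowhere_dense)
  moreover have "{x. \<not> meager {y. (x, y) \<in> M}} \<subseteq> (\<Union>N\<in>\<G>. {x. interior {y. (x, y) \<in> N} \<noteq> {}})"
  proof (rule subsetI, rule ccontr)
    fix x assume x: "x \<in> {x. \<not> meager {y. (x, y) \<in> M}}"
      and "x \<notin> (\<Union>N\<in>\<G>. {x. interior {y. (x, y) \<in> N} \<noteq> {}})"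
    then have e: "interior {y. (x, y) \<in> N} = {}" if "N \<in> \<G>" for N using that by blast
    have c: "closed {y. (x, y) \<in> N}" if "N \<in> \<G>" for N
    proof -
      have "closed (Pair x -` N)" using G(2)[OF that] by (intro closed_vimage continuous_intros) auto
      then show ?thesis by (simp add: vimage_def)
    qed
    have "meager (\<Union>N\<in>\<G>. {y. (x, y) \<in> N})"
      using G e c by (intro meager_Union) (auto intro: meager_closed)
    moreover have "{y. (x, y) \<in> M} \<subseteq> (\<Union>N\<in>\<G>. {y. (x, y) \<in> N})" using G(3) by blast
    ultimately show False using x meager_subset by blast
  qed
  ultimately show ?thesis by (rule meager_subset)
qed

text \<open>
  The converse half of Kuratowski-Ulam for projections of closed sets. If the projection were not
  meager, it would be comeager in a nonempty open rectangle, and then generic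
  sections would be comeager in the second side of the rectangle instead of meager.
\<close>

theorem Suslin_meager_by_sections:
  fixes W :: "((nat \<Rightarrow> bool) \<times> (nat \<Rightarrow> bool) \<times> (nat \<Rightarrow> nat)) set"
  assumes closed: "\<And>a b \<sigma>. (\<And>n. \<exists>a' b' \<sigma>'. agree n a a' \<and> agree n b b' \<and> agree n \<sigma> \<sigma>' \<and> (a', b', \<sigma>') \<in> W)
              \<Longrightarrow> (a, b, \<sigma>) \<in> W"
    and sections: "meager {a. \<not> meager {b. \<exists>\<sigma>. (a, b, \<sigma>) \<in> W}}"
  shows "meager {(a, b). \<exists>\<sigma>. (a, b, \<sigma>) \<in> W}"
proof (rule ccontr)
  assume nm: "\<not> meager {(a, b). \<exists>\<sigma>. (a, b, \<sigma>) \<in> W}"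
  define R where "R u = {(a, b). \<exists>\<sigma>. (a, b, \<sigma>) \<in> W \<and> map \<sigma> [0..<length u] = u}" for u
  have split: "R u \<subseteq> (\<Union>k. R (u @ [k]))" for u by (auto simp: R_def)
  have "R [] = {(a, b). \<exists>\<sigma>. (a, b, \<sigma>) \<in> W}" by (simp add: R_def)
  with nm have "\<not> meager (R [])" by simp
  from baire_property_of_Suslin_scheme[of R, OF split this]
  obtain V where V: "open V" "V \<noteq> {}"
    and mV: "meager (V - {p. \<exists>\<sigma>. \<forall>n. p \<in> closure (R (map \<sigma> [0..<n]))})" by blast
  have lim: "\<exists>\<sigma>. (a, b, \<sigma>) \<in> W" if "\<forall>n. (a, b) \<in> closure (R (map \<sigma> [0..<n]))" for a b \<sigma>
  proof
    show "(a, b, \<sigma>) \<in> W"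
    proof (rule closed)
      fix n
      let ?U = "{a'. agree n a a'} \<times> {b'. agree n b b'}"
      have "open ?U" by (intro open_Times open_agree)
      moreover have "(a, b) \<in> ?U" by simp
      ultimately have "R (map \<sigma> [0..<n]) \<inter> ?U \<noteq> {}"
        using that open_Int_closure_eq_empty[of ?U] by blast
      then obtain a' b' where ab: "(a', b') \<in> R (map \<sigma> [0..<n])" "agree n a a'" "agree n b b'" by blast
      then obtain \<sigma>' where s: "(a', b', \<sigma>') \<in> W" "map \<sigma>' [0..<n] = map \<sigma> [0..<n]"
        by (auto simp: R_def)
      have "agree n \<sigma> \<sigma>'" using s(2) by (auto simp: agree_def)
      with ab s show "\<exists>a' b' \<sigma>'. agree n a a' \<and> agree n b b' \<and> agree n \<sigma> \<sigma>' \<and> (a', b', \<sigma>') \<in> W" by blast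
    qed
  qed
  define M where "M = V - {(a, b). \<exists>\<sigma>. (a, b, \<sigma>) \<in> W}"
  have "meager M"
    by (rule meager_subset[OF mV]) (use lim in \<open>auto simp: M_def\<close>)
  then have mM: "meager {x. \<not> meager {y. (x, y) \<in> M}}" by (rule sections_of_meager)
  obtain A B where AB: "open A" "open B" "A \<noteq> {}" "B \<noteq> {}" "A \<times> B \<subseteq> V"
    using V unfolding open_prod_def by fastforce
  have "\<not> meager A" using AB open_cantor_not_meager by blast
  moreover have "meager ({x. \<not> meager {y. (x, y) \<in> M}} \<union> {a. \<not> meager {b. \<exists>\<sigma>. (a, b, \<sigma>) \<in> W}})"
    using mM sections by (rule meager_Un)
  ultimately obtain a where a: "a \<in> A" "meager {y. (a, y) \<in> M}" "meager {b. \<exists>\<sigma>. (a, b, \<sigma>) \<in> W}"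
    using meager_subset by (metis (mono_tags, lifting) UnI1 UnI2 mem_Collect_eq subsetI)
  have "B \<subseteq> {y. (a, y) \<in> M} \<union> {b. \<exists>\<sigma>. (a, b, \<sigma>) \<in> W}"
    using AB(5) a(1) by (auto simp: M_def)
  then have "meager B" using a meager_Un meager_subset by blast
  then show False using AB open_cantor_not_meager by blast
qed

section \<open>Finite-dimensional subspaces of normed spaces\<close>

text \<open>
  A convergent sequence in the span has Cauchy, hence convergent, coefficients.
\<close>

lemma closed_span_of_coeff_bound:
  fixes B :: "'a::real_normed_vector set"
  assumes fin: "finite B" and C: "\<And>a. (\<Sum>b\<in>B. \<bar>a b\<bar>) \<le> C * norm (\<Sum>b\<in>B. a b *\<^sub>R b)"
  shows "closed (span B)"
  unfolding closed_sequential_limits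
proof (intro allI impI)
  fix x l assume *: "(\<forall>n. x n \<in> span B) \<and> x \<longlonglongrightarrow> l"
  then have "\<forall>n. \<exists>a. x n = (\<Sum>b\<in>B. a b *\<^sub>R b)" by (auto simp: span_finite[OF fin])
  then obtain a where a: "\<And>n. x n = (\<Sum>b\<in>B. a n b *\<^sub>R b)" by metis
  have cau: "Cauchy x" using * by (auto intro: LIMSEQ_imp_Cauchy)
  have "convergent (\<lambda>n. a n b)" if b: "b \<in> B" for b
  proof -
    have d: "\<bar>a m b - a n b\<bar> \<le> \<bar>C\<bar> * norm (x m - x n)" for m n
    proof -
      have "\<bar>a m b - a n b\<bar> \<le> (\<Sum>b\<in>B. \<bar>a m b - a n b\<bar>)"
        using b fin by (intro member_le_sum) auto
      also have "\<dots> \<le> C * norm (\<Sum>b\<in>B. (a m b - a n b) *\<^sub>R b)" by (rule C)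
      also have "(\<Sum>b\<in>B. (a m b - a n b) *\<^sub>R b) = x m - x n"
        by (simp add: a scaleR_left_diff_distrib sum_subtractf)
      also have "C * norm (x m - x n) \<le> \<bar>C\<bar> * norm (x m - x n)" by (intro mult_right_mono) auto
      finally show ?thesis .
    qed
    have "Cauchy (\<lambda>n. a n b)"
      unfolding Cauchy_iff
    proof (intro allI impI)
      fix e :: real assume "0 < e"
      then have "0 < e / (\<bar>C\<bar> + 1)" by simp
      then obtain M where M: "\<And>m n. m \<ge> M \<Longrightarrow> n \<ge> M \<Longrightarrow> norm (x m - x n) < e / (\<bar>C\<bar> + 1)"
        using cau unfolding Cauchy_iff by blast
      show "\<exists>M. \<forall>m\<ge>M. \<forall>n\<ge>M. norm (a m b - a n b) < e"
      proof (intro exI allI impI)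
        fix m n assume "m \<ge> M" "n \<ge> M"
        then have "norm (x m - x n) < e / (\<bar>C\<bar> + 1)" by (rule M)
        then have "(\<bar>C\<bar> + 1) * norm (x m - x n) < e" by (simp add: pos_less_divide_eq mult.commute)
        moreover have "\<bar>C\<bar> * norm (x m - x n) \<le> (\<bar>C\<bar> + 1) * norm (x m - x n)"
          by (intro mult_right_mono) auto
        ultimately show "norm (a m b - a n b) < e" using d[of m n] by simp
      qed
    qed
    then show ?thesis by (rule Cauchy_convergent)
  qed
  then have "\<forall>b\<in>B. (\<lambda>n. a n b) \<longlonglongrightarrow> lim (\<lambda>n. a n b)" by (simp add: convergent_LIMSEQ_iff)
  then have "(\<lambda>n. \<Sum>b\<in>B. a n b *\<^sub>R b) \<longlonglongrightarrow> (\<Sum>b\<in>B. lim (\<lambda>n. a n b) *\<^sub>R b)"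
    by (intro tendsto_sum tendsto_scaleR tendsto_const) auto
  then have "x \<longlonglongrightarrow> (\<Sum>b\<in>B. lim (\<lambda>n. a n b) *\<^sub>R b)" by (simp flip: a)
  then have "l = (\<Sum>b\<in>B. lim (\<lambda>n. a n b) *\<^sub>R b)" using * LIMSEQ_unique by blast
  then show "l \<in> span B" by (simp add: span_sum span_scale span_base)
qed

text \<open>
  Induction on \<open>B\<close>: the span of the smaller set is closed by the previous lemma, so the
  new vector has positive distance from it, and this bounds its coefficient.
\<close>

lemma coeff_bound:
  fixes B :: "'a::real_normed_vector set"
  assumes "finite B" "independent B"
  shows "\<exists>C>0. \<forall>a. (\<Sum>b\<in>B. \<bar>a b\<bar>) \<le> C * norm (\<Sum>b\<in>B. a b *\<^sub>R b)"
  using assms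
proof (induction B rule: finite_induct)
  case empty
  then show ?case by (intro exI[of _ 1]) auto
next
  case (insert c B)
  then have "independent B" "c \<notin> span B" by (auto simp: independent_insert)
  with insert obtain C where C: "C > 0" "\<And>a. (\<Sum>b\<in>B. \<bar>a b\<bar>) \<le> C * norm (\<Sum>b\<in>B. a b *\<^sub>R b)"
    by blast
  have "closed (span B)" using insert C(2) by (intro closed_span_of_coeff_bound)
  then have "open (- span B)" by auto
  then obtain \<delta> where d: "\<delta> > 0" "ball c \<delta> \<subseteq> - span B"
    using \<open>c \<notin> span B\<close> open_contains_ball by blast
  have far: "\<bar>s\<bar> * \<delta> \<le> norm (s *\<^sub>R c + y)" if y: "y \<in> span B" for s y
  proof (cases "s = 0")
    case False
    have "(-1/s) *\<^sub>R y \<in> span B" using y by (rule span_scale)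
    then have "(-1/s) *\<^sub>R y \<notin> ball c \<delta>" using d(2) by blast
    then have "\<delta> \<le> norm (c - (-1/s) *\<^sub>R y)" by (simp add: dist_norm)
    then have "\<bar>s\<bar> * \<delta> \<le> \<bar>s\<bar> * norm (c - (-1/s) *\<^sub>R y)" by (intro mult_left_mono) auto
    also have "\<dots> = norm (s *\<^sub>R (c - (-1/s) *\<^sub>R y))" by simp
    also have "s *\<^sub>R (c - (-1/s) *\<^sub>R y) = s *\<^sub>R c + y" using False by (simp add: scaleR_right_distrib)
    finally show ?thesis .
  qed simp
  define K where "K = 1/\<delta> + C + C * norm c / \<delta>"
  have "(\<Sum>b\<in>insert c B. \<bar>a b\<bar>) \<le> K * norm (\<Sum>b\<in>insert c B. a b *\<^sub>R b)" for a
  proof -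
    define w where "w = (\<Sum>b\<in>B. a b *\<^sub>R b)"
    define v where "v = a c *\<^sub>R c + w"
    have "w \<in> span B" by (simp add: w_def span_sum span_scale span_base)
    from far[OF this, of "a c"] have 1: "\<bar>a c\<bar> \<le> norm v / \<delta>" using d(1) by (simp add: v_def field_simps)
    have "norm w = norm (v - a c *\<^sub>R c)" by (simp add: v_def)
    also have "\<dots> \<le> norm v + \<bar>a c\<bar> * norm c" using norm_triangle_ineq4[of v "a c *\<^sub>R c"] by simp
    also have "\<dots> \<le> norm v + norm v / \<delta> * norm c" using 1 by (intro add_left_mono mult_right_mono) auto
    finally have "C * norm w \<le> C * (norm v + norm v / \<delta> * norm c)" using C(1) by simp
    then have "(\<Sum>b\<in>B. \<bar>a b\<bar>) \<le> C * (norm v + norm v / \<delta> * norm c)"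
      using C(2)[of a] unfolding w_def by linarith
    then have "\<bar>a c\<bar> + (\<Sum>b\<in>B. \<bar>a b\<bar>) \<le> norm v / \<delta> + C * (norm v + norm v / \<delta> * norm c)"
      using 1 by linarith
    also have "\<dots> = K * norm v" by (simp add: K_def algebra_simps add_divide_distrib)
    finally show ?thesis using insert by (simp add: v_def w_def)
  qed
  moreover have "K > 0" using C(1) d(1) by (auto simp: K_def intro!: add_pos_nonneg)
  ultimately show ?case by blast
qed

lemma span_finite_basis:
  fixes S :: "'a::real_vector set"
  assumes "finite S"
  obtains B where "B \<subseteq> S" "finite B" "independent B" "span B = span S"
proof -
  obtain B where B: "B \<subseteq> S" "independent B" "S \<subseteq> span B"
    using maximal_independent_subset by blast
  then have "span B = span S" by (metis span_eq span_superset subset_trans)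
  with B assms that show thesis using finite_subset by blast
qed

lemma finite_dim_basis:
  fixes V :: "'a::real_vector set"
  assumes "subspace V" "finite_dim V"
  obtains B where "finite B" "independent B" "span B = V"
proof -
  obtain S where S: "finite S" "V \<subseteq> span S" using assms(2) by (auto simp: finite_dim_def)
  obtain B where B: "B \<subseteq> V" "independent B" "V \<subseteq> span B"
    using maximal_independent_subset by blast
  have "finite B" using B S independent_span_bound[OF S(1) B(2)] by (meson order_trans)
  moreover have "span B = V" using B assms(1) by (simp add: span_minimal subset_antisym)
  ultimately show thesis using that B by blast
qed

lemma closed_span_finite:
  fixes S :: "'a::real_normed_vector set"
  assumes "finite S"
  shows "closed (span S)"
proof -
  obtain B where B: "finite B" "independent B" "span B = span S"
    using span_finite_basis[OF assms] by metis
  obtain C where "\<And>a. (\<Sum>b\<in>B. \<bar>a b\<bar>) \<le> C * norm (\<Sum>b\<in>B. a b *\<^sub>R b)"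
    using coeff_bound[OF B(1,2)] by blast
  from closed_span_of_coeff_bound[OF B(1) this] show ?thesis using B by simp
qed

lemma linear_bounded_on_span:
  fixes f :: "'a::real_normed_vector \<Rightarrow> 'b::real_normed_vector"
  assumes "finite S" "linear f"
  shows "\<exists>C>0. \<forall>x\<in>span S. norm (f x) \<le> C * norm x"
proof -
  obtain B where B: "finite B" "independent B" "span B = span S"
    using span_finite_basis[OF assms(1)] by metis
  obtain C where C: "C > 0" "\<And>a. (\<Sum>b\<in>B. \<bar>a b\<bar>) \<le> C * norm (\<Sum>b\<in>B. a b *\<^sub>R b)"
    using coeff_bound[OF B(1,2)] by blast
  define M where "M = 1 + (\<Sum>b\<in>B. norm (f b))"
  have M: "M > 0" unfolding M_def by (intro add_pos_nonneg sum_nonneg) auto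
  have "norm (f x) \<le> (M * C) * norm x" if "x \<in> span S" for x
  proof -
    have "x \<in> span B" using that B by simp
    then obtain a where a: "x = (\<Sum>b\<in>B. a b *\<^sub>R b)" by (auto simp: span_finite[OF B(1)])
    have "norm (f x) = norm (\<Sum>b\<in>B. a b *\<^sub>R f b)"
      by (simp add: a linear_sum[OF assms(2)] linear_scale[OF assms(2)])
    also have "\<dots> \<le> (\<Sum>b\<in>B. \<bar>a b\<bar> * norm (f b))" by (rule sum_norm_le) simp
    also have "\<dots> \<le> (\<Sum>b\<in>B. \<bar>a b\<bar> * M)"
    proof (intro sum_mono mult_left_mono)
      fix b assume "b \<in> B"
      then have "norm (f b) \<le> (\<Sum>b\<in>B. norm (f b))" using B by (intro member_le_sum) auto
      then show "norm (f b) \<le> M" by (simp add: M_def)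
    qed auto
    also have "\<dots> = M * (\<Sum>b\<in>B. \<bar>a b\<bar>)" by (simp add: sum_distrib_left mult.commute)
    also have "\<dots> \<le> M * (C * norm x)" using C(2)[of a] M by (simp add: a)
    finally show ?thesis by simp
  qed
  then show ?thesis using M C(1) by (intro exI[of _ "M * C"]) auto
qed

text \<open>
  A form of the Hahn-Banach theorem whose constant 2 does not depend on the dimension: take any
  nonzero functional and a vector on which it almost attains its norm.
\<close>

lemma norming_functional:
  fixes B :: "'a::real_normed_vector set"
  assumes "finite B" "independent B" "B \<noteq> {}"
  shows "\<exists>w g. w \<in> span B \<and> norm w = 1 \<and> linear g \<and> g w = (1::real) \<and>
               (\<forall>x\<in>span B. \<bar>g x\<bar> \<le> 2 * norm x)"
proof -
  obtain b where b: "b \<in> B" using assms by blast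
  obtain h :: "'a \<Rightarrow> real" where h: "linear h" "h b = 1"
    using linear_independent_extend[OF assms(2), of "\<lambda>_. 1::real"] b by auto
  obtain C where C: "C > 0" "\<And>x. x \<in> span B \<Longrightarrow> \<bar>h x\<bar> \<le> C * norm x"
    using linear_bounded_on_span[OF assms(1) h(1)] by auto
  define T where "T = {\<bar>h x\<bar> / norm x |x. x \<in> span B}"
  have bdd: "bdd_above T"
    unfolding T_def bdd_above_def
  proof (intro exI[of _ C] ballI)
    fix t assume "t \<in> {\<bar>h x\<bar> / norm x |x. x \<in> span B}"
    then obtain x where x: "t = \<bar>h x\<bar> / norm x" "x \<in> span B" by blast
    show "t \<le> C" using C(1) C(2)[OF x(2)] by (cases "norm x = 0") (auto simp: x(1) divide_le_eq)
  qed
  have b0: "b \<noteq> 0" using b assms(2) dependent_zero by blast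
  have "1 / norm b \<in> T" unfolding T_def using b h by (force intro: span_base)
  then have pos: "Sup T > 0"
    using cSup_upper[OF _ bdd] b0 by (smt (verit) zero_less_norm_iff divide_pos_pos)
  moreover have "T \<noteq> {}" using \<open>1 / norm b \<in> T\<close> by blast
  ultimately obtain t where t: "t \<in> T" "Sup T / 2 < t"
    using less_cSup_iff[OF _ bdd, of "Sup T / 2"] by auto
  then obtain x where x: "t = \<bar>h x\<bar> / norm x" "x \<in> span B" unfolding T_def by blast
  have x0: "norm x > 0" "h x \<noteq> 0" using t x pos by (auto simp: zero_less_divide_iff split: if_splits)
  define w where "w = (1 / norm x) *\<^sub>R x"
  define g where "g = (\<lambda>y. h y / h w)"
  have hw: "h w = h x / norm x" by (simp add: w_def linear_scale[OF h(1)])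
  have "linear g" unfolding g_def using h(1)
    by (auto simp: linear_iff add_divide_distrib)
  moreover have "\<bar>g y\<bar> \<le> 2 * norm y" if y: "y \<in> span B" for y
  proof -
    have "\<bar>h w\<bar> = t" using x0 by (simp add: hw x)
    have "\<bar>h y\<bar> \<le> Sup T * norm y"
    proof (cases "norm y = 0")
      case True
      then show ?thesis using linear_0[OF h(1)] by simp
    next
      case False
      have "\<bar>h y\<bar> / norm y \<in> T" using y by (auto simp: T_def)
      then have "\<bar>h y\<bar> / norm y \<le> Sup T" using bdd by (rule cSup_upper)
      then show ?thesis using False by (simp add: divide_le_eq)
    qed
    also have "\<dots> \<le> (2 * t) * norm y" using t by (intro mult_right_mono) auto
    finally show ?thesis using \<open>\<bar>h w\<bar> = t\<close> t pos by (simp add: g_def divide_le_eq mult_ac)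
  qed
  moreover have "w \<in> span B" unfolding w_def using x by (intro span_scale)
  ultimately show ?thesis using x0
    by (intro exI[of _ w] exI[of _ g]) (auto simp: g_def hw, auto simp: w_def)
qed

lemma linear_extension_inverse:
  fixes B B' :: "'a::real_vector set"
  assumes "independent B" "independent B'" "finite B" "finite B'" "card B = card B'"
  obtains V V' where "linear V" "linear V'" "\<And>x. x \<in> span B \<Longrightarrow> V x \<in> span B' \<and> V' (V x) = x"
    "\<And>x. x \<in> span B' \<Longrightarrow> V' x \<in> span B \<and> V (V' x) = x"
proof -
  obtain h where h: "bij_betw h B B'" using assms finite_same_card_bij by blast
  obtain V where V: "linear V" "\<forall>x\<in>B. V x = h x" "range V = span (h ` B)"
    using linear_independent_extend_subspace[OF assms(1)] by metis
  obtain V' where V': "linear V'" "\<forall>x\<in>B'. V' x = inv_into B h x" "range V' = span (inv_into B h ` B')"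
    using linear_independent_extend_subspace[OF assms(2)] by metis
  have "h ` B = B'" "inv_into B h ` B' = B"
    using h bij_betw_inv_into[OF h] by (auto simp: bij_betw_def)
  moreover have "V' (V x) = x" if "x \<in> span B" for x
  proof (rule linear_eq_on_span[of "\<lambda>x. V' (V x)" "\<lambda>x. x", OF _ _ _ that])
    show "linear (\<lambda>x. V' (V x))" using linear_compose[OF V(1) V'(1)] by (simp add: o_def)
    show "V' (V x) = x" if "x \<in> B" for x
      using that V V' h bij_betw_inv_into_left[OF h that] by (auto simp: bij_betw_def)
  qed (rule linear_id[unfolded id_def])
  moreover have "V (V' x) = x" if "x \<in> span B'" for x
  proof (rule linear_eq_on_span[of "\<lambda>x. V (V' x)" "\<lambda>x. x", OF _ _ _ that])
    show "linear (\<lambda>x. V (V' x))" using linear_compose[OF V'(1) V(1)] by (simp add: o_def)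
    show "V (V' x) = x" if "x \<in> B'" for x
    proof -
      have "inv_into B h x \<in> B" using bij_betw_inv_into[OF h] that by (auto simp: bij_betw_def)
      then show ?thesis using that V V' bij_betw_inv_into_right[OF h that] by auto
    qed
  qed (rule linear_id[unfolded id_def])
  moreover have "V x \<in> span B'" "V' x \<in> span B" for x
    using V(3) V'(3) \<open>h ` B = B'\<close> \<open>inv_into B h ` B' = B\<close> by auto
  ultimately show thesis by (intro that[OF V(1) V'(1)] conjI)
qed

section \<open>Finite-dimensional decompositions\<close>

locale fdd =
  fixes F :: "nat \<Rightarrow> 'u::banach set" and X :: "'u set"
  assumes FDD: "is_FDD F X" and subspace_X: "subspace X" and closed_X: "closed X"
begin

lemma F_basics: "subspace (F n)" "finite_dim (F n)" "F n \<subseteq> X" "F n \<noteq> {0}"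
  using FDD by (auto simp: is_FDD_def fd_subspace_def)

lemma F_in_X: "x \<in> F n \<Longrightarrow> x \<in> X"
  using F_basics by blast

lemma closed_F: "closed (F n)"
proof -
  obtain B where "finite B" "span B = F n" using finite_dim_basis[OF F_basics(1,2)] by metis
  then show ?thesis using closed_span_finite by metis
qed

definition coord :: "'u \<Rightarrow> nat \<Rightarrow> 'u" where
  "coord x = (THE f. (\<forall>n. f n \<in> F n) \<and> f sums x)"

lemma coord_props:
  assumes "x \<in> X"
  shows "coord x n \<in> F n" "coord x sums x"
proof -
  have "\<exists>!f. (\<forall>n. f n \<in> F n) \<and> f sums x" using FDD assms by (simp add: is_FDD_def)
  from theI'[OF this] show "coord x n \<in> F n" "coord x sums x" by (auto simp: coord_def)
qed

lemma coord_unique: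
  assumes "x \<in> X" "\<And>n. f n \<in> F n" "f sums x"
  shows "coord x = f"
proof -
  have "\<exists>!f. (\<forall>n. f n \<in> F n) \<and> f sums x" using FDD assms by (simp add: is_FDD_def)
  then show ?thesis unfolding coord_def using assms by (intro the1_equality) auto
qed

lemma coord_add: "x \<in> X \<Longrightarrow> y \<in> X \<Longrightarrow> coord (x + y) n = coord x n + coord y n"
  using coord_unique[of "x + y" "\<lambda>n. coord x n + coord y n"]
  by (simp add: coord_props F_basics subspace_X subspace_add sums_add)

lemma coord_scale: "x \<in> X \<Longrightarrow> coord (c *\<^sub>R x) n = c *\<^sub>R coord x n"
  using coord_unique[of "c *\<^sub>R x" "\<lambda>n. c *\<^sub>R coord x n"]
  by (simp add: coord_props F_basics subspace_X subspace_scale sums_scaleR_right)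

lemma coord_F: "x \<in> F m \<Longrightarrow> coord x n = (if n = m then x else 0)"
proof -
  assume x: "x \<in> F m"
  have "(\<lambda>n. if n = m then x else 0) sums x" using sums_single[of m "\<lambda>_. x"] by simp
  then have "coord x = (\<lambda>n. if n = m then x else 0)"
    using x by (intro coord_unique) (auto simp: F_in_X subspace_0 F_basics)
  then show ?thesis by simp
qed

lemma coord_0 [simp]: "coord 0 n = 0"
  using coord_F[of 0 0 n] subspace_0[OF F_basics(1)] by auto

lemma coord_diff: "x \<in> X \<Longrightarrow> y \<in> X \<Longrightarrow> coord (x - y) n = coord x n - coord y n"
  using coord_add[of x "-1 *\<^sub>R y" n] coord_scale[of y "-1" n] subspace_scale[OF subspace_X, of y "-1"]
  by simp

lemma coord_sum:
  assumes "finite A" "\<And>i. i \<in> A \<Longrightarrow> f i \<in> X"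
  shows "coord (sum f A) n = (\<Sum>i\<in>A. coord (f i) n)"
  using assms
  by (induction A rule: finite_induct) (auto simp: coord_add subspace_sum[OF subspace_X])

definition P :: "nat \<Rightarrow> 'u \<Rightarrow> 'u" where
  "P n x = (\<Sum>i<n. coord x i)"

lemma P_in_X: "x \<in> X \<Longrightarrow> P n x \<in> X"
  unfolding P_def by (intro subspace_sum[OF subspace_X]) (auto intro: F_in_X coord_props)

lemma P_add: "x \<in> X \<Longrightarrow> y \<in> X \<Longrightarrow> P n (x + y) = P n x + P n y"
  by (simp add: P_def coord_add sum.distrib)

lemma P_scale: "x \<in> X \<Longrightarrow> P n (c *\<^sub>R x) = c *\<^sub>R P n x"
  by (simp add: P_def coord_scale scaleR_sum_right)

lemma P_diff: "x \<in> X \<Longrightarrow> y \<in> X \<Longrightarrow> P n (x - y) = P n x - P n y"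
  by (simp add: P_def coord_diff sum_subtractf)

lemma P_tendsto: "x \<in> X \<Longrightarrow> (\<lambda>n. P n x) \<longlonglongrightarrow> x"
  using coord_props(2) by (auto simp: P_def sums_def)

lemma coord_P: "x \<in> X \<Longrightarrow> coord (P n x) i = (if i < n then coord x i else 0)"
  unfolding P_def
  by (subst coord_sum) (auto intro: F_in_X coord_props simp: coord_F[OF coord_props(1)] sum.delta)

lemma P_P: "x \<in> X \<Longrightarrow> P m (P n x) = P (min m n) x"
proof -
  assume x: "x \<in> X"
  have "P m (P n x) = (\<Sum>i<m. if i < n then coord x i else 0)"
    unfolding P_def[of m] by (simp add: coord_P x)
  also have "\<dots> = (\<Sum>i\<in>{..<m} \<inter> {i. i < n}. coord x i)" by (simp add: sum.inter_restrict)
  also have "{..<m} \<inter> {i. i < n} = {..<min m n}" by auto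
  finally show ?thesis by (simp add: P_def)
qed

text \<open>
  Banach's theorem that the partial sum projections are uniformly bounded. By the Baire category
  theorem, for some \<open>k\<close> the vectors with all partial sums bounded by \<open>k\<close> are dense in a ball of \<open>X\<close>.
  Every \<open>x\<close> is then a series of vectors \<open>y\<^sub>j\<close> whose projections \<open>P n y\<^sub>j\<close> decrease
  geometrically in \<open>j\<close>, uniformly in \<open>n\<close>. Adding up the coordinates of the \<open>y\<^sub>j\<close> gives an expansion of \<open>x\<close>,
  and by uniqueness it is the expansion of \<open>x\<close>.
\<close>

lemma P_bounded:
  obtains C where "C \<ge> 1" "\<And>x n. x \<in> X \<Longrightarrow> norm (P n x) \<le> C * norm x"
proof -
  define A where "A k = {x \<in> X. \<forall>n. norm (P n x) \<le> real k}" for k :: nat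
  have AX: "A k \<subseteq> X" for k by (auto simp: A_def)
  have UA: "X \<subseteq> (\<Union>k. A k)"
  proof
    fix x assume x: "x \<in> X"
    have "Bseq (\<lambda>n. P n x)" using P_tendsto[OF x] by (intro convergent_imp_Bseq) (auto simp: convergent_def)
    then obtain K where "\<And>n. norm (P n x) \<le> K" by (auto simp: Bseq_def)
    moreover obtain k where "K \<le> real k" using real_arch_simple by blast
    ultimately have "x \<in> A k" using x by (auto simp: A_def intro: order_trans)
    then show "x \<in> (\<Union>k. A k)" by blast
  qed
  have clAX: "closure (A k) \<subseteq> X" for k using AX closed_X by (simp add: closure_minimal)
  \<comment> \<open>Baire: the sets \<open>closure (A k)\<close> cover the complete space \<open>X\<close>.\<close>
  have "\<exists>k. top_of_set X interior_of closure (A k) \<noteq> {}"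
  proof (rule ccontr)
    assume neg: "\<nexists>k. top_of_set X interior_of closure (A k) \<noteq> {}"
    have "top_of_set X interior_of \<Union>(range (\<lambda>k. closure (A k))) = {}"
    proof (rule Baire_category_alt)
      show "completely_metrizable_space (top_of_set X) \<or> locally_compact_space (top_of_set X) \<and> regular_space (top_of_set X)"
        using closed_X completely_metrizable_space_closedin completely_metrizable_space_euclidean closed_closedin by blast
      show "countable (range (\<lambda>k. closure (A k)))" by simp
      fix T assume "T \<in> range (\<lambda>k. closure (A k))"
      then show "closedin (top_of_set X) T \<and> top_of_set X interior_of T = {}"
        using neg clAX by (auto simp: closedin_closed intro!: exI[of _ "closure (A _)"])
    qed
    moreover have "\<Union>(range (\<lambda>k. closure (A k))) = X"
    proof
      show "\<Union>(range (\<lambda>k. closure (A k))) \<subseteq> X" using clAX by (rule UN_least)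
      show "X \<subseteq> \<Union>(range (\<lambda>k. closure (A k)))"
        using UA UN_mono[OF subset_refl closure_subset] by (rule subset_trans)
    qed
    ultimately have "X = {}"
      using interior_of_topspace[of "top_of_set X"] by simp
    then show False using subspace_0[OF subspace_X] by simp
  qed
  then obtain k x0 where x0: "x0 \<in> top_of_set X interior_of closure (A k)" by blast
  then obtain U where U: "openin (top_of_set X) U" "x0 \<in> U" "U \<subseteq> closure (A k)"
    by (auto simp: interior_of_def)
  then obtain r where r: "r > 0" "ball x0 r \<inter> X \<subseteq> closure (A k)" and x0X: "x0 \<in> X"
    unfolding openin_contains_ball by (metis subset_trans subsetD)
  have near: "\<exists>y\<in>A k. norm (x - y) < e" if x: "x \<in> X" "norm x < r" and e: "e > 0" for x e
  proof -
    have "x0 + x \<in> ball x0 r \<inter> X" "x0 - x \<in> ball x0 r \<inter> X"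
      using x x0X subspace_X by (auto simp: dist_norm subspace_add subspace_diff)
    then have "x0 + x \<in> closure (A k)" "x0 - x \<in> closure (A k)" using r by auto
    then obtain y1 y2 where y: "y1 \<in> A k" "y2 \<in> A k" "dist y1 (x0 + x) < e" "dist y2 (x0 - x) < e"
      using e by (meson closure_approachable)
    \<comment> \<open>\<open>A k\<close> is convex and symmetric, so its density near \<open>x0\<close> can be moved to the origin.\<close>
    define y where "y = (1/2) *\<^sub>R (y1 - y2)"
    have yX: "y1 \<in> X" "y2 \<in> X" using y by (auto simp: A_def)
    have "norm (P n y) \<le> real k" for n
    proof -
      have "P n y = (1/2) *\<^sub>R (P n y1 - P n y2)"
        using yX subspace_X by (simp add: y_def P_scale P_diff subspace_diff)
      then have "norm (P n y) \<le> (1/2) * (norm (P n y1) + norm (P n y2))"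
        using norm_triangle_ineq4[of "P n y1" "P n y2"] by simp
      moreover have "norm (P n y1) \<le> real k" "norm (P n y2) \<le> real k" using y by (auto simp: A_def)
      ultimately show ?thesis by simp
    qed
    moreover have "y \<in> X" unfolding y_def using yX subspace_X by (intro subspace_scale subspace_diff)
    ultimately have "y \<in> A k" by (simp add: A_def)
    moreover have "norm (x - y) < e"
    proof -
      have "x - y = (1/2) *\<^sub>R ((x0 + x - y1) - (x0 - x - y2))"
      proof -
        have "(x0 + x - y1) - (x0 - x - y2) = (x + x) - (y1 - y2)" by simp
        then show ?thesis by (simp only: y_def scaleR_right_diff_distrib[of _ "x + x"] scaleR_half_double)
      qed
      then have "norm (x - y) \<le> (1/2) * (norm (x0 + x - y1) + norm (x0 - x - y2))"
        using norm_triangle_ineq4[of "x0 + x - y1" "x0 - x - y2"] by simp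
      then show ?thesis using y(3,4) by (simp add: dist_norm norm_minus_commute)
    qed
    ultimately show ?thesis by blast
  qed
  define M where "M = 2 * real k / r"
  have M0: "M \<ge> 0" using r by (simp add: M_def)
  have approx: "\<exists>y\<in>X. norm (x - y) < e \<and> (\<forall>n. norm (P n y) \<le> M * norm x)"
    if x: "x \<in> X" and e: "e > 0" for x e
  proof (cases "x = 0")
    case True
    then show ?thesis using e x by (intro bexI[of _ 0]) (auto simp: P_def)
  next
    case False
    define t where "t = r / (2 * norm x)"
    have t: "t > 0" using r False by (simp add: t_def)
    have "t *\<^sub>R x \<in> X" using x subspace_X by (simp add: subspace_scale)
    moreover have "norm (t *\<^sub>R x) < r" using r False by (simp add: t_def)
    moreover have "t * e > 0" using t e by simp
    ultimately obtain y where y: "y \<in> A k" "norm (t *\<^sub>R x - y) < t * e" using near by blast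
    have yX: "y \<in> X" using y by (simp add: A_def)
    show ?thesis
    proof (intro bexI[of _ "(1/t) *\<^sub>R y"] conjI allI)
      show "(1/t) *\<^sub>R y \<in> X" using yX subspace_X by (simp add: subspace_scale)
      have "x - (1/t) *\<^sub>R y = (1/t) *\<^sub>R (t *\<^sub>R x - y)" using t by (simp add: scaleR_right_diff_distrib)
      then have "norm (x - (1/t) *\<^sub>R y) = norm (t *\<^sub>R x - y) / t" using t by simp
      then show "norm (x - (1/t) *\<^sub>R y) < e" using y(2) t by (simp add: divide_less_eq mult.commute)
      fix n
      have "norm (P n ((1/t) *\<^sub>R y)) = norm (P n y) / t" using t yX by (simp add: P_scale)
      also have "\<dots> \<le> real k / t" using y t by (intro divide_right_mono) (auto simp: A_def)
      also have "\<dots> = M * norm x" using r False by (simp add: t_def M_def)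
      finally show "norm (P n ((1/t) *\<^sub>R y)) \<le> M * norm x" .
    qed
  qed
  have main: "norm (P n x) \<le> (2 * M) * norm x" if x: "x \<in> X" for x n
  proof (cases "x = 0")
    case True
    then show ?thesis by (simp add: P_def)
  next
    case False
    define e where "e j = norm x * (1/2) ^ j" for j :: nat
    have e: "e j > 0" for j using False by (simp add: e_def)
    \<comment> \<open>\<open>z j\<close> is the remainder of \<open>x\<close> after \<open>j\<close> approximation steps.\<close>
    have "\<exists>z. \<forall>j. (z j \<in> X \<and> norm (z j) \<le> e j \<and> (j = 0 \<longrightarrow> z j = x)) \<and>
             (\<forall>n. norm (P n (z j - z (Suc j))) \<le> M * norm (z j))"
    proof (rule dependent_nat_choice)
      show "\<exists>z. z \<in> X \<and> norm z \<le> e 0 \<and> (0 = (0::nat) \<longrightarrow> z = x)" using x by (simp add: e_def)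
      fix z j assume z: "z \<in> X \<and> norm z \<le> e j \<and> (j = 0 \<longrightarrow> z = x)"
      then obtain y where "y \<in> X" "norm (z - y) < e (Suc j)" "\<forall>n. norm (P n y) \<le> M * norm z"
        using approx e by blast
      then show "\<exists>z'. (z' \<in> X \<and> norm z' \<le> e (Suc j) \<and> (Suc j = 0 \<longrightarrow> z' = x)) \<and>
          (\<forall>n. norm (P n (z - z')) \<le> M * norm z)"
        using z subspace_X by (intro exI[of _ "z - y"]) (auto simp: subspace_diff)
    qed
    then obtain z where z: "\<And>j. z j \<in> X" "\<And>j. norm (z j) \<le> e j" "z 0 = x"
      and Pz: "\<And>j n. norm (P n (z j - z (Suc j))) \<le> M * norm (z j)" by blast
    define y where "y j = z j - z (Suc j)" for j
    have yX: "y j \<in> X" for j using z subspace_X by (simp add: y_def subspace_diff)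
    define h where "h j = M * e j" for j
    have Py: "norm (P n (y j)) \<le> h j" for n j
    proof -
      have "norm (P n (y j)) \<le> M * norm (z j)" using Pz by (simp add: y_def)
      also have "\<dots> \<le> h j" unfolding h_def using z M0 by (intro mult_left_mono) auto
      finally show ?thesis .
    qed
    have hs: "h sums (M * (norm x * 2))"
      unfolding h_def e_def using geometric_sums[of "1/2::real"] by (intro sums_mult) simp
    then have sh: "summable h" by (rule sums_summable)
    have sum_y: "(\<lambda>j. \<Sum>i<j. y i) \<longlonglongrightarrow> x"
    proof -
      have "e \<longlonglongrightarrow> norm x * 0" unfolding e_def by (intro tendsto_mult tendsto_const LIMSEQ_power_zero) simp
      then have "z \<longlonglongrightarrow> 0" using z(2) by (intro Lim_null_comparison[of z e]) auto
      then have "(\<lambda>j. z 0 - z j) \<longlonglongrightarrow> z 0 - 0" by (intro tendsto_intros)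
      moreover have "(\<Sum>i<j. y i) = z 0 - z j" for j
        unfolding y_def by (rule sum_lessThan_telescope')
      ultimately show ?thesis using z(3) by simp
    qed
    have sP: "summable (\<lambda>j. P n (y j))" for n
      by (rule summable_comparison_test'[OF sh, of 0]) (rule Py)
    have cy: "coord (y j) i = P (Suc i) (y j) - P i (y j)" for i j by (simp add: P_def)
    define g where "g i = (\<Sum>j. coord (y j) i)" for i
    have sc: "summable (\<lambda>j. coord (y j) i)" for i
      unfolding cy by (intro summable_diff sP)
    have gF: "g i \<in> F i" for i
    proof -
      have "(\<lambda>n. \<Sum>j<n. coord (y j) i) \<longlonglongrightarrow> g i"
        unfolding g_def using sc by (rule summable_LIMSEQ)
      moreover have "(\<Sum>j<n. coord (y j) i) \<in> F i" for n
        by (intro subspace_sum F_basics coord_props yX)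
      ultimately show ?thesis by (rule closed_sequentially[OF closed_F, rotated])
    qed
    have gP: "(\<Sum>i<n. g i) = (\<Sum>j. P n (y j))" for n
      unfolding g_def P_def using sc by (subst suminf_sum) auto
    \<comment> \<open>Uniformity in \<open>n\<close> permits exchanging the limit over \<open>n\<close> with the sum over \<open>j\<close>.\<close>
    have ul: "uniform_limit UNIV (\<lambda>j n. \<Sum>i<j. P n (y i)) (\<lambda>n. \<Sum>i. P n (y i)) sequentially"
      by (rule Weierstrass_m_test[OF _ sh]) (rule Py)
    have "(\<lambda>n. \<Sum>i. P n (y i)) \<longlonglongrightarrow> x"
    proof (rule swap_uniform_limit'[OF _ sum_y ul])
      show "\<forall>\<^sub>F j in sequentially. (\<lambda>n. \<Sum>i<j. P n (y i)) \<longlonglongrightarrow> (\<Sum>i<j. y i)"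
        by (intro always_eventually allI tendsto_sum P_tendsto yX)
    qed (rule always_eventually, simp, rule sequentially_bot)
    then have "g sums x" by (simp add: sums_def gP)
    then have cg: "coord x = g" using x gF by (intro coord_unique)
    have "P n x = (\<Sum>j. P n (y j))" using gP by (simp add: P_def[of n x] cg)
    also have "norm \<dots> \<le> (\<Sum>j. h j)"
      using Py sh by (rule norm_suminf_le)
    also have "\<dots> = (2 * M) * norm x" using hs by (simp add: sums_iff)
    finally show ?thesis .
  qed
  show thesis
  proof (rule that[of "max 1 (2 * M)"])
    fix x n assume "x \<in> X"
    then have "norm (P n x) \<le> (2 * M) * norm x" by (rule main)
    also have "\<dots> \<le> max 1 (2 * M) * norm x" by (intro mult_right_mono) auto
    finally show "norm (P n x) \<le> max 1 (2 * M) * norm x" .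
  qed simp
qed

end

section \<open>Bounded operators and degrees\<close>

lemma subspace_closure_span: "subspace (closure (span S))" for S :: "'a::real_normed_vector set"
proof (rule subspaceI)
  show "0 \<in> closure (span S)" using closure_subset span_zero by blast
  show "x + y \<in> closure (span S)" if xy: "x \<in> closure (span S)" "y \<in> closure (span S)" for x y
  proof -
    obtain f g where "\<forall>n. f n \<in> span S" "f \<longlonglongrightarrow> x" "\<forall>n. g n \<in> span S" "g \<longlonglongrightarrow> y"
      using xy by (auto simp: closure_sequential)
    then show ?thesis unfolding closure_sequential
      by (intro exI[of _ "\<lambda>n. f n + g n"]) (auto intro: span_add tendsto_add)
  qed
  show "c *\<^sub>R x \<in> closure (span S)" if x: "x \<in> closure (span S)" for c x
  proof -
    obtain f where "\<forall>n. f n \<in> span S" "f \<longlonglongrightarrow> x" using x by (auto simp: closure_sequential)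
    then show ?thesis unfolding closure_sequential
      by (intro exI[of _ "\<lambda>n. c *\<^sub>R f n"]) (auto intro: span_scale tendsto_scaleR)
  qed
qed

lemma closure_span_subset:
  "subspace Y \<Longrightarrow> closed Y \<Longrightarrow> S \<subseteq> Y \<Longrightarrow> closure (span S) \<subseteq> Y"
  by (simp add: closure_minimal span_minimal)

lemma linear_on_diff:
  assumes "linear_on X T" "subspace X" "x \<in> X" "y \<in> X"
  shows "T (x - y) = T x - T y"
proof -
  have "- 1 *\<^sub>R y \<in> X" using assms by (intro subspace_scale)
  then have "T (x + - 1 *\<^sub>R y) = T x + - 1 *\<^sub>R T y" using assms unfolding linear_on_def by metis
  then show ?thesis by simp
qed

lemma linear_on_sum:
  assumes "linear_on X T" "subspace X" "finite A" "\<And>i. i \<in> A \<Longrightarrow> f i \<in> X"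
  shows "T (\<Sum>i\<in>A. a i *\<^sub>R f i) = (\<Sum>i\<in>A. a i *\<^sub>R T (f i))"
  using assms(3,4)
proof (induction A rule: finite_induct)
  case empty
  have "T (0 *\<^sub>R 0) = 0 *\<^sub>R T 0"
    using assms(1,2) subspace_0[of X] unfolding linear_on_def by metis
  then show ?case by simp
next
  case (insert i A)
  have "a i *\<^sub>R f i \<in> X" "(\<Sum>i\<in>A. a i *\<^sub>R f i) \<in> X"
    using insert assms by (auto intro!: subspace_scale subspace_sum)
  then show ?case using insert assms(1) unfolding linear_on_def by simp
qed

lemma closed_preimage_of_bounded:
  assumes X: "closed X" "subspace X" and lin: "linear_on X T"
    and bd: "\<And>x. x \<in> X \<Longrightarrow> norm (T x) \<le> C * norm x" and Y: "closed Y"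
  shows "closed {x \<in> X. T x \<in> Y}"
  unfolding closed_sequential_limits
proof (intro allI impI)
  fix f l assume f: "(\<forall>n. f n \<in> {x \<in> X. T x \<in> Y}) \<and> f \<longlonglongrightarrow> l"
  have l: "l \<in> X" using f by (intro closed_sequentially[OF X(1), of f l]) auto
  have "(\<lambda>n. C * norm (f n - l)) \<longlonglongrightarrow> C * norm (l - l)"
    using f by (intro tendsto_intros) auto
  moreover have "norm (T (f n) - T l) \<le> C * norm (f n - l)" for n
    using f l bd[of "f n - l"] X by (simp add: subspace_diff linear_on_diff[OF lin])
  ultimately have "(\<lambda>n. T (f n) - T l) \<longlonglongrightarrow> 0"
    by (intro Lim_null_comparison[of "\<lambda>n. T (f n) - T l" "\<lambda>n. C * norm (f n - l)"]) auto
  then have "(\<lambda>n. T (f n)) \<longlonglongrightarrow> T l" by (simp add: LIM_zero_iff)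
  then have "T l \<in> Y" using f by (intro closed_sequentially[OF Y, of "\<lambda>n. T (f n)" "T l"]) auto
  then show "l \<in> {x \<in> X. T x \<in> Y}" using l by simp
qed

lemma norm_on_norm: "norm_on V norm"
  by (auto simp: norm_on_def norm_triangle_ineq)

lemma banach_on_norm:
  fixes V :: "'a::banach set"
  assumes "subspace V" "closed V"
  shows "banach_on V norm"
  unfolding banach_on_def complete_on_def
proof (intro conjI assms norm_on_norm allI impI)
  fix s :: "nat \<Rightarrow> 'a"
  assume s: "(\<forall>n. s n \<in> V) \<and> (\<forall>e>0. \<exists>k. \<forall>m\<ge>k. \<forall>n\<ge>k. norm (s m - s n) < e)"
  then have "Cauchy s" by (simp add: Cauchy_iff)
  then obtain l where l: "s \<longlonglongrightarrow> l" using Cauchy_convergent convergent_def by blast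
  then have "l \<in> V" using s assms(2) by (intro closed_sequentially[OF assms(2), of s l]) auto
  moreover have "(\<lambda>n. norm (s n - l)) \<longlonglongrightarrow> 0" using l by (simp add: LIM_zero tendsto_norm_zero)
  ultimately show "\<exists>l\<in>V. (\<lambda>n. norm (s n - l)) \<longlonglongrightarrow> 0" by blast
qed

lemma op_norm_bounds:
  assumes V: "subspace V" and a: "\<And>x. x \<in> V \<Longrightarrow> norm (T x) \<le> a * norm x" "a \<ge> 0"
  shows "op_norm V norm norm T \<le> a" "x \<in> V \<Longrightarrow> norm (T x) \<le> op_norm V norm norm T * norm x"
proof -
  have le: "norm (T x) / norm x \<le> a" if "x \<in> V" for x
    using a(1)[OF that] a(2) by (cases "norm x = 0") (auto simp: divide_le_eq)
  have ne: "V \<noteq> {}" using subspace_0[OF V] by blast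
  show "op_norm V norm norm T \<le> a" unfolding op_norm_def
    using ne le by (rule cSUP_least)
  assume x: "x \<in> V"
  have "norm (T x) / norm x \<le> op_norm V norm norm T" unfolding op_norm_def
    using le x by (intro cSUP_upper) (auto intro!: bdd_aboveI[of _ a])
  then show "norm (T x) \<le> op_norm V norm norm T * norm x"
    using a(1)[OF x] by (cases "norm x = 0") (auto simp: divide_le_eq)
qed

text \<open>
  The axiom for degrees restricted to spaces normed by the norm of the type, and with the norm of
  the morphism replaced by upper bounds \<open>a\<close>, \<open>b\<close> for its two components, which are easier to provide.
\<close>

definition degree_gauge ::
  "('u::real_normed_vector set \<Rightarrow> ('u \<Rightarrow> real) \<Rightarrow> 'u set \<Rightarrow> real) \<Rightarrow> (real \<Rightarrow> real \<Rightarrow> real) \<Rightarrow> bool"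
where
  "degree_gauge d K \<longleftrightarrow>
     (\<forall>s t t'. 1 \<le> s \<and> 0 \<le> t \<and> t \<le> t' \<longrightarrow> K s t \<le> K s t') \<and>
     (\<forall>Y E Z G S T a b. approx_pair Y norm E \<and> approx_pair Z norm G \<and>
        linear_on G S \<and> S ` G \<subseteq> E \<and> (\<forall>g\<in>G. norm (S g) \<le> a * norm g) \<and>
        linear_on Y T \<and> T ` Y \<subseteq> Z \<and> (\<forall>y\<in>Y. norm (T y) \<le> b * norm y) \<and>
        (\<forall>g\<in>G. T (S g) = g) \<and> 1 \<le> a \<and> 1 \<le> b \<longrightarrow>
        d Z norm G \<le> K (a * b) (d Y norm E))"

lemma degree_gauge_mono:
  "degree_gauge d K \<Longrightarrow> 1 \<le> s \<Longrightarrow> 0 \<le> t \<Longrightarrow> t \<le> t' \<Longrightarrow> K s t \<le> K s t'"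
  unfolding degree_gauge_def by blast

lemma degree_gauge_bound:
  assumes "degree_gauge d K" "approx_pair Y norm E" "approx_pair Z norm G"
    "linear_on G S" "S ` G \<subseteq> E" "\<And>g. g \<in> G \<Longrightarrow> norm (S g) \<le> a * norm g"
    "linear_on Y T" "T ` Y \<subseteq> Z" "\<And>y. y \<in> Y \<Longrightarrow> norm (T y) \<le> b * norm y"
    "\<And>g. g \<in> G \<Longrightarrow> T (S g) = g" "1 \<le> a" "1 \<le> b"
  shows "d Z norm G \<le> K (a * b) (d Y norm E)"
  by (rule assms(1)[unfolded degree_gauge_def, THEN conjunct2, rule_format, of Y E Z G S a T b])
    (use assms(2-) in blast)

text \<open>
  Replacing the norm of a morphism by a bound is legitimate since the gauge is monotone on \<open>[1, \<infinity>)\<close>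
  and a morphism has norm at least 1: \<open>T \<circ> S\<close> is the identity on \<open>G\<close>.
\<close>

lemma degree_has_gauge:
  fixes d :: "'u::banach set \<Rightarrow> ('u \<Rightarrow> real) \<Rightarrow> 'u set \<Rightarrow> real"
  assumes "is_degree d"
  obtains K where "degree_gauge d K"
proof -
  have pos: "\<And>X N F. approx_pair X N F \<Longrightarrow> 0 \<le> d X N F"
    using assms by (simp add: is_degree_def)
  from assms[unfolded is_degree_def, THEN conjunct2] obtain K :: "real \<Rightarrow> real \<Rightarrow> real" where K0:
    "(\<forall>s\<ge>1. \<forall>t\<ge>0. 0 \<le> K s t) \<and>
     (\<forall>s s' t t'. 1 \<le> s \<and> s \<le> s' \<and> 0 \<le> t \<and> t \<le> t' \<longrightarrow> K s t \<le> K s' t') \<and>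
     (\<forall>t\<ge>0. ((\<lambda>s. K s t) \<longlongrightarrow> t) (at_right 1)) \<and>
     (\<forall>X N F Y M G S T.
        approx_pair X N F \<and> approx_pair Y M G \<and> approx_morphism X N F Y M G S T \<longrightarrow>
        d Y M G \<le> K (morphism_norm X N M G S T) (d X N F))"
    by (rule exE)
  note mono = K0[THEN conjunct2, THEN conjunct1, rule_format]
  note K = K0[THEN conjunct2, THEN conjunct2, THEN conjunct2, rule_format]
  have "degree_gauge d K"
    unfolding degree_gauge_def
  proof (intro conjI allI impI; elim conjE)
    show "K s t \<le> K s t'" if "1 \<le> s" "0 \<le> t" "t \<le> t'" for s t t' using mono that by simp
    fix Y E Z G :: "'u set" and S T :: "'u \<Rightarrow> 'u" and a b :: real
    assume Y: "approx_pair Y norm E" and Z: "approx_pair Z norm G"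
      and S: "linear_on G S" "S ` G \<subseteq> E" "\<forall>g\<in>G. norm (S g) \<le> a * norm g"
      and T: "linear_on Y T" "T ` Y \<subseteq> Z" "\<forall>y\<in>Y. norm (T y) \<le> b * norm y"
      and TS: "\<forall>g\<in>G. T (S g) = g" and ab: "1 \<le> a" "1 \<le> b"
    have sub: "subspace G" "subspace Y" "E \<subseteq> Y"
      using Y Z by (auto simp: approx_pair_def fd_subspace_def banach_on_def)
    have mor: "approx_morphism Y norm E Z norm G S T"
      using S T TS unfolding approx_morphism_def bounded_op_def by blast
    let ?m = "morphism_norm Y norm norm G S T"
    let ?s = "op_norm G norm norm S" and ?t = "op_norm Y norm norm T"
    have s: "?s \<le> a" "\<And>g. g \<in> G \<Longrightarrow> norm (S g) \<le> ?s * norm g"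
      using op_norm_bounds[OF sub(1), of S a] S(3) ab by auto
    have t: "?t \<le> b" "\<And>y. y \<in> Y \<Longrightarrow> norm (T y) \<le> ?t * norm y"
      using op_norm_bounds[OF sub(2), of T b] T(3) ab by auto
    have "1 \<le> ?m \<and> ?m \<le> a * b"
    proof (cases "G = {0}")
      case True
      then show ?thesis using mult_mono[of 1 a 1 b] ab by (simp add: morphism_norm_def)
    next
      case False
      then obtain g where g: "g \<in> G" "g \<noteq> 0" using subspace_0[OF sub(1)] by blast
      have Sg: "S g \<in> Y" using g S(2) sub(3) by auto
      have 1: "norm g \<le> ?t * norm (S g)" using t(2)[OF Sg] TS g(1) by simp
      have "0 < norm g" using g by simp
      then have "0 < ?t * norm (S g)" using 1 by linarith
      then have t0: "?t > 0" using norm_ge_zero[of "S g"] by (auto simp: zero_less_mult_iff)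
      have "norm g \<le> ?t * (?s * norm g)" 
        using 1 mult_left_mono[OF s(2)[OF g(1)], of ?t] t0 by linarith
      then have "1 * norm g \<le> (?s * ?t) * norm g" by (simp add: mult_ac)
      then have "1 \<le> ?s * ?t" using \<open>0 < norm g\<close> by (rule mult_right_le_imp_le)
      moreover have "?s * ?t \<le> a * b" using s t t0 ab by (intro mult_mono) auto
      ultimately show ?thesis using False by (simp add: morphism_norm_def)
    qed
    then have "K ?m (d Y norm E) \<le> K (a * b) (d Y norm E)" using pos[OF Y] by (intro mono) auto
    moreover have "d Z norm G \<le> K ?m (d Y norm E)" using Y Z mor by (intro K) auto
    ultimately show "d Z norm G \<le> K (a * b) (d Y norm E)" by simp
  qed
  then show thesis by (rule that)
qed

text \<open>
  The identity is a morphism from \<open>(Y, Y)\<close> to \<open>(Y, G)\<close> for every \<open>G\<close>, so the value at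
  \<open>(Y, Y)\<close> controls all others.
\<close>

lemma finite_dim_imp_small:
  fixes d :: "'u::banach set \<Rightarrow> ('u \<Rightarrow> real) \<Rightarrow> 'u set \<Rightarrow> real"
  assumes "is_degree d" "banach_on Y norm" "finite_dim Y"
  shows "d_small d Y norm"
proof -
  obtain K where K: "degree_gauge d K" using degree_has_gauge[OF assms(1)] .
  have "d Y norm G \<le> K (1 * 1) (d Y norm Y)" if G: "fd_subspace G Y" for G
    by (rule degree_gauge_bound[OF K, where S = "\<lambda>x. x" and T = "\<lambda>x. x"])
      (use G assms in \<open>auto simp: approx_pair_def fd_subspace_def banach_on_def linear_on_def\<close>)
  then show ?thesis unfolding d_small_def by (auto intro!: bdd_aboveI)
qed

section \<open>Bases adapted to the decomposition, and large blocks\<close>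

lemma fd_image:
  fixes T :: "'a::real_vector \<Rightarrow> 'b::real_normed_vector"
  assumes "linear_on X T" "subspace X" "subspace E" "finite_dim E" "E \<subseteq> X"
  shows "subspace (T ` E)" "finite_dim (T ` E)"
proof -
  obtain B where B: "finite B" "span B = E" using finite_dim_basis[OF assms(3,4)] by metis
  have BX: "b \<in> X" if "b \<in> B" for b using that B(2) assms(5) span_base by blast
  have "T ` E = span (T ` B)"
  proof
    show "T ` E \<subseteq> span (T ` B)"
    proof
      fix y assume "y \<in> T ` E"
      then obtain x where x: "x \<in> span B" "y = T x" using B by auto
      then obtain a where "x = (\<Sum>b\<in>B. a b *\<^sub>R b)" by (auto simp: span_finite[OF B(1)])
      then have "y = (\<Sum>b\<in>B. a b *\<^sub>R T b)"
        using x BX B(1) linear_on_sum[OF assms(1,2), of B "\<lambda>b. b" a] by simp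
      then show "y \<in> span (T ` B)" by (simp add: span_sum span_scale span_base)
    qed
    show "span (T ` B) \<subseteq> T ` E"
    proof
      fix y assume "y \<in> span (T ` B)"
      then show "y \<in> T ` E"
      proof (induction rule: span_induct_alt)
        case base
        have "T 0 = 0" using linear_on_sum[OF assms(1,2), of "{}" "\<lambda>_. 0"] by simp
        then show ?case using assms(3) subspace_0 by (metis imageI)
      next
        case (step c t y)
        then obtain b x where "b \<in> B" "t = T b" "x \<in> E" "y = T x" by blast
        moreover then have "b \<in> E" using B(2) span_base by blast
        ultimately have "c *\<^sub>R t + y = T (c *\<^sub>R b + x)" "c *\<^sub>R b + x \<in> E"
          using assms unfolding linear_on_def
          by (auto simp: subset_iff subspace_scale subspace_add)
        then show ?case by blast
      qed
    qed
  qed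
  then show "subspace (T ` E)" "finite_dim (T ` E)"
    using B(1) by (auto simp: finite_dim_def)
qed

context fdd begin

definition bs :: "nat \<Rightarrow> 'u set" where
  "bs n = (SOME B. finite B \<and> independent B \<and> span B = F n)"

lemma bs: "finite (bs n)" "independent (bs n)" "span (bs n) = F n" "bs n \<noteq> {}"
proof -
  have "\<exists>B. finite B \<and> independent B \<and> span B = F n"
    using finite_dim_basis[OF F_basics(1,2)[of n]] by metis
  from someI_ex[OF this] show *: "finite (bs n)" "independent (bs n)" "span (bs n) = F n"
    by (auto simp: bs_def)
  then show "bs n \<noteq> {}" using F_basics(4)[of n] by auto
qed

lemma bs_in_F: "b \<in> bs n \<Longrightarrow> b \<in> F n"
  using bs(3) span_base by metis

lemma bs_nonzero: "b \<in> bs n \<Longrightarrow> b \<noteq> 0"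
  using bs(2) dependent_zero by blast

lemma bs_disjoint: "m \<noteq> n \<Longrightarrow> bs m \<inter> bs n = {}"
proof (rule ccontr)
  assume "m \<noteq> n" "bs m \<inter> bs n \<noteq> {}"
  then obtain b where b: "b \<in> bs m" "b \<in> bs n" by blast
  then have "coord b n = b" "coord b n = 0"
    using coord_F[OF bs_in_F[OF b(1)], of n] coord_F[OF bs_in_F[OF b(2)], of n] \<open>m \<noteq> n\<close> by auto
  then show False using b bs_nonzero by auto
qed

lemma independent_bs: "independent (\<Union>i<n. bs i)"
proof (rule independent_if_scalars_zero)
  show "finite (\<Union>i<n. bs i)" using bs by auto
  fix f b assume s: "(\<Sum>b\<in>(\<Union>i<n. bs i). f b *\<^sub>R b) = 0" and "b \<in> (\<Union>i<n. bs i)"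
  then obtain i where i: "i < n" "b \<in> bs i" by blast
  define y where "y j = (\<Sum>b\<in>bs j. f b *\<^sub>R b)" for j
  have yF: "y j \<in> F j" for j unfolding y_def
    by (intro subspace_sum subspace_scale F_basics bs_in_F)
  have "(\<Sum>b\<in>(\<Union>i<n. bs i). f b *\<^sub>R b) = (\<Sum>j<n. y j)"
    unfolding y_def using bs bs_disjoint by (intro sum.UNION_disjoint) auto
  then have "coord (\<Sum>j<n. y j) i = 0" using s by simp
  then have "(\<Sum>j<n. coord (y j) i) = 0" using yF F_in_X by (subst (asm) coord_sum) auto
  moreover have "(\<Sum>j<n. coord (y j) i) = (\<Sum>j<n. if i = j then y j else 0)"
    using coord_F[OF yF] by simp
  ultimately have "y i = 0" using i by (simp add: sum.delta)
  then show "f b = 0"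
    using independentD[OF bs(2)[of i] bs(1)[of i] order_refl, of f b] i unfolding y_def by simp
qed

lemma P_in_span: "x \<in> X \<Longrightarrow> P n x \<in> span (\<Union>i<n. bs i)"
  unfolding P_def
proof (rule span_sum)
  fix i assume "x \<in> X" "i \<in> {..<n}"
  then have "coord x i \<in> span (bs i)" using bs coord_props by simp
  moreover have "span (bs i) \<subseteq> span (\<Union>i<n. bs i)" using \<open>i \<in> {..<n}\<close> by (intro span_mono) auto
  ultimately show "coord x i \<in> span (\<Union>i<n. bs i)" by blast
qed

lemma linear_on_P: "linear_on X (P n)"
  by (simp add: linear_on_def P_add P_scale)

lemma linear_on_coord: "linear_on X (\<lambda>x. coord x n)"
  by (simp add: linear_on_def coord_add coord_scale)

lemma coord_bounded:
  obtains C where "C \<ge> 1" "\<And>x n. x \<in> X \<Longrightarrow> norm (coord x n) \<le> C * norm x"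
proof -
  obtain C where C: "C \<ge> 1" "\<And>x n. x \<in> X \<Longrightarrow> norm (P n x) \<le> C * norm x" using P_bounded by metis
  show thesis
  proof (rule that[of "2 * C"])
    fix x n assume x: "x \<in> X"
    have "coord x n = P (Suc n) x - P n x" by (simp add: P_def)
    then have "norm (coord x n) \<le> norm (P (Suc n) x) + norm (P n x)" by (metis norm_triangle_ineq4)
    then show "norm (coord x n) \<le> 2 * C * norm x" using C(2)[OF x, of n] C(2)[OF x, of "Suc n"] by simp
  qed (use C in simp)
qed

lemma closed_span_eq_bs: "closed_span F A = closure (span (\<Union>n\<in>A. bs n))"
proof -
  have "span (\<Union>n\<in>A. F n) = span (\<Union>n\<in>A. bs n)"
  proof
    show "span (\<Union>n\<in>A. bs n) \<subseteq> span (\<Union>n\<in>A. F n)"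
      using bs_in_F by (intro span_mono) blast
    have "F n \<subseteq> span (\<Union>n\<in>A. bs n)" if "n \<in> A" for n
    proof -
      have "span (bs n) \<subseteq> span (\<Union>n\<in>A. bs n)" using that by (intro span_mono) auto
      then show ?thesis using bs by simp
    qed
    then show "span (\<Union>n\<in>A. F n) \<subseteq> span (\<Union>n\<in>A. bs n)"
      by (intro span_minimal) auto
  qed
  then show ?thesis by (simp add: closed_span_def)
qed

lemma bs_in_X: "b \<in> bs n \<Longrightarrow> b \<in> X"
  using bs_in_F F_in_X by blast

lemma closed_span_subset_X: "closed_span F A \<subseteq> X"
  unfolding closed_span_def using closed_X subspace_X F_in_X by (intro closure_span_subset) auto

lemma subspace_closed_span: "subspace (closed_span F A)"
  unfolding closed_span_def by (rule subspace_closure_span)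

lemma closed_closed_span: "closed (closed_span F A)"
  by (simp add: closed_span_def)

lemma F_closed_span: "n \<in> A \<Longrightarrow> F n \<subseteq> closed_span F A"
  unfolding closed_span_def using closure_subset span_superset by fast

lemma closed_span_mono: "A \<subseteq> B \<Longrightarrow> closed_span F A \<subseteq> closed_span F B"
  unfolding closed_span_def by (intro closure_mono span_mono) auto

lemma approx_pair_X: "fd_subspace E X \<Longrightarrow> approx_pair X norm E"
  by (simp add: approx_pair_def banach_on_norm subspace_X closed_X)

lemma approx_pair_closed_span:
  "fd_subspace E (closed_span F A) \<Longrightarrow> approx_pair (closed_span F A) norm E"
  by (simp add: approx_pair_def banach_on_norm subspace_closed_span closed_closed_span)

lemma P_uniform_on_fd:
  assumes E: "fd_subspace E X" and \<epsilon>: "\<epsilon> > 0"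
  shows "\<exists>j. \<forall>m\<ge>j. \<forall>x\<in>E. norm (x - P m x) \<le> \<epsilon> * norm x"
proof -
  obtain B where B: "finite B" "independent B" "span B = E"
    using E finite_dim_basis by (metis fd_subspace_def)
  have BX: "b \<in> X" if "b \<in> B" for b using that B E span_base by (auto simp: fd_subspace_def)
  obtain c where c: "c > 0" "\<And>a. (\<Sum>b\<in>B. \<bar>a b\<bar>) \<le> c * norm (\<Sum>b\<in>B. a b *\<^sub>R b)"
    using coeff_bound[OF B(1,2)] by blast
  have "\<forall>b\<in>B. \<forall>\<^sub>F m in sequentially. norm (b - P m b) < \<epsilon> / c"
  proof
    fix b assume "b \<in> B"
    then have "(\<lambda>m. P m b) \<longlonglongrightarrow> b" using P_tendsto BX by blast
    then have "\<forall>\<^sub>F m in sequentially. dist (P m b) b < \<epsilon> / c"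
      using \<epsilon> c(1) by (intro tendstoD) auto
    then show "\<forall>\<^sub>F m in sequentially. norm (b - P m b) < \<epsilon> / c"
      by (simp add: dist_norm norm_minus_commute)
  qed
  then have "\<forall>\<^sub>F m in sequentially. \<forall>b\<in>B. norm (b - P m b) < \<epsilon> / c"
    using B(1) by (simp add: eventually_ball_finite_distrib)
  then obtain j where j: "\<And>m b. m \<ge> j \<Longrightarrow> b \<in> B \<Longrightarrow> norm (b - P m b) < \<epsilon> / c"
    unfolding eventually_sequentially by blast
  have "norm (x - P m x) \<le> \<epsilon> * norm x" if "m \<ge> j" "x \<in> E" for m x
  proof -
    have "x \<in> span B" using that B by simp
    then obtain a where a: "x = (\<Sum>b\<in>B. a b *\<^sub>R b)" by (auto simp: span_finite[OF B(1)])
    have "P m x = (\<Sum>b\<in>B. a b *\<^sub>R P m b)"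
      unfolding a using BX B by (intro linear_on_sum[OF linear_on_P subspace_X]) auto
    then have "x - P m x = (\<Sum>b\<in>B. a b *\<^sub>R (b - P m b))"
      by (simp add: a sum_subtractf scaleR_right_diff_distrib)
    also have "norm \<dots> \<le> (\<Sum>b\<in>B. \<bar>a b\<bar> * norm (b - P m b))" by (rule sum_norm_le) simp
    also have "\<dots> \<le> (\<Sum>b\<in>B. \<bar>a b\<bar> * (\<epsilon> / c))"
      using j[OF that(1)] by (intro sum_mono mult_left_mono) (auto intro: less_imp_le)
    also have "\<dots> = (\<epsilon> / c) * (\<Sum>b\<in>B. \<bar>a b\<bar>)" by (simp add: sum_distrib_left mult.commute)
    also have "\<dots> \<le> (\<epsilon> / c) * (c * norm x)" using c \<epsilon> by (intro mult_left_mono) (auto simp: a)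
    also have "\<dots> = \<epsilon> * norm x" using c by simp
    finally show ?thesis .
  qed
  then show ?thesis by blast
qed

text \<open>
  For large \<open>m\<close> the projection \<open>P m\<close> moves the vectors of \<open>E\<close> only slightly, and it is undone by
  \<open>T = I + (I - P m) L\<close> for a bounded \<open>L : X \<rightarrow> E\<close> that is the identity on \<open>E\<close>. To keep
  \<open>T\<close> bounded independently of \<open>E\<close>, choose \<open>L\<close> first and \<open>m\<close> afterwards. This works because \<open>L\<close>
  can be taken to factor through a single \<open>P j\<close>, so that \<open>L (P m x) = L x\<close> for all \<open>m \<ge> j\<close>.
  Thus \<open>(P m, T)\<close> is a morphism from \<open>(X, P m E)\<close> to \<open>(X, E)\<close>.
\<close>

lemma finitely_supported_approximation:
  assumes E: "fd_subspace E X"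
  shows "\<exists>j. \<forall>m\<ge>j. \<exists>T. linear_on X T \<and> T ` X \<subseteq> X \<and> (\<forall>x\<in>X. norm (T x) \<le> 2 * norm x) \<and>
           (\<forall>x\<in>E. T (P m x) = x)"
proof -
  have EX: "E \<subseteq> X" and subE: "subspace E" using E by (auto simp: fd_subspace_def)
  obtain B where B: "finite B" "independent B" "span B = E"
    using E finite_dim_basis by (metis fd_subspace_def)
  have BX: "b \<in> X" if "b \<in> B" for b using that B E span_base by (auto simp: fd_subspace_def)
  obtain j where j: "\<And>m x. m \<ge> j \<Longrightarrow> x \<in> E \<Longrightarrow> norm (x - P m x) \<le> 1/2 * norm x"
    using P_uniform_on_fd[OF E, of "1/2"] by auto
  obtain p where p: "linear p" "\<forall>b\<in>B. p b = P j b"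
    using linear_independent_extend[OF B(2)] by blast
  have pP: "p x = P j x" if "x \<in> E" for x
  proof -
    have "x \<in> span B" using that B by simp
    then obtain a where a: "x = (\<Sum>b\<in>B. a b *\<^sub>R b)" by (auto simp: span_finite[OF B(1)])
    have "P j x = (\<Sum>b\<in>B. a b *\<^sub>R P j b)"
      unfolding a using BX B by (intro linear_on_sum[OF linear_on_P subspace_X]) auto
    also have "\<dots> = p x" using p by (simp add: a linear_sum linear_scale)
    finally show ?thesis by simp
  qed
  have "inj_on p (span B)"
  proof (rule inj_onI)
    fix x y assume xy: "x \<in> span B" "y \<in> span B" "p x = p y"
    then have "x - y \<in> E" using B subE by (simp add: subspace_diff)
    moreover have "P j (x - y) = 0" using pP[OF \<open>x - y \<in> E\<close>] xy(3) p(1) by (simp add: linear_diff)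
    ultimately show "x = y" using j[of j "x - y"] by simp
  qed
  then obtain \<psi> where \<psi>: "range \<psi> \<subseteq> span B" "linear \<psi>" "\<forall>x\<in>span B. \<psi> (p x) = x"
    using linear_inj_on_left_inverse[OF p(1)] by blast
  obtain c where c: "c > 0" "\<And>y. y \<in> span (\<Union>i<j. bs i) \<Longrightarrow> norm (\<psi> y) \<le> c * norm y"
    using linear_bounded_on_span[OF _ \<psi>(2), of "\<Union>i<j. bs i"] bs by auto
  obtain C where C: "C \<ge> 1" "\<And>x n. x \<in> X \<Longrightarrow> norm (P n x) \<le> C * norm x" using P_bounded by metis
  define L where "L x = \<psi> (P j x)" for x
  have L: "L x \<in> E" "norm (L x) \<le> (c * C) * norm x" if "x \<in> X" for x
  proof -
    show "L x \<in> E" using \<psi>(1) B by (auto simp: L_def)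
    have "norm (L x) \<le> c * norm (P j x)" unfolding L_def using that by (intro c P_in_span)
    also have "\<dots> \<le> c * (C * norm x)" using c C(2)[OF that] by (intro mult_left_mono) auto
    finally show "norm (L x) \<le> (c * C) * norm x" by simp
  qed
  have "1 / (c * C) > 0" using c C by simp
  then obtain j' where j': "\<And>m x. m \<ge> j' \<Longrightarrow> x \<in> E \<Longrightarrow> norm (x - P m x) \<le> 1 / (c * C) * norm x"
    using P_uniform_on_fd[OF E] by meson
  show ?thesis
  proof (intro exI[of _ "max j j'"] allI impI)
    fix m assume m: "max j j' \<le> m"
    define T where "T x = x + (L x - P m (L x))" for x
    have LX: "L x \<in> X" if "x \<in> X" for x using L that EX by blast
    have "linear_on X L" unfolding linear_on_def L_def
      using \<psi>(2) by (auto simp: P_add P_scale linear_add linear_scale)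
    then have "linear_on X T" using LX unfolding linear_on_def T_def
      by (auto simp: P_add P_scale scaleR_right_diff_distrib scaleR_right_distrib)
    moreover have "T ` X \<subseteq> X"
      using LX P_in_X subspace_X by (auto simp: T_def intro!: subspace_add subspace_diff)
    moreover have "norm (T x) \<le> 2 * norm x" if x: "x \<in> X" for x
    proof -
      have "norm (L x - P m (L x)) \<le> 1 / (c * C) * norm (L x)" using m L x by (intro j') auto
      also have "\<dots> \<le> 1 / (c * C) * ((c * C) * norm x)" using L x c C by (intro mult_left_mono) auto
      also have "\<dots> = norm x" using c C by simp
      finally show ?thesis unfolding T_def using norm_triangle_ineq[of x "L x - P m (L x)"] by simp
    qed
    moreover have "T (P m x) = x" if x: "x \<in> E" for x
    proof -
      have xX: "x \<in> X" using x EX by blast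
      have "L (P m x) = \<psi> (P j x)" unfolding L_def using m xX by (simp add: P_P)
      also have "\<dots> = x" using \<psi>(3) x B pP[OF x] by auto
      finally show ?thesis by (simp add: T_def)
    qed
    ultimately show "\<exists>T. linear_on X T \<and> T ` X \<subseteq> X \<and> (\<forall>x\<in>X. norm (T x) \<le> 2 * norm x) \<and>
           (\<forall>x\<in>E. T (P m x) = x)" by blast
  qed
qed

text \<open>
  By the previous lemma it suffices to treat \<open>E\<close> supported in \<open>[0, m0)\<close> with \<open>d X norm E\<close> huge. A morphism to \<open>(X, E)\<close> from
  \<open>(X\<^sub>A, G)\<close>, for any \<open>A\<close> containing \<open>{n..<m}\<close>, need not use the blocks below \<open>n\<close>: the
  part of \<open>E\<close> living there is moved by \<open>V\<close> to lines in the blocks from \<open>m0\<close> on, one line for each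
  basis vector, and \<open>U\<close> moves it back. Since the number of lines depends only on \<open>n\<close>, and each one is
  complemented with constant 2 in its block, the norm of the morphism is bounded in terms of \<open>n\<close>
  alone. The subspace \<open>E\<close> can therefore be chosen after this bound is known.
\<close>

lemma large_on_blocks:
  fixes d :: "'u set \<Rightarrow> ('u \<Rightarrow> real) \<Rightarrow> 'u set \<Rightarrow> real"
  assumes deg: "is_degree d" and large: "d_large d X norm"
  shows "\<exists>m. \<forall>A. {n..<m} \<subseteq> A \<longrightarrow>
           (\<exists>G. fd_subspace G (closed_span F A) \<and> M < d (closed_span F A) norm G)"
proof -
  obtain K where gauge: "degree_gauge d K" using degree_has_gauge[OF deg] .
  note K_mono = degree_gauge_mono[OF gauge] and K = degree_gauge_bound[OF gauge]
  have d_pos: "0 \<le> d Y norm E" if "approx_pair Y norm E" for Y E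
    using deg that by (simp add: is_degree_def)
  obtain C where C: "C \<ge> 1" "\<And>x n. x \<in> X \<Longrightarrow> norm (P n x) \<le> C * norm x"
    using P_bounded by metis
  obtain C' where C': "C' \<ge> 1" "\<And>x n. x \<in> X \<Longrightarrow> norm (coord x n) \<le> C' * norm x"
    using coord_bounded by metis
  have ex: "\<forall>i. \<exists>w g. w \<in> F i \<and> norm (w) = 1 \<and> linear (g) \<and> g (w) = (1::real) \<and> (\<forall>x\<in>F i. \<bar>g x\<bar> \<le> 2 * norm x)"
    using norming_functional[OF bs(1) bs(2) bs(4)] bs(3) by simp
  from choice[OF ex] obtain w where "\<forall>i. \<exists>g. w i \<in> F i \<and> norm (w i) = 1 \<and> linear (g) \<and> g (w i) = (1::real) \<and> (\<forall>x\<in>F i. \<bar>g x\<bar> \<le> 2 * norm x)"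
    by (rule exE)
  from choice[OF this] obtain g where wg0: "\<forall>i. w i \<in> F i \<and> norm (w i) = 1 \<and> linear (g i) \<and> g i (w i) = (1::real) \<and> (\<forall>x\<in>F i. \<bar>g i x\<bar> \<le> 2 * norm x)"
    by (rule exE)
  have wg: "\<And>i. w i \<in> F i" "\<And>i. norm (w i) = 1" "\<And>i. linear (g i)"
    "\<And>i. g i (w i) = (1::real)" "\<And>i x. x \<in> F i \<Longrightarrow> \<bar>g i x\<bar> \<le> 2 * norm x"
    using wg0[rule_format] by simp_all
  define D where "D = (\<Union>i<n. bs i)"
  have finD: "finite D" using bs by (auto simp: D_def)
  have indD: "independent D" unfolding D_def by (rule independent_bs)
  define k where "k = card D"
  obtain h where h: "bij_betw h D {0..<k}" unfolding k_def using ex_bij_betw_finite_nat[OF finD] by blast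
  have h_less: "h e < k" if "e \<in> D" for e using h that by (auto simp: bij_betw_def)
  have h_inj: "inj_on h D" using h by (auto simp: bij_betw_def)
  have "\<forall>e. \<exists>f. linear f \<and> (\<forall>b\<in>D. f b = (if b = e then 1 else (0::real)))"
  proof
    fix e
    show "\<exists>f. linear f \<and> (\<forall>b\<in>D. f b = (if b = e then 1 else (0::real)))"
      by (rule linear_independent_extend[OF indD])
  qed
  then obtain \<phi> where \<phi>: "\<And>e. linear (\<phi> e)" "\<And>e b. b \<in> D \<Longrightarrow> \<phi> e b = (if b = e then 1 else (0::real))"
    by metis
  have "\<forall>e. \<exists>c>0. \<forall>x\<in>span D. norm (\<phi> e x) \<le> c * norm x"
    using linear_bounded_on_span[OF finD \<phi>(1)] by blast
  then obtain c where c: "\<And>e. c e > 0" "\<And>e x. x \<in> span D \<Longrightarrow> \<bar>\<phi> e x\<bar> \<le> c e * norm x"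
    by (metis real_norm_def)
  have reconstruct: "(\<Sum>e\<in>D. \<phi> e z *\<^sub>R e) = z" if "z \<in> span D" for z
  proof (rule linear_eq_on_span[of "\<lambda>z. \<Sum>e\<in>D. \<phi> e z *\<^sub>R e" "\<lambda>z. z", OF _ _ _ that])
    show "linear (\<lambda>z. \<Sum>e\<in>D. \<phi> e z *\<^sub>R e)"
      by (intro linear_compose_sum ballI) (simp add: linear_iff linear_add[OF \<phi>(1)] linear_scale[OF \<phi>(1)] scaleR_left_distrib)
    show "linear (\<lambda>z::'u. z)" by (simp add: linear_iff)
    show "(\<Sum>e\<in>D. \<phi> e b *\<^sub>R e) = b" if "b \<in> D" for b
    proof -
      have "(\<Sum>e\<in>D. \<phi> e b *\<^sub>R e) = (\<Sum>e\<in>D. if b = e then b else 0)"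
        using that \<phi>(2) by (intro sum.cong) auto
      then show ?thesis using finD that by simp
    qed
  qed
  define CD where "CD = (\<Sum>e\<in>D. c e)"
  have CD: "CD \<ge> 0" unfolding CD_def using c(1) by (intro sum_nonneg) (simp add: less_imp_le)
  define a where "a = 1 + C + CD * C"
  \<comment> \<open>\<open>a\<close> and \<open>b\<close> will bound \<open>S\<close> and \<open>T\<close>; they depend on \<open>n\<close> only.\<close>
  define b where "b = 2 * C + (\<Sum>e\<in>D. 2 * C' * norm e)"
  have a1: "1 \<le> a" using C CD by (simp add: a_def)
  have "0 \<le> (\<Sum>e\<in>D. 2 * C' * norm e)" using C' by (intro sum_nonneg) auto
  then have b1: "1 \<le> b" using C by (simp add: b_def)
  \<comment> \<open>Two gauges are applied in turn, since the approximation of \<open>E\<close> by a finitely supported subspace costs a morphism of its own.\<close>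
  define t where "t = max 0 (K (a * b) (max M 0))"
  have "\<not> bdd_above {d X norm E |E. fd_subspace E X}"
    using large by (simp add: d_large_def d_small_def)
  then obtain E where E: "fd_subspace E X" "K (C * 2) t < d X norm E"
    by (auto simp: bdd_above_def not_le)
  have EX: "E \<subseteq> X" using E by (simp add: fd_subspace_def)
  obtain j where j: "\<And>m. m \<ge> j \<Longrightarrow> \<exists>T. linear_on X T \<and> T ` X \<subseteq> X \<and>
      (\<forall>x\<in>X. norm (T x) \<le> 2 * norm x) \<and> (\<forall>x\<in>E. T (P m x) = x)"
    using finitely_supported_approximation[OF E(1)] by blast
  define m0 where "m0 = max j n"
  have nm: "n \<le> m0" by (simp add: m0_def)
  obtain T0 where T0: "linear_on X T0" "T0 ` X \<subseteq> X" "\<And>x. x \<in> X \<Longrightarrow> norm (T0 x) \<le> 2 * norm x"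
    "\<And>x. x \<in> E \<Longrightarrow> T0 (P m0 x) = x"
    using j[of m0] by (auto simp: m0_def)
  define E1 where "E1 = P m0 ` E"
  have E1: "fd_subspace E1 X"
    using fd_image[OF linear_on_P subspace_X, of E m0] E P_in_X EX
    by (auto simp: fd_subspace_def E1_def)
  have E1X: "E1 \<subseteq> X" using E1 by (simp add: fd_subspace_def)
  have large1: "K (a * b) (max M 0) < d X norm E1"
  proof (rule ccontr)
    assume "\<not> K (a * b) (max M 0) < d X norm E1"
    then have "d X norm E1 \<le> t" by (simp add: t_def)
    then have "K (C * 2) (d X norm E1) \<le> K (C * 2) t"
      using C d_pos[OF approx_pair_X[OF E1]] by (intro K_mono) auto
    moreover have "d X norm E \<le> K (C * 2) (d X norm E1)"
    proof (rule K[where S = "P m0" and T = T0])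
      show "linear_on E (P m0)" using linear_on_P EX unfolding linear_on_def by blast
    qed (use E E1 E1_def T0 C EX in \<open>auto intro: approx_pair_X\<close>)
    ultimately show False using E(2) by simp
  qed
  define V where "V z = (\<Sum>e\<in>D. \<phi> e z *\<^sub>R w (m0 + h e))" for z
  define U where "U y = (\<Sum>e\<in>D. g (m0 + h e) (coord y (m0 + h e)) *\<^sub>R e)" for y
  define S where "S x = x - P n x + V (P n x)" for x
  define T where "T y = P m0 y - P n y + U y" for y
  have wX: "w i \<in> X" for i using wg(1) F_in_X by blast
  have VX: "V z \<in> X" for z unfolding V_def
    by (intro subspace_sum[OF subspace_X] subspace_scale[OF subspace_X] wX)
  have linV: "linear V" unfolding V_def
    by (intro linear_compose_sum ballI)
       (simp add: linear_iff linear_add[OF \<phi>(1)] linear_scale[OF \<phi>(1)] scaleR_left_distrib)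
  have linU: "linear_on X U" unfolding linear_on_def U_def
    by (simp add: coord_add coord_scale linear_add[OF wg(3)] linear_scale[OF wg(3)]
        scaleR_left_distrib sum.distrib scaleR_sum_right)
  have D_X: "e \<in> X" if "e \<in> D" for e using that bs_in_X by (auto simp: D_def)
  have UX: "U y \<in> X" for y unfolding U_def
    by (intro subspace_sum[OF subspace_X] subspace_scale[OF subspace_X] D_X)
  have linS: "linear_on X S" unfolding linear_on_def S_def
    by (simp add: P_add P_scale linear_add[OF linV] linear_scale[OF linV] scaleR_right_diff_distrib scaleR_right_distrib)
  have linT: "linear_on X T" using linU unfolding linear_on_def T_def
    by (simp add: P_add P_scale scaleR_right_diff_distrib scaleR_right_distrib)
  have S_bound: "norm (S x) \<le> a * norm x" if x: "x \<in> X" for x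
  proof -
    have "norm (V (P n x)) \<le> (\<Sum>e\<in>D. c e * (C * norm x))"
      unfolding V_def
    proof (rule sum_norm_le)
      fix e assume "e \<in> D"
      have "\<bar>\<phi> e (P n x)\<bar> \<le> c e * norm (P n x)" using P_in_span[OF x] by (intro c) (simp add: D_def)
      also have "\<dots> \<le> c e * (C * norm x)" using c(1)[of e] C(2)[OF x] by (intro mult_left_mono) auto
      finally show "norm (\<phi> e (P n x) *\<^sub>R w (m0 + h e)) \<le> c e * (C * norm x)" by (simp add: wg)
    qed
    then have "norm (V (P n x)) \<le> CD * (C * norm x)" by (simp add: CD_def sum_distrib_right)
    moreover have "norm (S x) \<le> norm x + norm (P n x) + norm (V (P n x))"
      unfolding S_def by (meson add_right_mono norm_triangle_ineq norm_triangle_ineq4 order_trans)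
    ultimately show ?thesis using C(2)[OF x, of n] by (simp add: a_def algebra_simps)
  qed
  have T_bound: "norm (T y) \<le> b * norm y" if y: "y \<in> X" for y
  proof -
    have "norm (U y) \<le> (\<Sum>e\<in>D. (2 * C' * norm e) * norm y)"
      unfolding U_def
    proof (rule sum_norm_le)
      fix e assume "e \<in> D"
      let ?i = "m0 + h e"
      have "\<bar>g ?i (coord y ?i)\<bar> \<le> 2 * norm (coord y ?i)" using y by (intro wg coord_props)
      also have "\<dots> \<le> 2 * (C' * norm y)" using C'(2)[OF y] by simp
      finally have "\<bar>g ?i (coord y ?i)\<bar> * norm e \<le> 2 * (C' * norm y) * norm e"
        by (intro mult_right_mono) auto
      then show "norm (g ?i (coord y ?i) *\<^sub>R e) \<le> (2 * C' * norm e) * norm y" by (simp add: mult_ac)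
    qed
    then have "norm (U y) \<le> (\<Sum>e\<in>D. 2 * C' * norm e) * norm y" by (simp add: sum_distrib_right)
    moreover have "norm (T y) \<le> norm (P m0 y) + norm (P n y) + norm (U y)"
      unfolding T_def by (meson add_right_mono norm_triangle_ineq norm_triangle_ineq4 order_trans)
    ultimately show ?thesis using C(2)[OF y, of n] C(2)[OF y, of m0] by (simp add: b_def algebra_simps)
  qed
  have coordV: "coord (V z) i = (\<Sum>e\<in>D. \<phi> e z *\<^sub>R (if i = m0 + h e then w i else 0))" for z i
  proof -
    have "coord (V z) i = (\<Sum>e\<in>D. \<phi> e z *\<^sub>R coord (w (m0 + h e)) i)"
      unfolding V_def using linear_on_sum[OF linear_on_coord subspace_X finD] wX by simp
    also have "\<dots> = (\<Sum>e\<in>D. \<phi> e z *\<^sub>R (if i = m0 + h e then w i else 0))"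
      using coord_F[OF wg(1)] by (intro sum.cong) auto
    finally show ?thesis .
  qed
  have PV: "P i (V z) = 0" if "i \<le> m0" for z i
    unfolding P_def coordV using that by (auto intro!: sum.neutral)
  have UV: "U (V z) = z" if z: "z \<in> span D" for z
  proof -
    have "coord (V z) (m0 + h e) = \<phi> e z *\<^sub>R w (m0 + h e)" if e: "e \<in> D" for e
    proof -
      have "coord (V z) (m0 + h e) = (\<Sum>e'\<in>D. if e' = e then \<phi> e z *\<^sub>R w (m0 + h e) else 0)"
        unfolding coordV using e h_inj by (intro sum.cong) (auto dest: inj_onD)
      then show ?thesis using finD e by simp
    qed
    then have "U (V z) = (\<Sum>e\<in>D. \<phi> e z *\<^sub>R e)"
      unfolding U_def by (intro sum.cong) (auto simp: linear_scale[OF wg(3)] wg(4))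
    then show ?thesis using reconstruct[OF z] by simp
  qed
  have TS: "T (S x) = x" if xE: "x \<in> E1" for x
  proof -
    obtain x' where x': "x' \<in> X" "x = P m0 x'" using xE EX by (auto simp: E1_def)
    have x: "x \<in> X" using xE E1X by blast
    have Px: "P m0 x = x" using x' by (simp add: P_P)
    define z where "z = P n x"
    have zX: "z \<in> X" using x by (simp add: z_def P_in_X)
    have zD: "z \<in> span D" unfolding z_def D_def using x by (rule P_in_span)
    have uX: "x - z \<in> X" using x zX subspace_X by (simp add: subspace_diff)
    have Pz: "P m0 z = z" "P n z = z" using x nm by (auto simp: z_def P_P min_def)
    have "coord (x - z) (m0 + i) = 0" for i
    proof -
      have "coord x (m0 + i) = 0" using x' coord_P[OF x'(1), of m0] by simp
      moreover have "coord z (m0 + i) = 0" using coord_P[OF x, of n] nm by (simp add: z_def)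
      ultimately show ?thesis using x zX by (simp add: coord_diff)
    qed
    then have "U (x - z) = 0" unfolding U_def by (simp add: linear_0[OF wg(3)])
    then have "U (S x) = z"
      using linU uX VX UV[OF zD] unfolding linear_on_def S_def z_def[symmetric] by simp
    moreover have "P m0 (S x) = x - z" "P n (S x) = 0"
      unfolding S_def z_def[symmetric] using x zX uX VX Pz Px PV nm
      by (simp_all add: P_add P_diff, simp add: z_def)
    ultimately show ?thesis by (simp add: T_def)
  qed
  show ?thesis
  proof (intro exI[of _ "m0 + k"] allI impI)
    fix A assume A: "{n..<m0 + k} \<subseteq> A"
    let ?Y = "closed_span F A"
    have FY: "F i \<subseteq> ?Y" if "n \<le> i" "i < m0 + k" for i using that A by (intro F_closed_span) auto
    have SY: "S x \<in> ?Y" if xE: "x \<in> E1" for x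
    proof -
      obtain x' where x': "x' \<in> X" "x = P m0 x'" using xE EX by (auto simp: E1_def)
      have "x - P n x = (\<Sum>i\<in>{n..<m0}. coord x' i)"
      proof -
        have "{..<m0} = {..<n} \<union> {n..<m0}" using nm by auto
        then have "P m0 x' = P n x' + (\<Sum>i\<in>{n..<m0}. coord x' i)"
          unfolding P_def by (simp add: sum.union_disjoint ivl_disj_int)
        moreover have "P n x = P n x'" unfolding x'(2) using x'(1) nm by (simp add: P_P min_def)
        ultimately show ?thesis by (simp add: x'(2))
      qed
      moreover have "(\<Sum>i\<in>{n..<m0}. coord x' i) \<in> ?Y"
        using FY coord_props(1)[OF x'(1)] by (intro subspace_sum subspace_closed_span) fastforce
      moreover have "w (m0 + h e) \<in> ?Y" if "e \<in> D" for e
        using FY[of "m0 + h e"] h_less[OF that] nm wg(1) by auto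
      then have "V z \<in> ?Y" for z unfolding V_def
        by (intro subspace_sum[OF subspace_closed_span] subspace_scale[OF subspace_closed_span])
      ultimately show ?thesis unfolding S_def by (simp add: subspace_add[OF subspace_closed_span])
    qed
    have "subspace E1" "finite_dim E1" using E1 by (auto simp: fd_subspace_def)
    then have G: "fd_subspace (S ` E1) ?Y"
      using fd_image[OF linS subspace_X _ _ E1X] SY by (auto simp: fd_subspace_def)
    have "d X norm E1 \<le> K (a * b) (d ?Y norm (S ` E1))"
    proof (rule K[where S = S and T = T])
      show "linear_on E1 S" using linS E1X unfolding linear_on_def by blast
      show "linear_on ?Y T" using linT closed_span_subset_X[of A] unfolding linear_on_def by blast
      show "T ` ?Y \<subseteq> X" using closed_span_subset_X[of A] P_in_X UX
        by (auto simp: T_def intro!: subspace_add[OF subspace_X] subspace_diff[OF subspace_X])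
      show "norm (S x) \<le> a * norm x" if "x \<in> E1" for x using that E1X by (intro S_bound) auto
      show "norm (T y) \<le> b * norm y" if "y \<in> ?Y" for y
        using that closed_span_subset_X[of A] by (intro T_bound) auto
    qed (use G E1 TS a1 b1 in \<open>auto intro: approx_pair_X approx_pair_closed_span\<close>)
    moreover have "1 \<le> a * b" using a1 b1 mult_mono[of 1 a 1 b] by simp
    ultimately have "\<not> d ?Y norm (S ` E1) \<le> max M 0"
      using K_mono[of "a * b" "d ?Y norm (S ` E1)" "max M 0"] large1
        d_pos[OF approx_pair_closed_span[OF G]] by linarith
    then show "\<exists>G. fd_subspace G ?Y \<and> M < d ?Y norm G" using G by (intro exI[of _ "S ` E1"]) auto
  qed
qed

end

section \<open>Embeddings determined on dense families\<close>

lemma countable_dense_in_span: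
  fixes D :: "'a::real_normed_vector set"
  assumes "finite D"
  obtains Q where "countable Q" "Q \<noteq> {}" "Q \<subseteq> span D" "span D \<subseteq> closure Q"
proof -
  define Q where "Q = (\<lambda>r. \<Sum>b\<in>D. r b *\<^sub>R b) ` (D \<rightarrow>\<^sub>E (\<rat>::real set))"
  show thesis
  proof (rule that)
    show "countable Q" unfolding Q_def
      using assms countable_rat by (intro countable_image countable_PiE) auto
    show "Q \<subseteq> span D" unfolding Q_def by (auto intro: span_sum span_scale span_base)
    show "span D \<subseteq> closure Q"
    proof
      fix x assume "x \<in> span D"
      then obtain c where c: "x = (\<Sum>b\<in>D. c b *\<^sub>R b)" by (auto simp: span_finite[OF assms])
      show "x \<in> closure Q" unfolding closure_approachable
      proof (intro allI impI)
        fix e :: real assume e: "e > 0"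
        define M where "M = 1 + (\<Sum>b\<in>D. norm b)"
        have M: "M > 0" unfolding M_def by (intro add_pos_nonneg sum_nonneg) auto
        have "\<exists>r\<in>\<rat>. c b < r \<and> r < c b + e / M" for b
          using Rats_dense_in_real[of "c b" "c b + e / M"] e M by auto
        then obtain r where r: "\<And>b. r b \<in> \<rat>" "\<And>b. c b < r b" "\<And>b. r b < c b + e / M" by metis
        define y where "y = (\<Sum>b\<in>D. restrict r D b *\<^sub>R b)"
        have "y \<in> Q" unfolding Q_def y_def using r(1)
          by (intro image_eqI[where x = "restrict r D"]) auto
        moreover have "dist y x < e"
        proof -
          have "y - x = (\<Sum>b\<in>D. (r b - c b) *\<^sub>R b)"
            by (simp add: y_def c scaleR_left_diff_distrib sum_subtractf)
          also have "norm \<dots> \<le> (\<Sum>b\<in>D. (e / M) * norm b)"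
          proof (rule sum_norm_le)
            fix b assume "b \<in> D"
            have "\<bar>r b - c b\<bar> \<le> e / M" using r(2,3)[of b] by linarith
            then show "norm ((r b - c b) *\<^sub>R b) \<le> (e / M) * norm b"
              using mult_right_mono[OF _ norm_ge_zero, of "\<bar>r b - c b\<bar>" "e / M" b] by simp
          qed
          also have "\<dots> = (e / M) * (M - 1)" by (simp add: M_def sum_distrib_left)
          also have "\<dots> < e" using e M by (simp add: field_simps)
          finally show ?thesis by (simp add: dist_norm)
        qed
        ultimately show "\<exists>y\<in>Q. dist y x < e" by blast
      qed
    qed
    then show "Q \<noteq> {}" using span_zero by fastforce
  qed
qed

lemma span_image_explicit:
  assumes "p \<in> span (h ` A)"
  obtains I c where "finite I" "I \<subseteq> A" "p = (\<Sum>i\<in>I. c i *\<^sub>R h i)"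
proof -
  obtain t r where t: "finite t" "t \<subseteq> h ` A" "p = (\<Sum>v\<in>t. r v *\<^sub>R v)"
    using assms unfolding span_explicit by blast
  obtain I where I: "I \<subseteq> A" "inj_on h I" "t = h ` I" using t(2) subset_image_inj by metis
  have "finite I" using t(1) I by (simp add: finite_image_iff)
  moreover have "p = (\<Sum>i\<in>I. r (h i) *\<^sub>R h i)"
    unfolding t(3) I(3) using I(2) by (simp add: sum.reindex)
  ultimately show thesis using that[of I "\<lambda>i. r (h i)"] I by blast
qed

text \<open>
  The embedding is the operator whose graph \<open>G\<close> is the closed span of the pairs \<open>(q i, y i)\<close>. The two
  inequalities pass to the closure and make \<open>G\<close> the graph of a bounded bijection with bounded inverse;
  completeness makes its domain closed.
\<close>

lemma embedding_from_equivalent_families: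
  fixes q :: "'i \<Rightarrow> 'a::banach" and y :: "'i \<Rightarrow> 'b::banach"
  assumes upper: "\<And>I c. finite I \<Longrightarrow> I \<subseteq> A \<Longrightarrow>
        norm (\<Sum>i\<in>I. c i *\<^sub>R y i) \<le> K * norm (\<Sum>i\<in>I. c i *\<^sub>R q i)"
    and lower: "\<And>I c. finite I \<Longrightarrow> I \<subseteq> A \<Longrightarrow>
        norm (\<Sum>i\<in>I. c i *\<^sub>R q i) \<le> K * norm (\<Sum>i\<in>I. c i *\<^sub>R y i)"
    and Z: "subspace Z" "closed Z" "y ` A \<subseteq> Z"
  shows "embeds_in (closure (span (q ` A))) norm Z norm"
proof -
  define G0 where "G0 = span ((\<lambda>i. (q i, y i)) ` A)"
  define G where "G = closure G0"
  have subG: "subspace G" unfolding G_def G0_def by (rule subspace_closure_span)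
  have "G0 \<subseteq> {p. norm (snd p) \<le> K * norm (fst p) \<and> norm (fst p) \<le> K * norm (snd p)}"
  proof
    fix p assume "p \<in> G0"
    then obtain I c where "finite I" "I \<subseteq> A" "p = (\<Sum>i\<in>I. c i *\<^sub>R (q i, y i))"
      unfolding G0_def by (rule span_image_explicit)
    then show "p \<in> {p. norm (snd p) \<le> K * norm (fst p) \<and> norm (fst p) \<le> K * norm (snd p)}"
      using upper lower by (simp add: fst_sum snd_sum)
  qed
  moreover have "closed {p::'a \<times> 'b. norm (snd p) \<le> K * norm (fst p) \<and> norm (fst p) \<le> K * norm (snd p)}"
    by (intro closed_Collect_conj closed_Collect_le continuous_intros)
  ultimately have "G \<subseteq> {p. norm (snd p) \<le> K * norm (fst p) \<and> norm (fst p) \<le> K * norm (snd p)}"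
    unfolding G_def by (rule closure_minimal)
  then have G: "norm z \<le> K * norm x" "norm x \<le> K * norm z" if "(x, z) \<in> G" for x z
    using that by auto
  let ?V = "closure (span (q ` A))"
  have G0_fst: "fst ` G0 = span (q ` A)"
    unfolding G0_def using linear_span_image[OF linear_fst, of "(\<lambda>i. (q i, y i)) ` A"]
    by (simp add: image_image)
  have GV: "x \<in> ?V" if "(x, z) \<in> G" for x z
  proof -
    have "fst ` G \<subseteq> closure (fst ` G0)" unfolding G_def
      by (intro image_closure_subset continuous_on_fst continuous_on_id closed_closure closure_subset)
    then show ?thesis using that G0_fst by force
  qed
  have GZ: "z \<in> Z" if "(x, z) \<in> G" for x z
  proof -
    have "subspace (UNIV \<times> Z)" using Z by (simp add: subspace_Times)
    moreover have "closed ((UNIV::'a set) \<times> Z)" using Z by (intro closed_Times) auto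
    ultimately have "G \<subseteq> UNIV \<times> Z" unfolding G_def G0_def
      using Z(3) by (intro closure_span_subset) auto
    then show ?thesis using that by auto
  qed
  \<comment> \<open>The second components of a sequence in \<open>G0\<close> are Cauchy if the first components are.\<close>
  have total: "\<exists>z. (x, z) \<in> G" if x: "x \<in> ?V" for x
  proof -
    obtain f where f: "\<And>n. f n \<in> span (q ` A)" "f \<longlonglongrightarrow> x"
      using x by (auto simp: closure_sequential)
    have "\<forall>n. \<exists>z. (f n, z) \<in> G0" using f(1) G0_fst by (metis fst_conv imageE prod.collapse)
    then obtain z where z: "\<And>n. (f n, z n) \<in> G0" by metis
    have zd: "norm (z m - z n) \<le> \<bar>K\<bar> * norm (f m - f n)" for m n
    proof -
      have "(f m, z m) - (f n, z n) \<in> G0" unfolding G0_def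
        by (intro span_diff z[unfolded G0_def])
      then have "(f m - f n, z m - z n) \<in> G" unfolding G_def using closure_subset by auto
      then have "norm (z m - z n) \<le> K * norm (f m - f n)" by (rule G)
      also have "\<dots> \<le> \<bar>K\<bar> * norm (f m - f n)" by (intro mult_right_mono) auto
      finally show ?thesis .
    qed
    have "Cauchy z" unfolding Cauchy_iff
    proof (intro allI impI)
      fix e :: real assume "e > 0"
      then have "e / (\<bar>K\<bar> + 1) > 0" by simp
      then obtain M where M: "\<And>m n. m \<ge> M \<Longrightarrow> n \<ge> M \<Longrightarrow> norm (f m - f n) < e / (\<bar>K\<bar> + 1)"
        using LIMSEQ_imp_Cauchy[OF f(2)] unfolding Cauchy_iff by blast
      show "\<exists>M. \<forall>m\<ge>M. \<forall>n\<ge>M. norm (z m - z n) < e"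
      proof (intro exI allI impI)
        fix m n assume "m \<ge> M" "n \<ge> M"
        then have "norm (f m - f n) < e / (\<bar>K\<bar> + 1)" by (rule M)
        then have "(\<bar>K\<bar> + 1) * norm (f m - f n) < e" by (simp add: pos_less_divide_eq mult.commute)
        moreover have "\<bar>K\<bar> * norm (f m - f n) \<le> (\<bar>K\<bar> + 1) * norm (f m - f n)"
          by (intro mult_right_mono) auto
        ultimately show "norm (z m - z n) < e" using zd[of m n] by linarith
      qed
    qed
    then obtain l where "z \<longlonglongrightarrow> l" using Cauchy_convergent convergent_def by blast
    with f(2) have "(\<lambda>n. (f n, z n)) \<longlonglongrightarrow> (x, l)" by (rule tendsto_Pair)
    then have "(x, l) \<in> G" unfolding G_def closure_sequential
      using z by (intro exI[of _ "\<lambda>n. (f n, z n)"]) auto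
    then show ?thesis by blast
  qed
  have inj1: "z = z'" if "(x, z) \<in> G" "(x, z') \<in> G" for x z z'
    using G(1)[of 0 "z - z'"] subspace_diff[OF subG that] by simp
  have inj2: "x = x'" if "(x, z) \<in> G" "(x', z) \<in> G" for x x' z
    using G(2)[of "x - x'" 0] subspace_diff[OF subG that] by simp
  define T where "T x = (SOME z. (x, z) \<in> G)" for x
  define S where "S z = (SOME x. (x, z) \<in> G)" for z
  have T: "(x, T x) \<in> G" if "x \<in> ?V" for x
    unfolding T_def using total[OF that] by (rule someI_ex)
  have T_eq: "T x = z" if "(x, z) \<in> G" for x z
    using T[OF GV[OF that]] that inj1 by blast
  have S_eq: "S z = x" if "(x, z) \<in> G" for x z
  proof -
    have "(S z, z) \<in> G" unfolding S_def using that by (rule someI)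
    then show ?thesis using that inj2 by blast
  qed
  have add: "(x + x', z + z') \<in> G" if "(x, z) \<in> G" "(x', z') \<in> G" for x x' z z'
    using subspace_add[OF subG that] by simp
  have scale: "(c *\<^sub>R x, c *\<^sub>R z) \<in> G" if "(x, z) \<in> G" for c x z
    using subspace_scale[OF subG that] by simp
  define U where "U = snd ` G"
  have subU: "subspace U" unfolding U_def by (intro linear_subspace_image linear_snd subG)
  have UZ: "U \<subseteq> Z" using GZ by (auto simp: U_def)
  have "bounded_op ?V norm U norm T"
    unfolding bounded_op_def linear_on_def
  proof (intro conjI ballI allI exI[of _ K])
    show "T ` ?V \<subseteq> U" using T by (force simp: U_def)
    show "T (x + x') = T x + T x'" if "x \<in> ?V" "x' \<in> ?V" for x x'
      using that by (intro T_eq add T)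
    show "T (c *\<^sub>R x) = c *\<^sub>R T x" if "x \<in> ?V" for c x using that by (intro T_eq scale T)
    show "norm (T x) \<le> K * norm x" if "x \<in> ?V" for x using that by (intro G T)
  qed
  moreover have "bounded_op U norm ?V norm S"
    unfolding bounded_op_def linear_on_def
  proof (intro conjI ballI allI exI[of _ K])
    show "S ` U \<subseteq> ?V" using S_eq GV by (force simp: U_def)
    show "S (z + z') = S z + S z'" if "z \<in> U" "z' \<in> U" for z z'
      using that S_eq add by (force simp: U_def)
    show "S (c *\<^sub>R z) = c *\<^sub>R S z" if "z \<in> U" for c z using that S_eq scale by (force simp: U_def)
    show "norm (S z) \<le> K * norm z" if "z \<in> U" for z using that S_eq G by (force simp: U_def)
  qed
  moreover have "S (T x) = x" if "x \<in> ?V" for x using T[OF that] by (rule S_eq)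
  moreover have "T (S z) = z" if "z \<in> U" for z using that S_eq T_eq by (force simp: U_def)
  ultimately show ?thesis unfolding embeds_in_def isomorphic_on_def using subU UZ by blast
qed

section \<open>The embedding relation as a countable union of projections of closed sets\<close>

text \<open>
  The code \<open>\<sigma>\<close> of an embedding \<open>T\<close> lists, for each vector \<open>q i\<close> of the domain and each \<open>j\<close>, the
  index of a vector of the range that approximates \<open>T (q i)\<close> up to an error of order \<open>1/2\<^sup>j\<close>. When
  all supports are finite, every instance of a clause depends on finitely many values of \<open>a\<close>, \<open>b\<close>, \<open>\<sigma>\<close>
  only, and the set is closed. The error terms in the last clause vanish as \<open>j\<close> grows and leave the
  inequalities that say that \<open>T\<close> is an isomorphism onto its image with constant \<open>K\<close>.
\<close>

definition coded_embeddings ::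
  "(nat \<Rightarrow> 'a::real_normed_vector) \<Rightarrow> (nat \<Rightarrow> nat set) \<Rightarrow> real \<Rightarrow>
   ((nat \<Rightarrow> bool) \<times> (nat \<Rightarrow> bool) \<times> (nat \<Rightarrow> nat)) set"
where
  "coded_embeddings q supp K = {(a, b, \<sigma>).
     (\<forall>i j. supp i \<subseteq> Collect a \<longrightarrow> supp (\<sigma> (prod_encode (i, j))) \<subseteq> Collect b) \<and>
     (\<forall>i j. supp i \<subseteq> Collect a \<longrightarrow>
        norm (q (\<sigma> (prod_encode (i, Suc j))) - q (\<sigma> (prod_encode (i, j)))) \<le> (1/2) ^ j) \<and>
     (\<forall>I c j. finite I \<and> (\<forall>i\<in>I. supp i \<subseteq> Collect a) \<longrightarrow>
        norm (\<Sum>i\<in>I. c i *\<^sub>R q (\<sigma> (prod_encode (i, j))))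
          \<le> K * norm (\<Sum>i\<in>I. c i *\<^sub>R q i) + (\<Sum>i\<in>I. \<bar>c i\<bar>) * (1/2) ^ j \<and>
        norm (\<Sum>i\<in>I. c i *\<^sub>R q i)
          \<le> K * (norm (\<Sum>i\<in>I. c i *\<^sub>R q (\<sigma> (prod_encode (i, j)))) + (\<Sum>i\<in>I. \<bar>c i\<bar>) * (1/2) ^ j))}"

lemma coded_embeddings_closed:
  assumes fin: "\<And>i. finite (supp i)"
    and lim: "\<And>n. \<exists>a' b' \<sigma>'. agree n a a' \<and> agree n b b' \<and> agree n \<sigma> \<sigma>' \<and>
                (a', b', \<sigma>') \<in> coded_embeddings q supp K"
  shows "(a, b, \<sigma>) \<in> coded_embeddings q supp K"
proof -
  have agree_subset: "s \<subseteq> Collect x \<longleftrightarrow> s \<subseteq> Collect x'"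
    if "agree n x x'" "s \<subseteq> {..<n}" for n s and x x' :: "nat \<Rightarrow> bool"
    using that by (auto simp: agree_def subset_iff)
  have bound: "\<exists>n. S \<subseteq> {..<n}" if "finite S" for S :: "nat set"
    using that finite_nat_iff_bounded by blast
  have 1: "supp (\<sigma> (prod_encode (i, j))) \<subseteq> Collect b" if a: "supp i \<subseteq> Collect a" for i j
  proof -
    obtain n where n: "supp i \<union> supp (\<sigma> (prod_encode (i, j))) \<union> {prod_encode (i, j)} \<subseteq> {..<n}"
      using bound[of "supp i \<union> supp (\<sigma> (prod_encode (i, j))) \<union> {prod_encode (i, j)}"] fin by auto
    obtain a' b' \<sigma>' where *: "agree n a a'" "agree n b b'" "agree n \<sigma> \<sigma>'"
      "(a', b', \<sigma>') \<in> coded_embeddings q supp K" using lim by blast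
    have "supp i \<subseteq> Collect a'" using a agree_subset[OF *(1), of "supp i"] n by auto
    then have "supp (\<sigma>' (prod_encode (i, j))) \<subseteq> Collect b'"
      using *(4) unfolding coded_embeddings_def by blast
    moreover have "\<sigma>' (prod_encode (i, j)) = \<sigma> (prod_encode (i, j))"
      using *(3) n by (simp add: agree_def)
    ultimately show ?thesis using agree_subset[OF *(2), of "supp (\<sigma> (prod_encode (i, j)))"] n by simp
  qed
  have 2: "norm (q (\<sigma> (prod_encode (i, Suc j))) - q (\<sigma> (prod_encode (i, j)))) \<le> (1/2) ^ j"
    if a: "supp i \<subseteq> Collect a" for i j
  proof -
    obtain n where n: "supp i \<union> {prod_encode (i, j), prod_encode (i, Suc j)} \<subseteq> {..<n}"
      using bound[of "supp i \<union> {prod_encode (i, j), prod_encode (i, Suc j)}"] fin by auto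
    obtain a' b' \<sigma>' where *: "agree n a a'" "agree n b b'" "agree n \<sigma> \<sigma>'"
      "(a', b', \<sigma>') \<in> coded_embeddings q supp K" using lim by blast
    have "supp i \<subseteq> Collect a'" using a agree_subset[OF *(1), of "supp i"] n by auto
    then have "norm (q (\<sigma>' (prod_encode (i, Suc j))) - q (\<sigma>' (prod_encode (i, j)))) \<le> (1/2) ^ j"
      using *(4) unfolding coded_embeddings_def by blast
    then show ?thesis using *(3) n by (simp add: agree_def)
  qed
  have 3: "norm (\<Sum>i\<in>I. c i *\<^sub>R q (\<sigma> (prod_encode (i, j))))
          \<le> K * norm (\<Sum>i\<in>I. c i *\<^sub>R q i) + (\<Sum>i\<in>I. \<bar>c i\<bar>) * (1/2) ^ j \<and>
        norm (\<Sum>i\<in>I. c i *\<^sub>R q i)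
          \<le> K * (norm (\<Sum>i\<in>I. c i *\<^sub>R q (\<sigma> (prod_encode (i, j)))) + (\<Sum>i\<in>I. \<bar>c i\<bar>) * (1/2) ^ j)"
    if I: "finite I" and a: "\<forall>i\<in>I. supp i \<subseteq> Collect a" for I c j
  proof -
    obtain n where n: "(\<Union>i\<in>I. supp i) \<union> (\<lambda>i. prod_encode (i, j)) ` I \<subseteq> {..<n}"
      using bound[of "(\<Union>i\<in>I. supp i) \<union> (\<lambda>i. prod_encode (i, j)) ` I"] fin I by auto
    obtain a' b' \<sigma>' where *: "agree n a a'" "agree n b b'" "agree n \<sigma> \<sigma>'"
      "(a', b', \<sigma>') \<in> coded_embeddings q supp K" using lim by blast
    have "supp i \<subseteq> Collect a'" if "i \<in> I" for i
      using a agree_subset[OF *(1), of "supp i"] n that by blast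
    moreover have "\<sigma>' (prod_encode (i, j)) = \<sigma> (prod_encode (i, j))" if "i \<in> I" for i
      using *(3) n that by (auto simp: agree_def)
    then have "(\<Sum>i\<in>I. c i *\<^sub>R q (\<sigma> (prod_encode (i, j)))) = (\<Sum>i\<in>I. c i *\<^sub>R q (\<sigma>' (prod_encode (i, j))))"
      by (intro sum.cong) auto
    ultimately show ?thesis using *(4) I unfolding coded_embeddings_def by simp
  qed
  show ?thesis unfolding coded_embeddings_def using 1 2 3 by blast
qed

context fdd begin

text \<open>
  One sequence serves all \<open>A\<close> at once: for every finite set \<open>s\<close> of indices it enumerates a
  countable dense subset of the span of the blocks in \<open>s\<close>.
\<close>

lemma dense_finitely_supported:
  obtains q :: "nat \<Rightarrow> 'u" and supp :: "nat \<Rightarrow> nat set" where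
    "\<And>i. finite (supp i)" "\<And>i. q i \<in> span (\<Union>n\<in>supp i. F n)"
    "\<And>A. closed_span F A \<subseteq> closure (q ` {i. supp i \<subseteq> A})"
proof -
  have ex: "\<exists>Q. countable Q \<and> Q \<noteq> {} \<and> Q \<subseteq> span (\<Union>n\<in>s. F n) \<and> span (\<Union>n\<in>s. F n) \<subseteq> closure Q"
    if s: "finite s" for s
  proof -
    have "span (\<Union>n\<in>s. F n) \<subseteq> span (\<Union>n\<in>s. bs n)"
    proof (rule span_minimal)
      show "(\<Union>n\<in>s. F n) \<subseteq> span (\<Union>n\<in>s. bs n)"
      proof
        fix x assume "x \<in> (\<Union>n\<in>s. F n)"
        then obtain n where "n \<in> s" "x \<in> span (bs n)" using bs(3) by auto
        moreover have "span (bs n) \<subseteq> span (\<Union>n\<in>s. bs n)" using \<open>n \<in> s\<close> by (intro span_mono) auto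
        ultimately show "x \<in> span (\<Union>n\<in>s. bs n)" by blast
      qed
    qed simp
    moreover have "span (\<Union>n\<in>s. bs n) \<subseteq> span (\<Union>n\<in>s. F n)" using bs_in_F by (intro span_mono) blast
    ultimately have eq: "span (\<Union>n\<in>s. F n) = span (\<Union>n\<in>s. bs n)" by (rule subset_antisym)
    have "finite (\<Union>n\<in>s. bs n)" using s bs by auto
    from countable_dense_in_span[OF this] show ?thesis unfolding eq by metis
  qed
  have "\<forall>s. \<exists>Q. finite s \<longrightarrow> countable Q \<and> Q \<noteq> {} \<and> Q \<subseteq> span (\<Union>n\<in>s. F n) \<and> span (\<Union>n\<in>s. F n) \<subseteq> closure Q"
  proof
    fix s
    show "\<exists>Q. finite s \<longrightarrow> countable Q \<and> Q \<noteq> {} \<and> Q \<subseteq> span (\<Union>n\<in>s. F n) \<and> span (\<Union>n\<in>s. F n) \<subseteq> closure Q"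
      using ex[of s] by (cases "finite s") simp_all
  qed
  from choice[OF this] obtain Q where Q0: "\<forall>s. finite s \<longrightarrow> countable (Q s) \<and> Q s \<noteq> {} \<and>
      Q s \<subseteq> span (\<Union>n\<in>s. F n) \<and> span (\<Union>n\<in>s. F n) \<subseteq> closure (Q s)"
    by (rule exE)
  have Q: "\<And>s. finite s \<Longrightarrow> countable (Q s)" "\<And>s. finite s \<Longrightarrow> Q s \<noteq> {}"
    "\<And>s. finite s \<Longrightarrow> Q s \<subseteq> span (\<Union>n\<in>s. F n)" "\<And>s. finite s \<Longrightarrow> span (\<Union>n\<in>s. F n) \<subseteq> closure (Q s)"
    using Q0[rule_format] by simp_all
  define supp where "supp i = set (from_nat (fst (prod_decode i)) :: nat list)" for i
  define q where "q i = from_nat_into (Q (supp i)) (snd (prod_decode i))" for i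
  have fin: "finite (supp i)" for i by (simp add: supp_def)
  have surj: "\<exists>i. supp i = s \<and> q i = x" if fs: "finite s" and x: "x \<in> Q s" for s x
  proof -
    obtain l where l: "set l = s" using finite_list[OF fs] by (elim exE)
    obtain k where k: "from_nat_into (Q s) k = x"
      using from_nat_into_surj[OF Q(1)[OF fs] x] by (elim exE)
    have "supp (prod_encode (to_nat l, k)) = s" by (simp add: supp_def l)
    moreover then have "q (prod_encode (to_nat l, k)) = x" by (simp add: q_def k)
    ultimately show ?thesis by blast
  qed
  show thesis
  proof (rule that)
    show "finite (supp i)" for i by (rule fin)
    show "q i \<in> span (\<Union>n\<in>supp i. F n)" for i
      using from_nat_into[OF Q(2)[OF fin]] Q(3)[OF fin] unfolding q_def by blast
    fix A
    have "x \<in> closure (q ` {i. supp i \<subseteq> A})" if "x \<in> span (\<Union>n\<in>A. F n)" for x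
    proof -
      have "\<exists>s. finite s \<and> s \<subseteq> A \<and> x \<in> span (\<Union>n\<in>s. F n)"
        using that
      proof (induction rule: span_induct_alt)
        case base
        show ?case by (intro exI[of _ "{}"]) auto
      next
        case (step c v y)
        then obtain s n where s: "finite s" "s \<subseteq> A" "y \<in> span (\<Union>n\<in>s. F n)" "n \<in> A" "v \<in> F n" by blast
        have "v \<in> span (\<Union>n\<in>insert n s. F n)" using s(5) by (intro span_base) auto
        moreover have "span (\<Union>n\<in>s. F n) \<subseteq> span (\<Union>n\<in>insert n s. F n)" by (intro span_mono) auto
        ultimately have "c *\<^sub>R v + y \<in> span (\<Union>n\<in>insert n s. F n)"
          using s(3) by (intro span_add span_scale) auto
        then show ?case using s by (intro exI[of _ "insert n s"]) auto
      qed
      then obtain s where s: "finite s" "s \<subseteq> A" "x \<in> span (\<Union>n\<in>s. F n)" by blast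
      have "Q s \<subseteq> q ` {i. supp i \<subseteq> A}" using surj[OF s(1)] s(2) by fastforce
      then have "closure (Q s) \<subseteq> closure (q ` {i. supp i \<subseteq> A})" by (rule closure_mono)
      then show ?thesis using Q(4)[OF s(1)] s(3) by blast
    qed
    then show "closed_span F A \<subseteq> closure (q ` {i. supp i \<subseteq> A})"
      unfolding closed_span_def by (intro closure_minimal) auto
  qed
qed

abbreviation span_embeds :: "(nat \<Rightarrow> bool) \<Rightarrow> (nat \<Rightarrow> bool) \<Rightarrow> bool" where
  "span_embeds a b \<equiv> embeds_in (closed_span F (Collect a)) norm (closed_span F (Collect b)) norm"

text \<open>
  From left to right, the values of an embedding at the vectors \<open>q i\<close> are approximated within the
  dense subset of \<open>X\<^sub>B\<close>; conversely they are recovered from a code as limits.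
\<close>

lemma embeds_iff_coded:
  assumes fin: "\<And>i. finite (supp i)" and q_span: "\<And>i. q i \<in> span (\<Union>n\<in>supp i. F n)"
    and dense: "\<And>A. closed_span F A \<subseteq> closure (q ` {i. supp i \<subseteq> A})"
  shows "span_embeds a b \<longleftrightarrow>
           (\<exists>(k::nat) \<sigma>. (a, b, \<sigma>) \<in> coded_embeddings q supp (real k))"
proof -
  have q_in: "q i \<in> closed_span F A" if "supp i \<subseteq> A" for i A
  proof -
    have "span (\<Union>n\<in>supp i. F n) \<subseteq> span (\<Union>n\<in>A. F n)" using that by (intro span_mono) auto
    then show ?thesis using q_span closure_subset unfolding closed_span_def by blast
  qed
  show ?thesis
  proof
    assume "span_embeds a b"
    then obtain U T S where U: "U \<subseteq> closed_span F (Collect b)"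
      and T: "bounded_op (closed_span F (Collect a)) norm U norm T"
      and S: "bounded_op U norm (closed_span F (Collect a)) norm S"
      and ST: "\<And>x. x \<in> closed_span F (Collect a) \<Longrightarrow> S (T x) = x"
      unfolding embeds_in_def isomorphic_on_def by blast
    obtain C1 where C1: "\<And>x. x \<in> closed_span F (Collect a) \<Longrightarrow> norm (T x) \<le> C1 * norm x"
      using T unfolding bounded_op_def by (elim conjE exE) (rule that, erule bspec, assumption)
    obtain C2 where C2: "\<And>y. y \<in> U \<Longrightarrow> norm (S y) \<le> C2 * norm y"
      using S unfolding bounded_op_def by (elim conjE exE) (rule that, erule bspec, assumption)
    obtain k :: nat where k: "max C1 C2 \<le> real k" using real_arch_simple by blast
    have linT: "linear_on (closed_span F (Collect a)) T" using T by (simp add: bounded_op_def)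
    have TU: "T x \<in> U" if "x \<in> closed_span F (Collect a)" for x using T that by (auto simp: bounded_op_def)
    have up: "norm (T x) \<le> real k * norm x" if "x \<in> closed_span F (Collect a)" for x
    proof -
      have "C1 * norm x \<le> real k * norm x" using k by (intro mult_right_mono) auto
      then show ?thesis using C1[OF that] by linarith
    qed
    have low: "norm x \<le> real k * norm (T x)" if "x \<in> closed_span F (Collect a)" for x
    proof -
      have "C2 * norm (T x) \<le> real k * norm (T x)" using k by (intro mult_right_mono) auto
      then show ?thesis using C2[OF TU[OF that]] ST[OF that] by simp
    qed
    have "\<exists>l. supp i \<subseteq> Collect a \<longrightarrow> supp l \<subseteq> Collect b \<and> norm (q l - T (q i)) < (1/2) ^ (Suc j)" for i j
    proof (cases "supp i \<subseteq> Collect a")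
      case True
      then have "T (q i) \<in> closure (q ` {i. supp i \<subseteq> Collect b})"
        using dense[of "Collect b"] U TU q_in by blast
      moreover have "(0::real) < (1/2) ^ Suc j" by simp
      ultimately have "\<exists>v\<in>q ` {i. supp i \<subseteq> Collect b}. dist v (T (q i)) < (1/2) ^ Suc j"
        unfolding closure_approachable by blast
      then obtain l where "supp l \<subseteq> Collect b" "dist (q l) (T (q i)) < (1/2) ^ (Suc j)" by blast
      then show ?thesis by (auto simp: dist_norm)
    qed simp
    then obtain s where s: "\<And>i j. supp i \<subseteq> Collect a \<Longrightarrow> supp (s i j) \<subseteq> Collect b"
      "\<And>i j. supp i \<subseteq> Collect a \<Longrightarrow> norm (q (s i j) - T (q i)) < (1/2) ^ (Suc j)"
      by metis
    define \<sigma> where "\<sigma> m = s (fst (prod_decode m)) (snd (prod_decode m))" for m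
    have \<sigma>: "\<sigma> (prod_encode (i, j)) = s i j" for i j by (simp add: \<sigma>_def)
    have "(a, b, \<sigma>) \<in> coded_embeddings q supp (real k)"
      unfolding coded_embeddings_def mem_Collect_eq prod.case \<sigma>
    proof (intro conjI allI impI; (elim conjE)?)
      show "supp (s i j) \<subseteq> Collect b" if "supp i \<subseteq> Collect a" for i j using s(1) that by blast
      show "norm (q (s i (Suc j)) - q (s i j)) \<le> (1/2) ^ j" if "supp i \<subseteq> Collect a" for i j
      proof -
        have "norm (q (s i (Suc j)) - q (s i j)) \<le> norm (q (s i (Suc j)) - T (q i)) + norm (q (s i j) - T (q i))"
          using norm_triangle_ineq4[of "q (s i (Suc j)) - T (q i)" "q (s i j) - T (q i)"] by simp
        also have "\<dots> \<le> (1/2) ^ Suc (Suc j) + (1/2) ^ Suc j"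
          using s(2)[OF that, of "Suc j"] s(2)[OF that, of j] by linarith
        also have "\<dots> \<le> (1/2) ^ j" by simp
        finally show ?thesis .
      qed
      fix I :: "nat set" and c :: "nat \<Rightarrow> real" and j
      assume I: "finite I" "\<forall>i\<in>I. supp i \<subseteq> Collect a"
      let ?x = "\<Sum>i\<in>I. c i *\<^sub>R q i" and ?y = "\<Sum>i\<in>I. c i *\<^sub>R q (s i j)"
      have qI: "q i \<in> closed_span F (Collect a)" if "i \<in> I" for i using q_in I(2) that by blast
      have x: "?x \<in> closed_span F (Collect a)"
        using qI by (intro subspace_sum[OF subspace_closed_span] subspace_scale[OF subspace_closed_span])
      have "?y - T ?x = (\<Sum>i\<in>I. c i *\<^sub>R (q (s i j) - T (q i)))"
        using linear_on_sum[OF linT subspace_closed_span I(1) qI]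
        by (simp add: scaleR_right_diff_distrib sum_subtractf)
      also have "norm \<dots> \<le> (\<Sum>i\<in>I. \<bar>c i\<bar> * (1/2) ^ j)"
      proof (rule sum_norm_le)
        fix i assume "i \<in> I"
        then have "norm (q (s i j) - T (q i)) \<le> (1/2) ^ Suc j" using s(2) I(2) by (simp add: less_imp_le)
        also have "\<dots> \<le> (1/2) ^ j" by simp
        finally show "norm (c i *\<^sub>R (q (s i j) - T (q i))) \<le> \<bar>c i\<bar> * (1/2) ^ j"
          by (simp add: mult_left_mono)
      qed
      finally have err: "norm (?y - T ?x) \<le> (\<Sum>i\<in>I. \<bar>c i\<bar>) * (1/2) ^ j" by (simp add: sum_distrib_right)
      show "norm ?y \<le> real k * norm ?x + (\<Sum>i\<in>I. \<bar>c i\<bar>) * (1/2) ^ j"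
        using err up[OF x] norm_triangle_sub[of ?y "T ?x"] by linarith
      have "norm (T ?x) \<le> norm ?y + (\<Sum>i\<in>I. \<bar>c i\<bar>) * (1/2) ^ j"
        using err norm_triangle_sub[of "T ?x" ?y] by (simp add: norm_minus_commute)
      then have "real k * norm (T ?x) \<le> real k * (norm ?y + (\<Sum>i\<in>I. \<bar>c i\<bar>) * (1/2) ^ j)"
        by (intro mult_left_mono) auto
      then show "norm ?x \<le> real k * (norm ?y + (\<Sum>i\<in>I. \<bar>c i\<bar>) * (1/2) ^ j)"
        using low[OF x] by linarith
    qed
    then show "\<exists>(k::nat) \<sigma>. (a, b, \<sigma>) \<in> coded_embeddings q supp (real k)" by blast
  next
    assume "\<exists>(k::nat) \<sigma>. (a, b, \<sigma>) \<in> coded_embeddings q supp (real k)"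
    then obtain K \<sigma> where "(a, b, \<sigma>) \<in> coded_embeddings q supp K" by blast
    note W = this[unfolded coded_embeddings_def mem_Collect_eq prod.case]
    define s where "s i j = \<sigma> (prod_encode (i, j))" for i j
    have W1: "supp (s i j) \<subseteq> Collect b" if "supp i \<subseteq> Collect a" for i j
      using W[THEN conjunct1, rule_format, OF that] unfolding s_def .
    have W2: "norm (q (s i (Suc j)) - q (s i j)) \<le> (1/2) ^ j" if "supp i \<subseteq> Collect a" for i j
      using W[THEN conjunct2, THEN conjunct1, rule_format, OF that] unfolding s_def .
    have W3: "norm (\<Sum>i\<in>I. c i *\<^sub>R q (s i j)) \<le> K * norm (\<Sum>i\<in>I. c i *\<^sub>R q i) + (\<Sum>i\<in>I. \<bar>c i\<bar>) * (1/2) ^ j"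
        "norm (\<Sum>i\<in>I. c i *\<^sub>R q i) \<le> K * (norm (\<Sum>i\<in>I. c i *\<^sub>R q (s i j)) + (\<Sum>i\<in>I. \<bar>c i\<bar>) * (1/2) ^ j)"
      if "finite I" "I \<subseteq> {i. supp i \<subseteq> Collect a}" for I c j
    proof -
      have "finite I \<and> (\<forall>i\<in>I. supp i \<subseteq> Collect a)" using that by auto
      note * = W[THEN conjunct2, THEN conjunct2, rule_format, OF this, of c j]
      show "norm (\<Sum>i\<in>I. c i *\<^sub>R q (s i j)) \<le> K * norm (\<Sum>i\<in>I. c i *\<^sub>R q i) + (\<Sum>i\<in>I. \<bar>c i\<bar>) * (1/2) ^ j"
        using * unfolding s_def by (rule conjunct1)
      show "norm (\<Sum>i\<in>I. c i *\<^sub>R q i) \<le> K * (norm (\<Sum>i\<in>I. c i *\<^sub>R q (s i j)) + (\<Sum>i\<in>I. \<bar>c i\<bar>) * (1/2) ^ j)"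
        using * unfolding s_def by (rule conjunct2)
    qed
    have "\<exists>y. (\<lambda>j. q (s i j)) \<longlonglongrightarrow> y" if "supp i \<subseteq> Collect a" for i
    proof -
      have "summable (\<lambda>j. q (s i (Suc j)) - q (s i j))"
        by (rule summable_comparison_test'[of "\<lambda>j. (1/2::real) ^ j" 0]) (use W2[OF that] in auto)
      then obtain l where "(\<lambda>n. \<Sum>j<n. q (s i (Suc j)) - q (s i j)) \<longlonglongrightarrow> l"
        using summable_LIMSEQ by blast
      then have "(\<lambda>n. (\<Sum>j<n. q (s i (Suc j)) - q (s i j)) + q (s i 0)) \<longlonglongrightarrow> l + q (s i 0)"
        by (intro tendsto_intros)
      moreover have "(\<Sum>j<n. q (s i (Suc j)) - q (s i j)) + q (s i 0) = q (s i n)" for n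
        by (subst sum_lessThan_telescope) simp
      ultimately have "(\<lambda>n. q (s i n)) \<longlonglongrightarrow> l + q (s i 0)" by simp
      then show ?thesis by blast
    qed
    then obtain y where y: "\<And>i. supp i \<subseteq> Collect a \<Longrightarrow> (\<lambda>j. q (s i j)) \<longlonglongrightarrow> y i" by metis
    have half: "(\<lambda>j. (1/2::real) ^ j) \<longlonglongrightarrow> 0" by (intro LIMSEQ_power_zero) simp
    have "embeds_in (closure (span (q ` {i. supp i \<subseteq> Collect a}))) norm (closed_span F (Collect b)) norm"
    proof (rule embedding_from_equivalent_families[where K = K and y = y])
      fix I :: "nat set" and c :: "nat \<Rightarrow> real" assume I: "finite I" "I \<subseteq> {i. supp i \<subseteq> Collect a}"
      have lim: "(\<lambda>j. \<Sum>i\<in>I. c i *\<^sub>R q (s i j)) \<longlonglongrightarrow> (\<Sum>i\<in>I. c i *\<^sub>R y i)"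
        using I y by (intro tendsto_sum tendsto_scaleR tendsto_const) auto
      have "(\<lambda>j. K * norm (\<Sum>i\<in>I. c i *\<^sub>R q i) + (\<Sum>i\<in>I. \<bar>c i\<bar>) * (1/2) ^ j)
              \<longlonglongrightarrow> K * norm (\<Sum>i\<in>I. c i *\<^sub>R q i) + (\<Sum>i\<in>I. \<bar>c i\<bar>) * 0"
        by (intro tendsto_intros half)
      then show "norm (\<Sum>i\<in>I. c i *\<^sub>R y i) \<le> K * norm (\<Sum>i\<in>I. c i *\<^sub>R q i)"
        using W3(1)[OF I] by (intro LIMSEQ_le[OF tendsto_norm[OF lim]]) auto
      have "(\<lambda>j. K * (norm (\<Sum>i\<in>I. c i *\<^sub>R q (s i j)) + (\<Sum>i\<in>I. \<bar>c i\<bar>) * (1/2) ^ j))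
              \<longlonglongrightarrow> K * (norm (\<Sum>i\<in>I. c i *\<^sub>R y i) + (\<Sum>i\<in>I. \<bar>c i\<bar>) * 0)"
        by (intro tendsto_intros half lim)
      then show "norm (\<Sum>i\<in>I. c i *\<^sub>R q i) \<le> K * norm (\<Sum>i\<in>I. c i *\<^sub>R y i)"
        using W3(2)[OF I] by (intro LIMSEQ_le_const) auto
    next
      show "y ` {i. supp i \<subseteq> Collect a} \<subseteq> closed_span F (Collect b)"
      proof clarify
        fix i assume i: "supp i \<subseteq> Collect a"
        show "y i \<in> closed_span F (Collect b)"
          by (rule closed_sequentially[OF closed_closed_span _ y[OF i]]) (rule q_in[OF W1[OF i]])
      qed
    qed (rule subspace_closed_span closed_closed_span)+
    moreover have "closure (span (q ` {i. supp i \<subseteq> Collect a})) = closed_span F (Collect a)"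
    proof
      show "closure (span (q ` {i. supp i \<subseteq> Collect a})) \<subseteq> closed_span F (Collect a)"
        using q_in by (intro closure_span_subset subspace_closed_span closed_closed_span) auto
      show "closed_span F (Collect a) \<subseteq> closure (span (q ` {i. supp i \<subseteq> Collect a}))"
        using dense[of "Collect a"] closure_mono[OF span_superset] by (rule subset_trans)
    qed
    ultimately show "span_embeds a b" by simp
  qed
qed

lemma embedding_relation_meager_by_sections:
  assumes "meager {a. \<not> meager {b. span_embeds a b}}"
  shows "meager {(a, b). span_embeds a b}"
proof (rule dense_finitely_supported)
  fix q :: "nat \<Rightarrow> 'u" and supp :: "nat \<Rightarrow> nat set"
  assume q: "\<And>i. finite (supp i)" "\<And>i. q i \<in> span (\<Union>n\<in>supp i. F n)"
    "\<And>A. closed_span F A \<subseteq> closure (q ` {i. supp i \<subseteq> A})"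
  note iff = embeds_iff_coded[OF q]
  have "meager {(a, b). \<exists>\<sigma>. (a, b, \<sigma>) \<in> coded_embeddings q supp (real k)}" for k :: nat
  proof (rule Suslin_meager_by_sections)
    show "(a, b, \<sigma>) \<in> coded_embeddings q supp (real k)"
      if "\<And>n. \<exists>a' b' \<sigma>'. agree n a a' \<and> agree n b b' \<and> agree n \<sigma> \<sigma>' \<and>
            (a', b', \<sigma>') \<in> coded_embeddings q supp (real k)" for a b \<sigma>
      using q(1) that by (rule coded_embeddings_closed)
    show "meager {a. \<not> meager {b. \<exists>\<sigma>. (a, b, \<sigma>) \<in> coded_embeddings q supp (real k)}}"
    proof (rule meager_subset[OF assms], rule Collect_mono, rule impI, erule contrapos_nn)
      fix a assume "meager {b. span_embeds a b}"
      then show "meager {b. \<exists>\<sigma>. (a, b, \<sigma>) \<in> coded_embeddings q supp (real k)}"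
        by (rule meager_subset) (use iff in blast)
    qed
  qed
  then have "meager (\<Union>k. {(a, b). \<exists>\<sigma>. (a, b, \<sigma>) \<in> coded_embeddings q supp (real k)})"
    by (rule meager_UN)
  then show ?thesis by (rule meager_subset) (use iff in blast)
qed

end

section \<open>The embedding relation is meager\<close>

text \<open>
  Finite unions of closed nowhere dense sets are closed and nowhere dense.
\<close>

lemma meager_increasing:
  assumes "meager S"
  obtains N :: "nat \<Rightarrow> 'a::topological_space set" where
    "\<And>n. closed (N n)" "\<And>n. interior (N n) = {}" "\<And>m n. m \<le> n \<Longrightarrow> N m \<subseteq> N n" "S \<subseteq> (\<Union>n. N n)"
proof -
  obtain \<G> where G: "countable \<G>" "\<And>T. T \<in> \<G> \<Longrightarrow> closed T \<and> interior T = {}" "S \<subseteq> \<Union>\<G>"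
    using assms unfolding meager_def by blast
  define h where "h = from_nat_into (insert {} \<G>)"
  have range_h: "range h = insert {} \<G>" unfolding h_def using G(1) by (intro range_from_nat_into) auto
  have h: "closed (h n)" "interior (h n) = {}" for n
  proof -
    have "h n \<in> insert {} \<G>" using range_h by blast
    then show "closed (h n)" "interior (h n) = {}" using G(2) by auto
  qed
  define N where "N n = (\<Union>i\<le>n. h i)" for n
  have int: "interior (N n) = {}" for n
  proof (induction n)
    case 0
    then show ?case using h by (simp add: N_def)
  next
    case (Suc n)
    have "N (Suc n) = h (Suc n) \<union> N n" by (auto simp: N_def atMost_Suc)
    then show ?case using interior_closed_Un_empty_interior[OF h(1) Suc] h(2) by simp
  qed
  show thesis
  proof (rule that[of N])
    show "closed (N n)" for n unfolding N_def using h by (intro closed_UN) auto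
    show "interior (N n) = {}" for n by (rule int)
    show "N m \<subseteq> N n" if "m \<le> n" for m n using that by (fastforce simp: N_def)
    show "S \<subseteq> (\<Union>n. N n)"
    proof
      fix x assume "x \<in> S"
      then obtain T where "T \<in> \<G>" "x \<in> T" using G(3) by blast
      then obtain n where "x \<in> h n" using range_h by (metis imageE insertCI)
      then show "x \<in> (\<Union>n. N n)" by (auto simp: N_def)
    qed
  qed
qed

text \<open>
  The set can be avoided whatever the values below \<open>p\<close> are, since there are finitely many
  possibilities for these values; they are dealt with one after another, lengthening the pattern
  each time.
\<close>

lemma avoid_nowhere_dense:
  fixes N :: "((nat \<Rightarrow> bool) \<times> (nat \<Rightarrow> bool)) set"
  assumes N: "closed N" "interior N = {}"
  obtains q s t where "p \<le> q" "\<And>a b. (\<forall>i\<in>{p..<q}. a i = s i \<and> b i = t i) \<Longrightarrow> (a, b) \<notin> N"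
proof -
  have "\<exists>q s t. p \<le> q \<and> (\<forall>a b. (Collect a \<inter> {..<p}, Collect b \<inter> {..<p}) \<in> \<Psi> \<and>
          (\<forall>i\<in>{p..<q}. a i = s i \<and> b i = t i) \<longrightarrow> (a, b) \<notin> N)" if "finite \<Psi>" for \<Psi>
    using that
  proof (induction \<Psi> rule: finite_induct)
    case empty
    then show ?case by (intro exI[of _ p]) auto
  next
    case (insert \<pi> \<Psi>)
    then obtain q s t where q0: "p \<le> q \<and> (\<forall>a b. (Collect a \<inter> {..<p}, Collect b \<inter> {..<p}) \<in> \<Psi> \<and>
          (\<forall>i\<in>{p..<q}. a i = s i \<and> b i = t i) \<longrightarrow> (a, b) \<notin> N)" by (elim exE)
    have q: "p \<le> q" using q0 by (rule conjunct1)
    note avoid = q0[THEN conjunct2, rule_format]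
    define a0 where "a0 i = (if i < p then i \<in> fst \<pi> else s i)" for i
    define b0 where "b0 i = (if i < p then i \<in> snd \<pi> else t i)" for i
    let ?U = "{a. agree q a0 a} \<times> {b. agree q b0 b}"
    have "\<not> ?U \<subseteq> N"
    proof
      assume "?U \<subseteq> N"
      then have "?U \<subseteq> interior N" by (intro interior_maximal open_Times open_agree)
      moreover have "(a0, b0) \<in> ?U" by simp
      ultimately show False using N(2) by blast
    qed
    then obtain a1 b1 where ab1: "agree q a0 a1" "agree q b0 b1" "(a1, b1) \<in> - N" by blast
    have "open (- N)" using N(1) by auto
    then obtain r where r: "\<And>a b. agree r a1 a \<Longrightarrow> agree r b1 b \<Longrightarrow> (a, b) \<in> - N"
      using ab1(3) unfolding open_cantor2_iff by blast
    show ?case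
    proof (rule exI[of _ "max q r"], rule exI[of _ a1], rule exI[of _ b1], intro conjI allI impI)
      show "p \<le> max q r" using q by simp
      fix a b
      assume *: "(Collect a \<inter> {..<p}, Collect b \<inter> {..<p}) \<in> insert \<pi> \<Psi> \<and>
          (\<forall>i\<in>{p..<max q r}. a i = a1 i \<and> b i = b1 i)"
      have s1: "a1 i = s i" "b1 i = t i" if "p \<le> i" "i < q" for i
        using ab1 that by (auto simp: agree_def a0_def b0_def)
      show "(a, b) \<notin> N"
      proof (cases "(Collect a \<inter> {..<p}, Collect b \<inter> {..<p}) \<in> \<Psi>")
        case True
        then show ?thesis using * s1 by (intro avoid) auto
      next
        case False
        then have pi: "Collect a \<inter> {..<p} = fst \<pi>" "Collect b \<inter> {..<p} = snd \<pi>" using * by auto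
        have "a i = a1 i \<and> b i = b1 i" if "i < r" for i
        proof (cases "i < p")
          case True
          then have "a1 i = (i \<in> fst \<pi>)" "b1 i = (i \<in> snd \<pi>)"
            using ab1 q by (auto simp: agree_def a0_def b0_def)
          then show ?thesis using True pi by blast
        next
          case False
          then show ?thesis using * that by auto
        qed
        then have "(a, b) \<in> - N" by (intro r) (auto simp: agree_def)
        then show ?thesis by simp
      qed
    qed
  qed
  from this[of "Pow {..<p} \<times> Pow {..<p}"] obtain q s t where
    q0: "p \<le> q \<and> (\<forall>a b. (Collect a \<inter> {..<p}, Collect b \<inter> {..<p}) \<in> Pow {..<p} \<times> Pow {..<p} \<and>
          (\<forall>i\<in>{p..<q}. a i = s i \<and> b i = t i) \<longrightarrow> (a, b) \<notin> N)" by auto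
  show thesis
  proof (rule that[of q s t])
    show "p \<le> q" using q0 by (rule conjunct1)
    show "(a, b) \<notin> N" if "\<forall>i\<in>{p..<q}. a i = s i \<and> b i = t i" for a b
      by (rule q0[THEN conjunct2, rule_format]) (use that in auto)
  qed
qed

lemma span_UN_finite_stage:
  assumes "x \<in> span (\<Union>j. A j)"
  shows "\<exists>p::nat. x \<in> span (\<Union>j<p. A j)"
  using assms
proof (induction rule: span_induct_alt)
  case base
  show ?case by (auto intro: span_zero)
next
  case (step c v y)
  then obtain p j where p: "y \<in> span (\<Union>j<p. A j)" "v \<in> A j" by blast
  have "v \<in> span (\<Union>i<max p (Suc j). A i)" using p(2) by (intro span_base) auto
  moreover have "span (\<Union>j<p. A j) \<subseteq> span (\<Union>i<max p (Suc j). A i)"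
    by (intro span_mono UN_mono) auto
  ultimately show ?case using p(1) by (intro exI[of _ "max p (Suc j)"] span_add span_scale) auto
qed

lemma isomorphic_on_sym: "isomorphic_on V N W M \<Longrightarrow> isomorphic_on W M V N"
  unfolding isomorphic_on_def by blast

lemma embeds_in_of_isomorphic:
  fixes V V0 :: "'a::real_normed_vector set" and W :: "'b::real_normed_vector set"
  assumes iso: "isomorphic_on V N W M" and V: "subspace V" "subspace V0" "V0 \<subseteq> V" and W: "W \<subseteq> Z"
  shows "embeds_in V0 N Z M"
proof -
  obtain T S where T: "bounded_op V N W M T" and S: "bounded_op W M V N S"
    and ST: "\<And>x. x \<in> V \<Longrightarrow> S (T x) = x" and TS: "\<And>y. y \<in> W \<Longrightarrow> T (S y) = y"
    using iso unfolding isomorphic_on_def by blast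
  have TV: "T ` V0 \<subseteq> W" using T V(3) unfolding bounded_op_def by blast
  have lin: "linear_on V0 T" using T V(3) unfolding bounded_op_def linear_on_def by blast
  have "subspace (T ` V0)"
  proof (rule subspaceI)
    have "T 0 = 0" using linear_on_sum[OF lin V(2), of "{}" "\<lambda>_. 0"] by simp
    then show "0 \<in> T ` V0" using subspace_0[OF V(2)] by (metis imageI)
    show "x + y \<in> T ` V0" if xy: "x \<in> T ` V0" "y \<in> T ` V0" for x y
    proof -
      obtain u v where uv: "u \<in> V0" "v \<in> V0" "x = T u" "y = T v" using xy by blast
      then have "x + y = T (u + v)" using lin by (simp add: linear_on_def)
      then show ?thesis using uv V(2) by (simp add: subspace_add)
    qed
    show "c *\<^sub>R x \<in> T ` V0" if x: "x \<in> T ` V0" for c x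
    proof -
      obtain u where u: "u \<in> V0" "x = T u" using x by blast
      then have "c *\<^sub>R x = T (c *\<^sub>R u)" using lin by (simp add: linear_on_def)
      then show ?thesis using u V(2) by (simp add: subspace_scale)
    qed
  qed
  moreover have "bounded_op V0 N (T ` V0) M T"
    using T V(3) lin unfolding bounded_op_def by blast
  moreover have "bounded_op (T ` V0) M V0 N S"
    unfolding bounded_op_def
  proof (intro conjI)
    show "linear_on (T ` V0) S" using S TV unfolding bounded_op_def linear_on_def by blast
    show "S ` T ` V0 \<subseteq> V0" using ST V(3) by auto
    show "\<exists>C. \<forall>x\<in>T ` V0. N (S x) \<le> C * M x" using S TV unfolding bounded_op_def by blast
  qed
  moreover have "T ` V0 \<subseteq> Z" using TV W by blast
  ultimately show ?thesis unfolding embeds_in_def isomorphic_on_def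
    using ST V(3) by (intro exI[of _ "T ` V0"] conjI exI[of _ T] exI[of _ S]) auto
qed

lemma embeds_in_mono: "embeds_in V N W M \<Longrightarrow> W \<subseteq> W' \<Longrightarrow> embeds_in V N W' M"
  unfolding embeds_in_def by (meson subset_trans)

context fdd begin

lemma closed_span_UNIV: "closed_span F UNIV = X"
proof
  show "X \<subseteq> closed_span F UNIV"
  proof
    fix x assume x: "x \<in> X"
    have "P n x \<in> closed_span F UNIV" for n unfolding P_def
      using F_closed_span[of _ UNIV] coord_props(1)[OF x]
      by (intro subspace_sum subspace_closed_span) blast
    then show "x \<in> closed_span F UNIV"
      using closed_sequentially[OF closed_closed_span _ P_tendsto[OF x]] by blast
  qed
qed (rule closed_span_subset_X)

lemma separable_X: "\<exists>D. countable D \<and> D \<subseteq> X \<and> X \<subseteq> closure D"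
proof (rule dense_finitely_supported)
  fix q :: "nat \<Rightarrow> 'u" and supp :: "nat \<Rightarrow> nat set"
  assume q: "\<And>i. finite (supp i)" "\<And>i. q i \<in> span (\<Union>n\<in>supp i. F n)"
    "\<And>A. closed_span F A \<subseteq> closure (q ` {i. supp i \<subseteq> A})"
  have "span (\<Union>n\<in>supp i. F n) \<subseteq> X" for i using F_in_X by (intro span_minimal subspace_X) auto
  then have "range q \<subseteq> X" using q(2) by blast
  moreover have "X \<subseteq> closure (range q)" using q(3)[of UNIV] closed_span_UNIV by simp
  ultimately show ?thesis by (intro exI[of _ "range q"]) auto
qed

text \<open>
  A space \<open>X\<^sub>A\<close> that is not large misses, for some value, all the intervals provided by
  \<open>large_on_blocks\<close>; every finite initial segment can be continued so as to contain one.
\<close>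

lemma nonlarge_meager:
  fixes d :: "'u set \<Rightarrow> ('u \<Rightarrow> real) \<Rightarrow> 'u set \<Rightarrow> real"
  assumes deg: "is_degree d" and large: "d_large d X norm"
  shows "meager {a. \<not> d_large d (closed_span F (Collect a)) norm}"
proof -
  have "\<exists>m. \<forall>n M A. {n..<m n M} \<subseteq> A \<longrightarrow>
           (\<exists>G. fd_subspace G (closed_span F A) \<and> real M < d (closed_span F A) norm G)"
    by (intro choice allI large_on_blocks[OF deg large])
  then obtain m :: "nat \<Rightarrow> nat \<Rightarrow> nat" where m0: "\<forall>n M A. {n..<m n M} \<subseteq> A \<longrightarrow>
           (\<exists>G. fd_subspace G (closed_span F A) \<and> real M < d (closed_span F A) norm G)"
    by (rule exE)
  note m = m0[rule_format]
  define S where "S M = {a. \<forall>n. \<not> {n..<m n M} \<subseteq> Collect a}" for M :: nat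
  have "meager (S M)" for M
  proof (rule meager_closed)
    have "open (- S M)" unfolding open_cantor_iff
    proof
      fix a assume "a \<in> - S M"
      then obtain n where n: "{n..<m n M} \<subseteq> Collect a" by (auto simp: S_def)
      then have "b \<in> - S M" if "agree (m n M) a b" for b
        using that unfolding S_def agree_def by fastforce
      then show "\<exists>n. \<forall>b. agree n a b \<longrightarrow> b \<in> - S M" by blast
    qed
    then show "closed (S M)" by (simp add: closed_def)
    show "interior (S M) = {}"
    proof (rule ccontr)
      assume "interior (S M) \<noteq> {}"
      then obtain a where "a \<in> interior (S M)" by blast
      then obtain k where k: "\<And>b. agree k a b \<Longrightarrow> b \<in> interior (S M)"
        using open_interior[of "S M"] unfolding open_cantor_iff by blast
      define b where "b i = (if i < k then a i else True)" for i
      have "b \<in> interior (S M)" by (rule k) (simp add: agree_def b_def)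
      then have "b \<in> S M" using interior_subset by blast
      moreover have "{k..<m k M} \<subseteq> Collect b" by (auto simp: b_def)
      ultimately show False by (auto simp: S_def)
    qed
  qed
  then have mS: "meager (\<Union>M. S M)" by (rule meager_UN)
  show ?thesis
  proof (rule meager_subset[OF mS], intro subsetI, rule ccontr)
    fix a assume a: "a \<in> {a. \<not> d_large d (closed_span F (Collect a)) norm}" "a \<notin> (\<Union>M. S M)"
    then have "bdd_above {d (closed_span F (Collect a)) norm G |G. fd_subspace G (closed_span F (Collect a))}"
      by (simp add: d_large_def d_small_def)
    then obtain c where c: "\<And>G. fd_subspace G (closed_span F (Collect a)) \<Longrightarrow>
        d (closed_span F (Collect a)) norm G \<le> c"
      unfolding bdd_above_def by blast
    obtain M :: nat where M: "c \<le> real M" using real_arch_simple by blast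
    obtain n where "{n..<m n M} \<subseteq> Collect a" using a(2) by (auto simp: S_def)
    then obtain G where "fd_subspace G (closed_span F (Collect a))"
      "real M < d (closed_span F (Collect a)) norm G" using m by blast
    then show False using c[of G] M by linarith
  qed
qed

text \<open>
  If \<open>Z\<close> embeds into \<open>X\<^sub>B\<close>, then \<open>B\<close> is disjoint from finitely many of the tightness intervals only.
\<close>

lemma tight_sections_meager:
  assumes "tight_in Z N F"
  shows "meager {b. embeds_in Z N (closed_span F (Collect b)) norm}"
proof -
  from assms[unfolded tight_in_def] obtain I :: "nat \<Rightarrow> nat set" where I0:
    "(\<forall>k. \<exists>a b. a \<le> b \<and> I k = {a..b}) \<and>
     (\<forall>j k. j < k \<longrightarrow> (\<forall>m\<in>I j. \<forall>n\<in>I k. m < n)) \<and>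
     (\<forall>A. infinite A \<longrightarrow> \<not> embeds_in Z N (closed_span F (- (\<Union>i\<in>A. I i))) norm)"
    by (rule exE)
  note I1 = I0[THEN conjunct1, rule_format]
  note I2 = I0[THEN conjunct2, THEN conjunct1, rule_format]
  note I3 = I0[THEN conjunct2, THEN conjunct2, rule_format]
  have fin: "finite (I k)" and ne: "I k \<noteq> {}" for k using I1[of k] by auto
  have ge: "k \<le> x" if "x \<in> I k" for k x
    using that
  proof (induction k arbitrary: x)
    case (Suc k)
    obtain y where "y \<in> I k" using ne by blast
    then show ?case using Suc.IH[of y] I2[of k "Suc k" y x] Suc.prems by simp
  qed simp
  define S where "S n = {b. \<forall>k\<ge>n. I k \<inter> Collect b \<noteq> {}}" for n
  have "meager (S n)" for n
  proof (rule meager_closed)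
    have "open (- S n)" unfolding open_cantor_iff
    proof
      fix b assume "b \<in> - S n"
      then obtain k where k: "k \<ge> n" "I k \<inter> Collect b = {}" by (auto simp: S_def)
      obtain r where r: "I k \<subseteq> {..<r}" using fin[of k] finite_nat_iff_bounded by blast
      have "c \<in> - S n" if "agree r b c" for c
      proof -
        have "I k \<inter> Collect c = {}" using k(2) r that by (auto simp: agree_def)
        then show ?thesis using k(1) by (auto simp: S_def)
      qed
      then show "\<exists>r. \<forall>c. agree r b c \<longrightarrow> c \<in> - S n" by blast
    qed
    then show "closed (S n)" by (simp add: closed_def)
    show "interior (S n) = {}"
    proof (rule ccontr)
      assume "interior (S n) \<noteq> {}"
      then obtain a where "a \<in> interior (S n)" by blast
      then obtain r where r: "\<And>b. agree r a b \<Longrightarrow> b \<in> interior (S n)"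
        using open_interior[of "S n"] unfolding open_cantor_iff by blast
      define b where "b i = (if i < r then a i else False)" for i
      have "b \<in> interior (S n)" by (rule r) (simp add: agree_def b_def)
      then have "b \<in> S n" using interior_subset by blast
      moreover have "I (max n r) \<inter> Collect b = {}" 
      proof -
        have "\<not> x < r" if "x \<in> I (max n r)" for x using ge[OF that] by simp
        then show ?thesis by (auto simp: b_def)
      qed
      ultimately show False by (auto simp: S_def)
    qed
  qed
  then have mS: "meager (\<Union>n. S n)" by (rule meager_UN)
  show ?thesis
  proof (rule meager_subset[OF mS], intro subsetI, rule ccontr)
    fix b assume b: "b \<in> {b. embeds_in Z N (closed_span F (Collect b)) norm}" "b \<notin> (\<Union>n. S n)"
    define A where "A = {k. I k \<inter> Collect b = {}}"
    have "\<exists>k\<ge>n. k \<in> A" for n using b(2) by (auto simp: S_def A_def)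
    then have "infinite A" unfolding infinite_nat_iff_unbounded_le by blast
    moreover have "closed_span F (Collect b) \<subseteq> closed_span F (- (\<Union>i\<in>A. I i))"
      by (rule closed_span_mono) (auto simp: A_def)
    ultimately show False using I3 embeds_in_mono b(1) by blast
  qed
qed

lemma embedding_relation_meager:
  fixes d :: "'u set \<Rightarrow> ('u \<Rightarrow> real) \<Rightarrow> 'u set \<Rightarrow> real"
  assumes deg: "is_degree d" and large: "d_large d X norm"
    and tight: "\<And>Z N. banach_on Z N \<Longrightarrow> \<not> finite_dim Z \<Longrightarrow> d_large d Z N \<Longrightarrow> tight_in Z N F"
  shows "meager {(a, b). span_embeds a b}"
proof (rule embedding_relation_meager_by_sections, rule meager_subset[OF nonlarge_meager[OF deg large]],
    rule Collect_mono, rule impI, erule contrapos_nn)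
  fix a assume a: "d_large d (closed_span F (Collect a)) norm"
  have b: "banach_on (closed_span F (Collect a)) norm"
    by (rule banach_on_norm[OF subspace_closed_span closed_closed_span])
  moreover have "\<not> finite_dim (closed_span F (Collect a))"
    using finite_dim_imp_small[OF deg b] a by (auto simp: d_large_def)
  ultimately show "meager {b. span_embeds a b}"
    using a by (intro tight_sections_meager tight)
qed

end

section \<open>Reducing eventual equality to isomorphism\<close>

context fdd begin

definition block_span :: "(nat \<Rightarrow> 'u set) \<Rightarrow> 'u set" where
  "block_span A = closure (span (\<Union>j. A j))"

lemma subspace_block_span: "subspace (block_span A)"
  unfolding block_span_def by (rule subspace_closure_span)

lemma closed_block_span: "closed (block_span A)"
  by (simp add: block_span_def)

lemma block_span_subset_X: "(\<And>j. A j \<subseteq> bs j) \<Longrightarrow> block_span A \<subseteq> X"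
  unfolding block_span_def using bs_in_X by (intro closure_span_subset subspace_X closed_X) blast

lemma block_span_superset: "b \<in> A j \<Longrightarrow> b \<in> block_span A"
proof -
  assume "b \<in> A j"
  then have "b \<in> span (\<Union>j. A j)" by (intro span_base) auto
  then show ?thesis unfolding block_span_def by (rule subsetD[OF closure_subset])
qed

lemma P_bs: "b \<in> bs j \<Longrightarrow> P p b = (if j < p then b else 0)"
proof -
  assume b: "b \<in> bs j"
  have "P p b = (\<Sum>i<p. if i = j then b else 0)"
    unfolding P_def using coord_F[OF bs_in_F[OF b]] by simp
  then show ?thesis by simp
qed

lemma bounded_preimage_closed_span:
  assumes lin: "linear_on X L" and bd: "\<And>x. x \<in> X \<Longrightarrow> norm (L x) \<le> C * norm x"
    and Y: "subspace Y" "closed Y" and S: "\<And>s. s \<in> S \<Longrightarrow> s \<in> X \<and> L s \<in> Y"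
    and x: "x \<in> closure (span S)"
  shows "L x \<in> Y"
proof -
  have "closed {x \<in> X. L x \<in> Y}"
    by (rule closed_preimage_of_bounded[OF closed_X subspace_X lin bd Y(2)])
  moreover have "subspace {x \<in> X. L x \<in> Y}"
  proof (rule subspaceI)
    have "L 0 = 0" using linear_on_sum[OF lin subspace_X, of "{}" "\<lambda>_. 0"] by simp
    then show "0 \<in> {x \<in> X. L x \<in> Y}" using subspace_0[OF subspace_X] subspace_0[OF Y(1)] by simp
  qed (use lin Y(1) subspace_X in \<open>auto simp: linear_on_def subspace_add subspace_scale\<close>)
  ultimately have "closure (span S) \<subseteq> {x \<in> X. L x \<in> Y}"
    using S by (intro closure_span_subset) auto
  then show ?thesis using x by auto
qed

lemma P_block_span:
  assumes "\<And>j. A j \<subseteq> bs j" "x \<in> block_span A"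
  shows "P p x \<in> span (\<Union>j<p. A j)"
proof -
  obtain C where C: "\<And>x n. x \<in> X \<Longrightarrow> norm (P n x) \<le> C * norm x" using P_bounded by metis
  show ?thesis
  proof (rule bounded_preimage_closed_span[OF linear_on_P C subspace_span _ _ assms(2)[unfolded block_span_def]])
    have "finite (\<Union>j<p. A j)" using bs(1) assms(1) finite_subset by blast
    then show "closed (span (\<Union>j<p. A j))" by (rule closed_span_finite)
    fix s assume "s \<in> (\<Union>j. A j)"
    then obtain j where j: "s \<in> A j" "s \<in> bs j" using assms(1) by blast
    then show "s \<in> X \<and> P p s \<in> span (\<Union>j<p. A j)"
      using bs_in_X[OF j(2)] P_bs[OF j(2), of p] by (auto intro: span_base span_zero)
  qed
qed

lemma linear_on_tail: "linear_on X (\<lambda>x. x - P p x)"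
  by (simp add: linear_on_def P_add P_scale scaleR_right_diff_distrib)

lemma tail_bounded:
  obtains C where "C \<ge> 0" "\<And>x n. x \<in> X \<Longrightarrow> norm (x - P n x) \<le> C * norm x"
proof -
  obtain C where C: "C \<ge> 1" "\<And>x n. x \<in> X \<Longrightarrow> norm (P n x) \<le> C * norm x" using P_bounded by metis
  show thesis
  proof (rule that[of "1 + C"])
    fix x n assume "x \<in> X"
    then have "norm (P n x) \<le> C * norm x" by (rule C)
    then show "norm (x - P n x) \<le> (1 + C) * norm x"
      using norm_triangle_ineq4[of x "P n x"] by (simp add: algebra_simps)
  qed (use C in simp)
qed

lemma tail_block_span:
  assumes A: "\<And>j. A j \<subseteq> bs j" and AB: "\<And>j. p \<le> j \<Longrightarrow> A j = B j" and x: "x \<in> block_span A"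
  shows "x - P p x \<in> block_span B"
proof -
  obtain C where C: "\<And>x n. x \<in> X \<Longrightarrow> norm (x - P n x) \<le> C * norm x" using tail_bounded by metis
  show ?thesis
  proof (rule bounded_preimage_closed_span[OF linear_on_tail C subspace_block_span closed_block_span _
        x[unfolded block_span_def]])
    fix s assume "s \<in> (\<Union>j. A j)"
    then obtain j where j: "s \<in> A j" "s \<in> bs j" using A by blast
    have "s - P p s \<in> block_span B"
    proof (cases "j < p")
      case True
      then show ?thesis using P_bs[OF j(2), of p] subspace_0[OF subspace_block_span] by simp
    next
      case False
      then have "s \<in> B j" using j AB by auto
      then have "s \<in> block_span B" by (rule block_span_superset)
      then show ?thesis using P_bs[OF j(2), of p] False by simp
    qed
    then show "s \<in> X \<and> s - P p s \<in> block_span B" using bs_in_X[OF j(2)] by blast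
  qed
qed

lemma P_fixes_head:
  assumes "\<And>j. A j \<subseteq> bs j" "x \<in> span (\<Union>j<p. A j)"
  shows "P p x = x"
proof -
  obtain C where C: "\<And>x n. x \<in> X \<Longrightarrow> norm (x - P n x) \<le> C * norm x" using tail_bounded by metis
  have "x - P p x \<in> {0}"
  proof (rule bounded_preimage_closed_span[OF linear_on_tail C, of "{0}" "\<Union>j<p. A j"])
    show "x \<in> closure (span (\<Union>j<p. A j))" using assms(2) closure_subset by blast
    fix s assume "s \<in> (\<Union>j<p. A j)"
    then obtain j where j: "j < p" "s \<in> bs j" using assms(1) by blast
    then show "s \<in> X \<and> s - P p s \<in> {0}" using bs_in_X P_bs[OF j(2), of p] by simp
  qed (auto simp: subspace_single_0)
  then show ?thesis by simp
qed

text \<open>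
  The parts of \<open>A\<close> and \<open>B\<close> from \<open>p\<close> on agree, so only the heads have to be exchanged; \<open>T\<close> is bounded
  because \<open>P p\<close> is and because the heads have finite dimension. Applied a second time, with \<open>V\<close> and
  \<open>V'\<close> exchanged, the lemma makes \<open>T'\<close> a bounded inverse of \<open>T\<close>.
\<close>

lemma head_swap:
  assumes A: "\<And>j. A j \<subseteq> bs j" and B: "\<And>j. B j \<subseteq> bs j" and AB: "\<And>j. p \<le> j \<Longrightarrow> A j = B j"
    and V: "linear V" "\<And>x. x \<in> span (\<Union>j<p. A j) \<Longrightarrow> V x \<in> span (\<Union>j<p. B j) \<and> V' (V x) = x"
  defines "T \<equiv> \<lambda>x. V (P p x) + (x - P p x)"
  defines "T' \<equiv> \<lambda>x. V' (P p x) + (x - P p x)"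
  shows "bounded_op (block_span A) norm (block_span B) norm T"
    and "\<And>x. x \<in> block_span A \<Longrightarrow> T' (T x) = x"
proof -
  have AX: "x \<in> X" if "x \<in> block_span A" for x using block_span_subset_X[OF A] that by blast
  have head: "P p x \<in> span (\<Union>j<p. A j)" if "x \<in> block_span A" for x
    by (rule P_block_span[OF A that])
  have V_head: "V (P p x) \<in> span (\<Union>j<p. B j)" "V' (V (P p x)) = P p x" if "x \<in> block_span A" for x
    using V(2)[OF head[OF that]] by auto
  have B_head: "span (\<Union>j<p. B j) \<subseteq> block_span B"
  proof -
    have "span (\<Union>j<p. B j) \<subseteq> span (\<Union>j. B j)" by (intro span_mono) auto
    then show ?thesis unfolding block_span_def using closure_subset by blast
  qed
  obtain C where C: "C \<ge> 1" "\<And>x n. x \<in> X \<Longrightarrow> norm (P n x) \<le> C * norm x" using P_bounded by metis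
  obtain C' where C': "\<And>x n. x \<in> X \<Longrightarrow> norm (x - P n x) \<le> C' * norm x" using tail_bounded by metis
  have "finite (\<Union>j<p. A j)" using bs(1) A finite_subset by blast
  then obtain c where c: "c > 0" "\<And>x. x \<in> span (\<Union>j<p. A j) \<Longrightarrow> norm (V x) \<le> c * norm x"
    using linear_bounded_on_span[OF _ V(1)] by blast
  show "bounded_op (block_span A) norm (block_span B) norm T"
    unfolding bounded_op_def
  proof (intro conjI exI[of _ "c * C + C'"] ballI)
    show "linear_on (block_span A) T" unfolding linear_on_def T_def
      using AX by (simp add: P_add P_scale linear_add[OF V(1)] linear_scale[OF V(1)]
          scaleR_right_diff_distrib scaleR_right_distrib)
    show "T ` block_span A \<subseteq> block_span B"
      unfolding T_def using V_head(1) B_head tail_block_span[OF A AB]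
      by (auto intro!: subspace_add[OF subspace_block_span])
    fix x assume x: "x \<in> block_span A"
    have "norm (V (P p x)) \<le> c * norm (P p x)" using head[OF x] by (rule c)
    also have "\<dots> \<le> c * (C * norm x)" using c(1) C(2)[OF AX[OF x]] by (intro mult_left_mono) auto
    finally show "norm (T x) \<le> (c * C + C') * norm x" unfolding T_def
      using C'[OF AX[OF x], of p] norm_triangle_ineq[of "V (P p x)" "x - P p x"]
      by (simp add: algebra_simps)
  qed
  fix x assume x: "x \<in> block_span A"
  have BX: "V (P p x) \<in> X" using V_head(1)[OF x] B_head block_span_subset_X[OF B] by blast
  have PX: "P p x \<in> X" using AX[OF x] by (rule P_in_X)
  have "P p (T x) = P p (V (P p x)) + (P p x - P p (P p x))"
    unfolding T_def using BX PX AX[OF x] subspace_X by (simp add: P_add P_diff subspace_diff)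
  also have "\<dots> = V (P p x)"
    using P_fixes_head[OF B V_head(1)[OF x]] AX[OF x] by (simp add: P_P)
  finally have "P p (T x) = V (P p x)" .
  then show "T' (T x) = x" using V_head(2)[OF x] by (simp add: T'_def, simp add: T_def)
qed

lemma isomorphic_of_equal_heads:
  assumes A: "\<And>j. A j \<subseteq> bs j" and B: "\<And>j. B j \<subseteq> bs j" and AB: "\<And>j. p \<le> j \<Longrightarrow> A j = B j"
    and card: "(\<Sum>j<p. card (A j)) = (\<Sum>j<p. card (B j))"
  shows "isomorphic_on (block_span A) norm (block_span B) norm"
proof -
  have fin: "finite (\<Union>j<p. D j)" and ind: "independent (\<Union>j<p. D j)"
    and cd: "card (\<Union>j<p. D j) = (\<Sum>j<p. card (D j))"
    if D: "\<And>j. D j \<subseteq> bs j" for D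
  proof -
    have f: "finite (D j)" for j using bs(1) D finite_subset by blast
    then show "finite (\<Union>j<p. D j)" by simp
    show "independent (\<Union>j<p. D j)" by (rule independent_mono[OF independent_bs[of p]]) (use D in blast)
    show "card (\<Union>j<p. D j) = (\<Sum>j<p. card (D j))"
      by (rule card_UN_disjoint) (use f D bs_disjoint in blast)+
  qed
  have "card (\<Union>j<p. A j) = card (\<Union>j<p. B j)" using cd[OF A] cd[OF B] card by simp
  then obtain V V' where V: "linear V" "linear V'"
    "\<And>x. x \<in> span (\<Union>j<p. A j) \<Longrightarrow> V x \<in> span (\<Union>j<p. B j) \<and> V' (V x) = x"
    "\<And>x. x \<in> span (\<Union>j<p. B j) \<Longrightarrow> V' x \<in> span (\<Union>j<p. A j) \<and> V (V' x) = x"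
    using linear_extension_inverse[OF ind[OF A] ind[OF B] fin[OF A] fin[OF B]] by blast
  have BA: "B j = A j" if "p \<le> j" for j using AB[OF that] by simp
  show ?thesis unfolding isomorphic_on_def
    using head_swap[OF A B AB V(1,3)] head_swap[OF B A BA V(2,4)] by blast
qed

text \<open>
  The pattern \<open>C True\<close> represents the digit 1 and \<open>C False\<close> the digit 0. They start
  with a finite piece that decides that \<open>N\<close> is avoided. To the right of it the pattern of smaller
  dimension is enlarged by lines, one in each block, until both dimensions agree.
\<close>

lemma block_stage:
  fixes N :: "((nat \<Rightarrow> bool) \<times> (nat \<Rightarrow> bool)) set"
  assumes "closed N" "interior N = {}"
  shows "\<exists>q C. p < q \<and> (\<forall>i j. C i j \<subseteq> bs j) \<and>
      (\<Sum>j\<in>{p..<q}. card (C True j)) = (\<Sum>j\<in>{p..<q}. card (C False j)) \<and>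
      (\<forall>a b. (\<forall>j\<in>{p..<q}. (a j \<longleftrightarrow> C True j = bs j) \<and> (b j \<longleftrightarrow> C False j \<noteq> {})) \<longrightarrow> (a, b) \<notin> N)"
proof -
  obtain q s t where q: "p \<le> q" and avoid: "\<And>a b. (\<forall>i\<in>{p..<q}. a i = s i \<and> b i = t i) \<Longrightarrow> (a, b) \<notin> N"
    using avoid_nowhere_dense[OF assms] by metis
  define v where "v j = (SOME b. b \<in> bs j)" for j
  have v: "v j \<in> bs j" for j unfolding v_def using bs(4) by (simp add: some_in_eq)
  define st where "st i = (if i then s else t)" for i
  define D where "D i = (\<Sum>j\<in>{p..<q}. if st i j then card (bs j) else 0)" for i
  \<comment> \<open>The difference of natural numbers is 0 for the pattern of larger dimension.\<close>
  define C where "C i j = (if j < q then (if st i j then bs j else {})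
      else if j < q + (D (\<not> i) - D i) then {v j} else {})" for i j
  define r where "r = q + max (D True) (D False) + 1"
  have sum: "(\<Sum>j\<in>{p..<r}. card (C i j)) = max (D True) (D False)" for i
  proof -
    let ?m = "D (\<not> i) - D i"
    have "?m \<le> max (D True) (D False)" by (cases i) auto
    then have m: "q + ?m \<le> r" by (simp add: r_def)
    have "(\<Sum>j\<in>{p..<q}. card (C i j)) = D i" unfolding D_def by (intro sum.cong) (auto simp: C_def)
    moreover have "(\<Sum>j\<in>{q..<q + ?m}. card (C i j)) = (\<Sum>j\<in>{q..<q + ?m}. 1)"
      by (intro sum.cong) (auto simp: C_def)
    moreover have "(\<Sum>j\<in>{q + ?m..<r}. card (C i j)) = 0" by (intro sum.neutral) (auto simp: C_def)
    moreover have "(\<Sum>j\<in>{p..<r}. card (C i j)) =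
        (\<Sum>j\<in>{p..<q}. card (C i j)) + ((\<Sum>j\<in>{q..<q + ?m}. card (C i j)) + (\<Sum>j\<in>{q + ?m..<r}. card (C i j)))"
      using q m by (simp add: sum.atLeastLessThan_concat)
    ultimately have "(\<Sum>j\<in>{p..<r}. card (C i j)) = D i + ?m" by simp
    then show ?thesis by (cases i) auto
  qed
  have "(a, b) \<notin> N" if "\<forall>j\<in>{p..<r}. (a j \<longleftrightarrow> C True j = bs j) \<and> (b j \<longleftrightarrow> C False j \<noteq> {})" for a b
  proof (rule avoid, intro ballI)
    fix j assume j: "j \<in> {p..<q}"
    then have "(a j \<longleftrightarrow> C True j = bs j) \<and> (b j \<longleftrightarrow> C False j \<noteq> {})" using that by (auto simp: r_def)
    moreover have "C True j = (if s j then bs j else {})" "C False j = (if t j then bs j else {})"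
      using j by (auto simp: C_def st_def)
    ultimately show "a j = s j \<and> b j = t j" using bs(4)[of j] by auto
  qed
  moreover have "C i j \<subseteq> bs j" for i j using v by (auto simp: C_def)
  moreover have "p < r" using q by (simp add: r_def)
  ultimately show ?thesis using sum by (intro exI[of _ r] exI[of _ C]) auto
qed

text \<open>
  In the proof \<open>pt n\<close> is the left end of the \<open>n\<close>-th interval, \<open>lev j\<close> is the number of the interval that contains
  \<open>j\<close>, and \<open>A \<alpha> j\<close> is the part of the basis of \<open>F\<^sub>j\<close> that \<open>\<alpha>\<close> selects. Preimages under \<open>f\<close> of the generators of
  the Effros structure are even open: if \<open>f \<alpha>\<close> meets an open set, then so does the span of
  finitely many selected blocks, which depends on finitely many digits of \<open>\<alpha>\<close>.
\<close>

lemma ergodic_from_meager_embedding: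
  assumes meag: "meager {(a, b). span_embeds a b}"
  shows "ergodic X"
proof -
  obtain N where N: "\<And>n. closed (N n)" "\<And>n. interior (N n) = {}" "\<And>m n. m \<le> n \<Longrightarrow> N m \<subseteq> N n"
    "{(a, b). span_embeds a b} \<subseteq> (\<Union>n::nat. N n)"
    using meager_increasing[OF meag] by metis
  define stage where "stage p n q C \<longleftrightarrow> p < q \<and> (\<forall>i j. C i j \<subseteq> bs j) \<and>
      (\<Sum>j\<in>{p..<q}. card (C True j)) = (\<Sum>j\<in>{p..<q}. card (C False j)) \<and>
      (\<forall>a b. (\<forall>j\<in>{p..<q}. (a j \<longleftrightarrow> C True j = bs j) \<and> (b j \<longleftrightarrow> C False j \<noteq> {})) \<longrightarrow> (a, b) \<notin> N n)"
    for p n q :: nat and C :: "bool \<Rightarrow> nat \<Rightarrow> 'u set"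
  have "\<exists>q C. stage p n q C" for p n
    unfolding stage_def by (rule block_stage[OF N(1,2)])
  then obtain Q C0 where st0: "\<And>p n. stage p n (Q p n) (C0 p n)" by metis
  define pt where "pt = rec_nat 0 (\<lambda>n p. Q p n)"
  have pt0: "pt 0 = 0" and ptS: "pt (Suc n) = Q (pt n) n" for n by (simp_all add: pt_def)
  define C where "C n = C0 (pt n) n" for n
  have st: "stage (pt n) n (pt (Suc n)) (C n)" for n using st0 by (simp add: C_def ptS)
  have pt_less: "pt n < pt (Suc n)" for n using st by (simp add: stage_def)
  have pt_mono: "pt m \<le> pt n" if "m \<le> n" for m n
    by (rule lift_Suc_mono_le[of pt, OF less_imp_le[OF pt_less] that])
  have C_bs: "C n i j \<subseteq> bs j" for n i j using st[of n] by (simp add: stage_def)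
  have pt_ge: "n \<le> pt n" for n
    by (induction n) (use pt_less in \<open>auto simp: Suc_le_eq intro: le_less_trans\<close>)
  define lev where "lev j = (LEAST n. j < pt (Suc n))" for j
  have lev: "pt (lev j) \<le> j" "j < pt (Suc (lev j))" for j
  proof -
    have "j < pt (Suc j)" using pt_ge[of "Suc j"] by simp
    then show "j < pt (Suc (lev j))" unfolding lev_def by (rule LeastI)
    show "pt (lev j) \<le> j"
    proof (cases "lev j")
      case (Suc n)
      then have "\<not> j < pt (Suc n)" using not_less_Least[of n "\<lambda>n. j < pt (Suc n)"] by (simp add: lev_def)
      then show ?thesis using Suc by simp
    qed (simp add: pt0)
  qed
  have lev_eq: "lev j = n" if "pt n \<le> j" "j < pt (Suc n)" for j n
  proof (rule antisym; rule ccontr)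
    assume "\<not> lev j \<le> n"
    then show False using pt_mono[of "Suc n" "lev j"] lev(1)[of j] that by simp
  next
    assume "\<not> n \<le> lev j"
    then show False using pt_mono[of "Suc (lev j)" n] lev(2)[of j] that by simp
  qed
  have lev_less: "lev j < n" if "j < pt n" for j n
  proof (rule ccontr)
    assume "\<not> lev j < n"
    then show False using pt_mono[of n "lev j"] lev(1)[of j] that by simp
  qed
  have lev_ge: "n \<le> lev j" if "pt n \<le> j" for j n
  proof (rule ccontr)
    assume "\<not> n \<le> lev j"
    then show False using pt_mono[of "Suc (lev j)" n] lev(2)[of j] that by simp
  qed
  define A where "A \<alpha> j = C (lev j) (\<alpha> (lev j)) j" for \<alpha> :: "nat \<Rightarrow> bool" and j
  have A_bs: "A \<alpha> j \<subseteq> bs j" for \<alpha> j by (simp add: A_def C_bs)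
  define f where "f \<alpha> = block_span (A \<alpha>)" for \<alpha>
  have f_Sub: "f \<alpha> \<in> Sub X" for \<alpha>
    using block_span_subset_X[of "A \<alpha>", OF A_bs]
    by (simp add: f_def Sub_def subspace_block_span closed_block_span)
  have heads: "(\<Sum>j<pt n. card (A \<alpha> j)) = (\<Sum>j<pt n. card (A \<beta> j))" for \<alpha> \<beta> n
  proof (induction n)
    case (Suc n)
    have split: "(\<Sum>j<pt (Suc n). g j) = (\<Sum>j<pt n. g j) + (\<Sum>j\<in>{pt n..<pt (Suc n)}. g j)" for g :: "nat \<Rightarrow> nat"
      using pt_less[of n] by (simp add: lessThan_atLeast0 sum.atLeastLessThan_concat)
    have "(\<Sum>j\<in>{pt n..<pt (Suc n)}. card (A \<gamma> j)) = (\<Sum>j\<in>{pt n..<pt (Suc n)}. card (C n (\<gamma> n) j))" for \<gamma>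
      by (intro sum.cong) (auto simp: A_def lev_eq)
    moreover have "(\<Sum>j\<in>{pt n..<pt (Suc n)}. card (C n i j)) = (\<Sum>j\<in>{pt n..<pt (Suc n)}. card (C n True j))" for i
      using st[of n] by (cases i) (auto simp: stage_def)
    ultimately have "(\<Sum>j\<in>{pt n..<pt (Suc n)}. card (A \<alpha> j)) = (\<Sum>j\<in>{pt n..<pt (Suc n)}. card (A \<beta> j))"
      by metis
    then show ?case using Suc by (simp add: split)
  qed (simp add: pt0)
  have E0_iso: "isomorphic_on (f \<alpha>) norm (f \<beta>) norm" if E: "E0 \<alpha> \<beta>" for \<alpha> \<beta>
  proof -
    obtain n where n: "\<And>m. m \<ge> n \<Longrightarrow> \<alpha> m = \<beta> m"
      using E unfolding E0_def eventually_sequentially by blast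
    have "A \<alpha> j = A \<beta> j" if "pt n \<le> j" for j using n[OF lev_ge[OF that]] by (simp add: A_def)
    then show ?thesis unfolding f_def using heads by (intro isomorphic_of_equal_heads A_bs)
  qed
  have not_iso: False
    if inf: "\<exists>\<^sub>\<infinity>n. \<alpha> n \<and> \<not> \<beta> n" and iso: "isomorphic_on (f \<alpha>) norm (f \<beta>) norm" for \<alpha> \<beta>
  proof -
    define a where "a j \<longleftrightarrow> A \<alpha> j = bs j" for j
    define b where "b j \<longleftrightarrow> A \<beta> j \<noteq> {}" for j
    have "closed_span F (Collect a) \<subseteq> f \<alpha>"
      unfolding closed_span_eq_bs f_def block_span_def
      by (intro closure_mono span_mono UN_mono) (auto simp: a_def)
    moreover have "f \<beta> \<subseteq> closed_span F (Collect b)"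
      unfolding closed_span_eq_bs f_def block_span_def
      using A_bs by (intro closure_mono span_mono) (fastforce simp: b_def)
    ultimately have "span_embeds a b"
      using iso f_Sub[of \<alpha>] by (intro embeds_in_of_isomorphic[OF iso]) (auto simp: Sub_def subspace_closed_span)
    then obtain m where m: "(a, b) \<in> N m" using N(4) by blast
    obtain n where n: "n \<ge> m" "\<alpha> n" "\<not> \<beta> n" using inf unfolding INFM_nat_le by blast
    have "\<forall>j\<in>{pt n..<pt (Suc n)}. (a j \<longleftrightarrow> C n True j = bs j) \<and> (b j \<longleftrightarrow> C n False j \<noteq> {})"
    proof
      fix j assume "j \<in> {pt n..<pt (Suc n)}"
      then have "lev j = n" by (intro lev_eq) auto
      then have "A \<alpha> j = C n True j" "A \<beta> j = C n False j" using n(2,3) by (simp_all add: A_def)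
      then show "(a j \<longleftrightarrow> C n True j = bs j) \<and> (b j \<longleftrightarrow> C n False j \<noteq> {})" by (simp add: a_def b_def)
    qed
    then have "(a, b) \<notin> N n" using st[of n] by (simp add: stage_def)
    then show False using m N(3)[OF n(1)] by blast
  qed
  have iso_E0: "E0 \<alpha> \<beta>" if iso: "isomorphic_on (f \<alpha>) norm (f \<beta>) norm" for \<alpha> \<beta>
  proof (rule ccontr)
    assume "\<not> E0 \<alpha> \<beta>"
    then have "\<exists>\<^sub>\<infinity>n. \<alpha> n \<noteq> \<beta> n"
      by (simp add: E0_def not_eventually cofinite_eq_sequentially)
    then have "\<exists>\<^sub>\<infinity>n. (\<alpha> n \<and> \<not> \<beta> n) \<or> (\<beta> n \<and> \<not> \<alpha> n)" by (rule INFM_mono) auto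
    then have "(\<exists>\<^sub>\<infinity>n. \<alpha> n \<and> \<not> \<beta> n) \<or> (\<exists>\<^sub>\<infinity>n. \<beta> n \<and> \<not> \<alpha> n)" by (simp add: INFM_disj_distrib)
    then show False using not_iso[OF _ iso] not_iso[OF _ isomorphic_on_sym[OF iso]] by blast
  qed
  have "f \<in> measurable (borel :: (nat \<Rightarrow> bool) measure) (effros X)"
    unfolding effros_def
  proof (rule measurable_measure_of)
    show "{{Y \<in> Sub X. Y \<inter> U \<noteq> {}} |U. openin (top_of_set X) U} \<subseteq> Pow (Sub X)" by auto
    show "f \<in> space borel \<rightarrow> Sub X" using f_Sub by simp
    fix \<Y> assume "\<Y> \<in> {{Y \<in> Sub X. Y \<inter> U \<noteq> {}} |U. openin (top_of_set X) U}"
    then obtain U where U: "openin (top_of_set X) U" "\<Y> = {Y \<in> Sub X. Y \<inter> U \<noteq> {}}" by blast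
    obtain O' where O': "open O'" "U = X \<inter> O'" using U(1) unfolding openin_open by blast
    have "open (f -` \<Y>)" unfolding open_cantor_iff
    proof
      fix \<alpha> assume "\<alpha> \<in> f -` \<Y>"
      then have "f \<alpha> \<inter> O' \<noteq> {}" using U(2) O'(2) by blast
      then have "O' \<inter> span (\<Union>j. A \<alpha> j) \<noteq> {}"
        using open_Int_closure_eq_empty[OF O'(1)] by (auto simp: f_def block_span_def)
      then obtain x where x: "x \<in> O'" "x \<in> span (\<Union>j. A \<alpha> j)" by blast
      obtain p where p: "x \<in> span (\<Union>j<p. A \<alpha> j)" using span_UN_finite_stage[OF x(2)] by blast
      have "\<beta> \<in> f -` \<Y>" if ag: "agree p \<alpha> \<beta>" for \<beta>
      proof -
        have "A \<alpha> j = A \<beta> j" if "j < p" for j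
          using lev_less[of j p] that pt_ge[of p] ag by (simp add: A_def agree_def)
        then have "(\<Union>j<p. A \<alpha> j) \<subseteq> (\<Union>j. A \<beta> j)" by auto
        then have "x \<in> span (\<Union>j. A \<beta> j)" using p span_mono by blast
        then have "x \<in> f \<beta>" unfolding f_def block_span_def using closure_subset by blast
        then have "x \<in> f \<beta> \<inter> U" using f_Sub[of \<beta>] x(1) O'(2) by (auto simp: Sub_def)
        then show ?thesis using U(2) f_Sub[of \<beta>] by auto
      qed
      then show "\<exists>n. \<forall>\<beta>. agree n \<alpha> \<beta> \<longrightarrow> \<beta> \<in> f -` \<Y>" by blast
    qed
    then show "f -` \<Y> \<inter> space borel \<in> sets borel" by simp
  qed
  then show ?thesis unfolding ergodic_def using separable_X E0_iso iso_E0 by blast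
qed

end

theorem theorem1p30:
  fixes d :: "'u::banach set \<Rightarrow> ('u \<Rightarrow> real) \<Rightarrow> 'u set \<Rightarrow> real"
    and X :: "'u set"
    and F :: "nat \<Rightarrow> 'u set"
  assumes "is_degree d"
    and "subspace X" and "closed X" and "\<not> finite_dim X"
    and "d_large d X norm"
    and "is_FDD F X"
    and "\<forall>Z N. banach_on Z N \<and> \<not> finite_dim Z \<and> d_large d Z N \<longrightarrow> tight_in Z N F"
  shows "ergodic X"
proof -
  interpret fdd F X by unfold_locales (use assms in auto)
  show ?thesis
    by (rule ergodic_from_meager_embedding, rule embedding_relation_meager[OF assms(1,5)])
      (use assms(7) in blast)
qed

end
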